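(* Let $p\in\mathbb{C}$. The linear map $\pi:U_q[gl(n/m)]\to W(n-1/m)$ defined on the generators by $$\pi(h_1)=p-N,\qquad \pi(h_i)=N_{i-1},\quad i=2,\ldots,n+m=r,$$ $$\pi(e_1)=\sqrt{[p-N]}\;\langle N_1+1\rangle A_1^-,\qquad \pi(f_1)=\sqrt{[p-N+1]}\;\langle N_1\rangle A_1^+,$$ $$\pi(e_i)=\langle N_{i-1}\rangle\langle N_i+1\rangle A_{i-1}^+A_i^-,\quad i=2,\ldots,r-1,$$ $$\pi(f_i)=\langle N_{i-1}+1\rangle\langle N_i\rangle A_i^+A_{i-1}^-,\quad i=2,\ldots,r-1,$$ is a homomorphism of $U_q[gl(n/m)]$ into $W(n-1/m)$. If $p\in\mathbb{N}=\{1,2,\ldots\}$, then the subspaces $\mathcal{F}_0(p;n-1,m)$ and $\mathcal{F}_1(p;n-1,m)$ of the Fock space $\mathcal{F}(n-1/m)$ are invariant under $\pi(U_q[gl(n/m)])$; the subspace $\mathcal{F}_0(p;n-1,m)$ carries a finite-dimensional irreducible representation of $U_q[gl(n/m)]$; and, provided $h\in\mathbb{R}$, this representation is unitarizable with respect to the anti-involution $\omega$ and the metric (scalar product) for which the basis vectors $|l_1,\ldots,l_{r-1})$ are orthonormal, i.e. $(\pi(a)x,y)=(x,\pi(\omega(a))y)$ for all $a\in U_q[gl(n/m)]$ and $x,y\in\mathcal{F}_0(p;n-1,m)$. The representations in $\mathcal{F}_0(p;n-1,m)$ corresponding to different $p\in\mathbb{N}$ are inequivalent.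
   Context: Throughout $n\ge 1$, $m\ge 0$ are integers with $r:=n+m\ge 2$; $\mathbb{C}[[h]]$ is the algebra of formal power series in the indeterminate $h$, $q=e^{h/2}\in\mathbb{C}[[h]]$, and $\bar q=q^{-1}$. For $x$ a number or an operator, $[x]=\dfrac{q^x-\bar q^{\,x}}{q-\bar q}$. The parities $\theta_i\in\mathbb{Z}_2=\{\bar 0,\bar 1\}$ are $\theta_i=\bar 0$ if $i<n$ and $\theta_i=\bar 1$ if $i\ge n$. **The superalgebra $U_q[gl(n/m)]$.** It is the associative unital superalgebra over $\mathbb{C}[[h]]$, topologically free as a $\mathbb{C}[[h]]$-module (complete in the $h$-adic topology), with generators $h_j$ ($j=1,\ldots,r$) and $e_i,f_i$ ($i=1,\ldots,r-1$), with degrees $\deg(h_i)=\bar 0$, $\deg(e_j)=\deg(f_j)=\theta_{j-1}+\theta_j$ (so $e_n,f_n$ are odd and all other generators are even), subject to the following relations, where indices run over all values for which the generators involved exist. (It also carries a Hopf structure, which is not used here.) Cartan-Kac relations (the $h_i$ commute with each other): $[h_i,e_j]=(\delta_{ij}-\delta_{i,j+1})e_j$; $[h_i,f_j]=(-\delta_{ij}+\delta_{i,j+1})f_j$; $e_if_j-f_je_i=0$ if $i\ne j$; $e_if_i-f_ie_i=\dfrac{q^{h_i-h_{i+1}}-q^{-h_i+h_{i+1}}}{q-q^{-1}}$ if $i\neq n$; $e_nf_n+f_ne_n=\dfrac{q^{h_n+h_{n+1}}-q^{-h_n-h_{n+1}}}{q-q^{-1}}$. $e$-Serre relations: $e_ie_j=e_je_i$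 if $|i-j|\ne 1$; $e_n^2=0$; $e_i^2e_{i+1}-(q+q^{-1})e_ie_{i+1}e_i+e_{i+1}e_i^2=0$ for $i\in\{1,\ldots,n-1\}\cup\{n+1,\ldots,n+m-2\}$; $e_{i+1}^2e_i-(q+q^{-1})e_{i+1}e_ie_{i+1}+e_ie_{i+1}^2=0$ for $i\in\{1,\ldots,n-2\}\cup\{n,\ldots,n+m-2\}$; $e_ne_{n-1}e_ne_{n+1}+e_{n-1}e_ne_{n+1}e_n+e_ne_{n+1}e_ne_{n-1}+e_{n+1}e_ne_{n-1}e_n-(q+q^{-1})e_ne_{n-1}e_{n+1}e_n=0$. $f$-Serre relations: those obtained from the $e$-Serre relations by replacing every $e_i$ by $f_i$. **The algebra $W(n-1/m)$.** It is the associative unital superalgebra over $\mathbb{C}[[h]]$, topologically free as a $\mathbb{C}[[h]]$-module (complete in the $h$-adic topology), with generators $A_1^\pm,\ldots,A_{n+m-1}^\pm$ of degrees $\deg(A_i^\pm)=\theta_i$, subject to the relations $[\![A_i^-,A_j^+]\!]=\delta_{ij}$, $[\![A_i^+,A_j^+]\!]=[\![A_i^-,A_j^-]\!]=0$, where $[\![x,y]\!]=xy-(-1)^{\deg(x)\deg(y)}yx$ for homogeneous $x,y$. Thus $A_1^\pm,\ldots,A_{n-1}^\pm$ are Bose creation and annihilation operators, $A_n^\pm,\ldots,A_{n+m-1}^\pm$ are Fermi creation and annihilation operators, and Bose operators commute with Fermi operators. Set $N_i=A_i^+A_i^-$, $N=N_1+\cdots+N_{n+m-1}$, and $$\langle N_i+c\rangle=\left(\frac{[N_i+c]}{N_i+c}\right)^{(1-\theta_i)/2},$$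 so $\langle N_i+c\rangle$ is the square root of $\frac{[N_i+c]}{N_i+c}$ for $i<n$ and equals $1$ for $i\ge n$ (in the exponent $\theta_i$ is read as the integer $0$ or $1$). **Functions of the number operators.** $W(n-1/m)$ is understood to be completed so that the functions of $N_1,\ldots,N_{n+m-1}$ appearing in the formulas are elements of it; they obey $F(N_i)A_i^{\pm}=A_i^{\pm}F(N_i\pm1)$, and in the Fock space below they act diagonally, $F(N_1,\ldots,N_{r-1})|l)=F(l_1,\ldots,l_{r-1})|l)$. The expressions $\sqrt{[p-N]}$ and $\sqrt{[p-N+1]}$ denote one and the same function $x\mapsto\sqrt{[x]}$ (satisfying $\sqrt{[x]}^{\,2}=[x]$, nonnegative when $[x]\ge 0$) evaluated at $x=p-N$ and $x=p-N+1$. **Numerical $h,q$.** One may also take $h,q=e^{h/2}$ to be complex numbers, with $q$ not a root of $1$ (replacing $U_q[gl(n/m)]$ and $W(n-1/m)$ by their quotients by the relation $q=$ number, which are complex associative algebras); all the considerations remain valid. The condition $h\in\mathbb{R}$ refers to this case. **Fock space.** $\mathcal{F}(n-1/m)$ is the Fock space of $W(n-1/m)$, with vacuum $|0\rangle$ satisfying $A_i^-|0\rangle=0$ for all $i$, and with basis, declared orthonormal, $$|l)\equiv|l_1,\ldots,l_{r-1})=\frac{(A_1^+)^{l_1}\cdots(A_{r-1}^+)^{l_{r-1}}}{\sqrt{l_1!\cdots l_{r-1}!}}|0\rangle,$$ where $l_1,\ldots,l_{n-1}\in\{0,1,2,\ldots\}$ and $l_n,\ldots,l_{r-1}\in\{0,1\}$.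 For $p\in\mathbb{N}$, $\mathcal{F}_1(p;n-1,m)$ is the linear span of the $|l_1,\ldots,l_{r-1})$ with $l_1+\cdots+l_{r-1}>p$, and $\mathcal{F}_0(p;n-1,m)$ is the linear span of those with $l_1+\cdots+l_{r-1}\le p$. $U_q[gl(n/m)]$ acts on the Fock space through $\pi$. **Anti-involution.** $\omega:U_q[gl(n/m)]\to U_q[gl(n/m)]$ is the antilinear anti-involution defined on the generators by $\omega(h_i)=h_i$, $\omega(e_i)=f_i$ (hence $\omega(f_i)=e_i$). *)

theory Defs
  imports
    Complex_Main
    "HOL-Library.Poly_Mapping"
    "HOL-Library.Nonpos_Ints"
    "HOL-Computational_Algebra.Formal_Power_Series"
    "HOL-Algebra.Module"
    "HOL-Algebra.QuotRing"
begin

unbundle fps_syntax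

section \<open>Free algebras and quotient algebras\<close>

instantiation list :: (type) monoid_add
begin

definition zero_list :: "'a list" where "zero_list = []"

definition plus_list :: "'a list \<Rightarrow> 'a list \<Rightarrow> 'a list" where "plus_list = (@)"

instance by standard (simp_all add: zero_list_def plus_list_def)

end

text \<open>
  With concatenation as addition of words, the convolution product on finitely supported
  functions makes this the free unital associative complex algebra on \<open>'g\<close>.
  Its power series ring \<open>'g free_alg fps\<close> is the free \<open>h\<close>-adically complete algebra
  over \<open>complex fps\<close>; the indeterminate \<open>h\<close> is \<^const>\<open>fps_X\<close>.
\<close>

type_synonym 'g free_alg = "'g list \<Rightarrow>\<^sub>0 complex"

definition fgen :: "'g \<Rightarrow> 'g free_alg" where
  "fgen g = Poly_Mapping.single [g] 1"

definition fconst :: "complex \<Rightarrow> 'g free_alg" where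
  "fconst c = Poly_Mapping.single [] c"

definition fgen_h :: "'g \<Rightarrow> 'g free_alg fps" where
  "fgen_h g = fps_const (fgen g)"

definition fconst_h :: "complex fps \<Rightarrow> 'g free_alg fps" where
  "fconst_h c = Abs_fps (\<lambda>k. fconst (c $ k))"

definition type_ring :: "'a::ring_1 ring" where
  "type_ring = \<lparr>carrier = UNIV, monoid.mult = (*), one = 1, zero = 0, add = (+)\<rparr>"

definition cls :: "'a::ring_1 set \<Rightarrow> 'a \<Rightarrow> 'a set" where
  "cls I x = I +>\<^bsub>type_ring\<^esub> x"

text \<open>The quotient ring by \<open>I\<close>, with the scalar multiplication induced by \<open>sc\<close>.\<close>

definition quot_alg :: "('k \<Rightarrow> 'a \<Rightarrow> 'a) \<Rightarrow> 'a::ring_1 set \<Rightarrow> ('k, 'a set) module" where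
  "quot_alg sc I =
     ring.extend (type_ring Quot I) (module.fields (\<lambda>c X. \<Union>x\<in>X. cls I (sc c x)))"

definition alg_hom :: "('k, 'a, 'x) module_scheme \<Rightarrow> ('k, 'b, 'y) module_scheme \<Rightarrow> ('a \<Rightarrow> 'b) set"
  where "alg_hom A B =
    {\<phi> \<in> ring_hom A B. \<forall>c. \<forall>x\<in>carrier A. \<phi> (c \<odot>\<^bsub>A\<^esub> x) = c \<odot>\<^bsub>B\<^esub> \<phi> x}"

text \<open>
  The smallest two-sided ideal containing \<open>S\<close> that is closed in the \<open>h\<close>-adic topology and
  whose quotient has no \<open>h\<close>-torsion. A separated, complete and torsion-free
  \<open>complex fps\<close>-module is the same thing as a topologically free one, so the quotient is the
  topologically free algebra with relations \<open>S\<close>.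
\<close>

definition top_ideal :: "'a::ring_1 fps set \<Rightarrow> 'a fps set" where
  "top_ideal S = \<Inter>{I. ideal I type_ring \<and> S \<subseteq> I \<and> closed I \<and>
                       (\<forall>x. fps_X * x \<in> I \<longrightarrow> x \<in> I)}"

subsection \<open>Gradings\<close>

text \<open>Elements of \<open>\<int>\<^sub>2\<close> are booleans, \<^const>\<open>True\<close> standing for the odd degree.\<close>

definition theta :: "nat \<Rightarrow> nat \<Rightarrow> bool" where
  "theta n i \<longleftrightarrow> n \<le> i"

definition homog :: "('g \<Rightarrow> bool) \<Rightarrow> bool \<Rightarrow> 'g free_alg set" where
  "homog deg d = {a. \<forall>w \<in> Poly_Mapping.keys a. odd (length (filter deg w)) = d}"

definition homog_h :: "('g \<Rightarrow> bool) \<Rightarrow> bool \<Rightarrow> 'g free_alg fps set" where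
  "homog_h deg d = {a. \<forall>k. a $ k \<in> homog deg d}"


section \<open>The quantum superalgebra\<close>

subsection \<open>Relations common to formal and numerical \<open>q\<close>\<close>

text \<open>
  A relation \<open>x = y\<close> is encoded by the element \<open>x - y\<close>. Generators whose index is out of range
  are set to zero. \<open>qs\<close> stands for \<open>q + q\<^sup>-\<^sup>1\<close>.
\<close>

definition serre_rels :: "nat \<Rightarrow> nat \<Rightarrow> 'a::ring_1 \<Rightarrow> (nat \<Rightarrow> 'a) \<Rightarrow> 'a set" where
  "serre_rels n m qs e =
     {e i * e j - e j * e i | i j. i \<in> {1..<n+m} \<and> j \<in> {1..<n+m} \<and> i \<noteq> j + 1 \<and> j \<noteq> i + 1}
   \<union> {e n ^ 2 | _::unit. n \<in> {1..<n+m}}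
   \<union> {e i ^ 2 * e (i+1) - qs * (e i * e (i+1) * e i) + e (i+1) * e i ^ 2 | i.
        i \<in> {1..<n+m} \<and> i + 1 \<in> {1..<n+m} \<and> i \<noteq> n}
   \<union> {e (i+1) ^ 2 * e i - qs * (e (i+1) * e i * e (i+1)) + e i * e (i+1) ^ 2 | i.
        i \<in> {1..<n+m} \<and> i + 1 \<in> {1..<n+m} \<and> i + 1 \<noteq> n}
   \<union> {e n * e (n-1) * e n * e (n+1) + e (n-1) * e n * e (n+1) * e n
        + e n * e (n+1) * e n * e (n-1) + e (n+1) * e n * e (n-1) * e n
        - qs * (e n * e (n-1) * e (n+1) * e n) | _::unit.
        n - 1 \<in> {1..<n+m} \<and> n + 1 \<in> {1..<n+m}}"

text \<open>\<open>b i\<close> is the right-hand side of the (anti)commutation relation between \<open>e i\<close> and \<open>f i\<close>.\<close>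

definition gl_rels ::
  "nat \<Rightarrow> nat \<Rightarrow> 'a::ring_1 \<Rightarrow> (nat \<Rightarrow> 'a) \<Rightarrow> (nat \<Rightarrow> 'a) \<Rightarrow> (nat \<Rightarrow> 'a) \<Rightarrow> (nat \<Rightarrow> 'a) \<Rightarrow> 'a set"
  where
  "gl_rels n m qs b h e f =
     {h i | i. i \<notin> {1..n+m}} \<union> {e i | i. i \<notin> {1..<n+m}} \<union> {f i | i. i \<notin> {1..<n+m}}
   \<union> {h i * h j - h j * h i | i j. i \<in> {1..n+m} \<and> j \<in> {1..n+m}}
   \<union> {h i * e j - e j * h i - (of_bool (i = j) - of_bool (i = j + 1)) * e j | i j.
        i \<in> {1..n+m} \<and> j \<in> {1..<n+m}}
   \<union> {h i * f j - f j * h i - (- of_bool (i = j) + of_bool (i = j + 1)) * f j | i j.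
        i \<in> {1..n+m} \<and> j \<in> {1..<n+m}}
   \<union> {e i * f j - f j * e i | i j. i \<in> {1..<n+m} \<and> j \<in> {1..<n+m} \<and> i \<noteq> j}
   \<union> {e i * f i - f i * e i - b i | i. i \<in> {1..<n+m} \<and> i \<noteq> n}
   \<union> {e i * f i + f i * e i - b i | i. i \<in> {1..<n+m} \<and> i = n}
   \<union> serre_rels n m qs e \<union> serre_rels n m qs f"

subsection \<open>Formal \<open>q\<close>\<close>

datatype ugen = GH nat | GE nat | GF nat

fun udeg :: "nat \<Rightarrow> ugen \<Rightarrow> bool" where
  "udeg n (GH i) = False"
| "udeg n (GE i) = (theta n (i - 1) \<noteq> theta n i)"
| "udeg n (GF i) = (theta n (i - 1) \<noteq> theta n i)"

text \<open>\<open>q\<^sup>x = exp (h x / 2)\<close> for \<open>x\<close> in the free algebra.\<close>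

definition qpow_free :: "'g free_alg \<Rightarrow> 'g free_alg fps" where
  "qpow_free x = Abs_fps (\<lambda>k. fconst (1 / (2 ^ k * fact k)) * x ^ k)"

text \<open>
  \<open>[x] = (q\<^sup>x - q\<^sup>-\<^sup>x) / (q - q\<^sup>-\<^sup>1)\<close>. Numerator and denominator have zero constant term; the
  common factor \<open>h\<close> is cancelled by the shifts, after which the denominator is a unit.
\<close>

definition qbr_free :: "'g free_alg \<Rightarrow> 'g free_alg fps" where
  "qbr_free x = fconst_h (inverse (fps_shift 1 (fps_exp (1/2) - fps_exp (-1/2))))
                * fps_shift 1 (qpow_free x - qpow_free (- x))"

definition U_ideal_h :: "nat \<Rightarrow> nat \<Rightarrow> ugen free_alg fps set" where
  "U_ideal_h n m = top_ideal
     (gl_rels n m (fconst_h (fps_exp (1/2) + fps_exp (-1/2)))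
        (\<lambda>i. if i \<noteq> n then qbr_free (fgen (GH i) - fgen (GH (i+1)))
             else qbr_free (fgen (GH i) + fgen (GH (i+1))))
        (\<lambda>i. fgen_h (GH i)) (\<lambda>i. fgen_h (GE i)) (\<lambda>i. fgen_h (GF i)))"

definition U_alg_h :: "nat \<Rightarrow> nat \<Rightarrow> (complex fps, ugen free_alg fps set) module" where
  "U_alg_h n m = quot_alg (\<lambda>c x. fconst_h c * x) (U_ideal_h n m)"

definition U_part_h :: "nat \<Rightarrow> nat \<Rightarrow> bool \<Rightarrow> ugen free_alg fps set set" where
  "U_part_h n m d = cls (U_ideal_h n m) ` homog_h (udeg n) d"

subsection \<open>Numerical \<open>q\<close>\<close>

text \<open>
  Here \<open>q\<close> is \<open>exp (h / 2)\<close> for a complex number \<open>h\<close>. As the exponential series of an abstract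
  generator no longer makes sense, \<open>CQ i\<close> and \<open>CQi i\<close>, standing for \<open>q\<close> to the power \<open>h\<^sub>i\<close>
  and \<open>- h\<^sub>i\<close>, are generators, subject to the relations which they satisfy for formal \<open>q\<close>.
\<close>

datatype cgen = CH nat | CE nat | CF nat | CQ nat | CQi nat

fun cdeg :: "nat \<Rightarrow> cgen \<Rightarrow> bool" where
  "cdeg n (CE i) = (theta n (i - 1) \<noteq> theta n i)"
| "cdeg n (CF i) = (theta n (i - 1) \<noteq> theta n i)"
| "cdeg n _ = False"

definition q_rels :: "nat \<Rightarrow> nat \<Rightarrow> complex \<Rightarrow> cgen free_alg set" where
  "q_rels n m q =
     {fgen (CQ i) | i. i \<notin> {1..n+m}} \<union> {fgen (CQi i) | i. i \<notin> {1..n+m}}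
   \<union> {fgen (CQ i) * fgen (CQi i) - 1 | i. i \<in> {1..n+m}}
   \<union> {fgen (CQi i) * fgen (CQ i) - 1 | i. i \<in> {1..n+m}}
   \<union> {fgen (CQ i) * fgen (CQ j) - fgen (CQ j) * fgen (CQ i) | i j. i \<in> {1..n+m} \<and> j \<in> {1..n+m}}
   \<union> {fgen (CQ i) * fgen (CH j) - fgen (CH j) * fgen (CQ i) | i j. i \<in> {1..n+m} \<and> j \<in> {1..n+m}}
   \<union> {fgen (CQ i) * fgen (CE j)
        - fconst (q powi (of_bool (i = j) - of_bool (i = j + 1))) * fgen (CE j) * fgen (CQ i) | i j.
        i \<in> {1..n+m} \<and> j \<in> {1..<n+m}}
   \<union> {fgen (CQ i) * fgen (CF j)
        - fconst (q powi (- of_bool (i = j) + of_bool (i = j + 1))) * fgen (CF j) * fgen (CQ i) | i j.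
        i \<in> {1..n+m} \<and> j \<in> {1..<n+m}}"

definition U_ideal_c :: "nat \<Rightarrow> nat \<Rightarrow> complex \<Rightarrow> cgen free_alg set" where
  "U_ideal_c n m h = genideal type_ring
     (gl_rels n m (fconst (exp (h/2) + exp (-h/2)))
        (\<lambda>i. fconst (1 / (exp (h/2) - exp (-h/2))) *
             (if i \<noteq> n then fgen (CQ i) * fgen (CQi (i+1)) - fgen (CQi i) * fgen (CQ (i+1))
              else fgen (CQ i) * fgen (CQ (i+1)) - fgen (CQi i) * fgen (CQi (i+1))))
        (\<lambda>i. fgen (CH i)) (\<lambda>i. fgen (CE i)) (\<lambda>i. fgen (CF i))
      \<union> q_rels n m (exp (h/2)))"

definition U_alg_c :: "nat \<Rightarrow> nat \<Rightarrow> complex \<Rightarrow> (complex, cgen free_alg set) module" where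
  "U_alg_c n m h = quot_alg (\<lambda>c x. fconst c * x) (U_ideal_c n m h)"

definition U_part_c :: "nat \<Rightarrow> nat \<Rightarrow> complex \<Rightarrow> bool \<Rightarrow> cgen free_alg set set" where
  "U_part_c n m h d = cls (U_ideal_c n m h) ` homog (cdeg n) d"

text \<open>The antilinear anti-involution; for real \<open>h\<close> it fixes the powers of \<open>q\<close> by the \<open>h\<^sub>i\<close>.\<close>

definition is_omega ::
  "nat \<Rightarrow> nat \<Rightarrow> complex \<Rightarrow> (cgen free_alg set \<Rightarrow> cgen free_alg set) \<Rightarrow> bool" where
  "is_omega n m h \<omega> \<longleftrightarrow> (let A = U_alg_c n m h; I = U_ideal_c n m h in
     \<omega> \<in> carrier A \<rightarrow> carrier A \<and> \<omega> \<one>\<^bsub>A\<^esub> = \<one>\<^bsub>A\<^esub> \<and>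
     (\<forall>x\<in>carrier A. \<forall>y\<in>carrier A. \<omega> (x \<oplus>\<^bsub>A\<^esub> y) = \<omega> x \<oplus>\<^bsub>A\<^esub> \<omega> y \<and>
                                  \<omega> (x \<otimes>\<^bsub>A\<^esub> y) = \<omega> y \<otimes>\<^bsub>A\<^esub> \<omega> x) \<and>
     (\<forall>c. \<forall>x\<in>carrier A. \<omega> (c \<odot>\<^bsub>A\<^esub> x) = cnj c \<odot>\<^bsub>A\<^esub> \<omega> x) \<and>
     (\<forall>x\<in>carrier A. \<omega> (\<omega> x) = x) \<and>
     (\<forall>i\<in>{1..n+m}. \<omega> (cls I (fgen (CH i))) = cls I (fgen (CH i)) \<and>
                     \<omega> (cls I (fgen (CQ i))) = cls I (fgen (CQ i)) \<and>
                     \<omega> (cls I (fgen (CQi i))) = cls I (fgen (CQi i))) \<and>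
     (\<forall>i\<in>{1..<n+m}. \<omega> (cls I (fgen (CE i))) = cls I (fgen (CF i)) \<and>
                      \<omega> (cls I (fgen (CF i))) = cls I (fgen (CE i))))"


section \<open>The algebra of Bose and Fermi operators\<close>

text \<open>
  \<open>Cr i\<close> and \<open>An i\<close> are the creation and annihilation operators. The completion is obtained by
  adjoining an element \<open>Fn \<phi>\<close> for every complex function \<open>\<phi>\<close> of the number operators; \<open>\<phi>\<close> takes
  its arguments from the coordinates \<open>1, \<dots>, n+m-1\<close> of a sequence.
\<close>

datatype wgen = Cr nat | An nat | Fn "(nat \<Rightarrow> complex) \<Rightarrow> complex"

fun wdeg :: "nat \<Rightarrow> wgen \<Rightarrow> bool" where
  "wdeg n (Cr i) = theta n i"
| "wdeg n (An i) = theta n i"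
| "wdeg n (Fn \<phi>) = False"

definition supercomm :: "nat \<Rightarrow> wgen \<Rightarrow> wgen \<Rightarrow> wgen free_alg" where
  "supercomm n x y = fgen x * fgen y
     - (if wdeg n x \<and> wdeg n y then -1 else 1) * (fgen y * fgen x)"

definition W_rels :: "nat \<Rightarrow> nat \<Rightarrow> wgen free_alg set" where
  "W_rels n m =
     {fgen (Cr i) | i. i \<notin> {1..<n+m}} \<union> {fgen (An i) | i. i \<notin> {1..<n+m}}
   \<union> {supercomm n (An i) (Cr j) - of_bool (i = j) | i j. i \<in> {1..<n+m} \<and> j \<in> {1..<n+m}}
   \<union> {supercomm n (Cr i) (Cr j) | i j. i \<in> {1..<n+m} \<and> j \<in> {1..<n+m}}
   \<union> {supercomm n (An i) (An j) | i j. i \<in> {1..<n+m} \<and> j \<in> {1..<n+m}}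
   \<union> {fgen (Fn \<phi>) - fgen (Fn \<psi>) | \<phi> \<psi>. \<forall>x. (\<forall>i. i \<notin> {1..<n+m} \<longrightarrow> x i = 0) \<longrightarrow> \<phi> x = \<psi> x}
   \<union> {fgen (Fn (\<lambda>x. \<phi> x + \<psi> x)) - (fgen (Fn \<phi>) + fgen (Fn \<psi>)) | \<phi> \<psi>. True}
   \<union> {fgen (Fn (\<lambda>x. \<phi> x * \<psi> x)) - fgen (Fn \<phi>) * fgen (Fn \<psi>) | \<phi> \<psi>. True}
   \<union> {fgen (Fn (\<lambda>x. c)) - fconst c | c. True}
   \<union> {fgen (Fn (\<lambda>x. x i)) - fgen (Cr i) * fgen (An i) | i. i \<in> {1..<n+m}}
   \<union> {fgen (Fn \<phi>) * fgen (Cr i) - fgen (Cr i) * fgen (Fn (\<lambda>x. \<phi> (x(i := x i + 1)))) | \<phi> i.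
        i \<in> {1..<n+m}}
   \<union> {fgen (Fn \<phi>) * fgen (An i) - fgen (An i) * fgen (Fn (\<lambda>x. \<phi> (x(i := x i - 1)))) | \<phi> i.
        i \<in> {1..<n+m}}"

definition W_ideal_c :: "nat \<Rightarrow> nat \<Rightarrow> wgen free_alg set" where
  "W_ideal_c n m = genideal type_ring (W_rels n m)"

definition W_ideal_h :: "nat \<Rightarrow> nat \<Rightarrow> wgen free_alg fps set" where
  "W_ideal_h n m = top_ideal (fps_const ` W_rels n m)"

definition W_alg_c :: "nat \<Rightarrow> nat \<Rightarrow> (complex, wgen free_alg set) module" where
  "W_alg_c n m = quot_alg (\<lambda>c x. fconst c * x) (W_ideal_c n m)"

definition W_alg_h :: "nat \<Rightarrow> nat \<Rightarrow> (complex fps, wgen free_alg fps set) module" where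
  "W_alg_h n m = quot_alg (\<lambda>c x. fconst_h c * x) (W_ideal_h n m)"

definition W_part_c :: "nat \<Rightarrow> nat \<Rightarrow> bool \<Rightarrow> wgen free_alg set set" where
  "W_part_c n m d = cls (W_ideal_c n m) ` homog (wdeg n) d"

definition W_part_h :: "nat \<Rightarrow> nat \<Rightarrow> bool \<Rightarrow> wgen free_alg fps set set" where
  "W_part_h n m d = cls (W_ideal_h n m) ` homog_h (wdeg n) d"

text \<open>The element given by a function of the number operators with values in \<open>complex fps\<close>.\<close>

definition fn_h :: "((nat \<Rightarrow> complex) \<Rightarrow> complex fps) \<Rightarrow> wgen free_alg fps" where
  "fn_h \<phi> = Abs_fps (\<lambda>k. fgen (Fn (\<lambda>x. \<phi> x $ k)))"


section \<open>The homomorphism\<close>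

definition qnum_h :: "complex \<Rightarrow> complex fps" where
  "qnum_h x = (fps_exp (x/2) - fps_exp (- x/2)) / (fps_exp (1/2) - fps_exp (-1/2))"

definition qnum_c :: "complex \<Rightarrow> complex \<Rightarrow> complex" where
  "qnum_c h x = (exp (h * x / 2) - exp (- (h * x / 2))) / (exp (h / 2) - exp (- h / 2))"

text \<open>
  \<open>s\<close> is a choice of the function \<open>x \<mapsto> sqrt [x]\<close>, and \<open>t\<close> is a choice of
  \<open>x \<mapsto> sqrt ([x] / x)\<close>, whose value at the removable singularity \<open>0\<close> is left arbitrary.
\<close>

definition is_roots_h :: "(complex \<Rightarrow> complex fps) \<Rightarrow> (complex \<Rightarrow> complex fps) \<Rightarrow> bool" where
  "is_roots_h s t \<longleftrightarrow> (\<forall>x. (s x)^2 = qnum_h x) \<and>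
                     (\<forall>x. x \<noteq> 0 \<longrightarrow> (t x)^2 = qnum_h x / fps_const x)"

definition is_roots_c :: "complex \<Rightarrow> (complex \<Rightarrow> complex) \<Rightarrow> (complex \<Rightarrow> complex) \<Rightarrow> bool" where
  "is_roots_c h s t \<longleftrightarrow>
     (\<forall>x. (s x)^2 = qnum_c h x \<and> (qnum_c h x \<in> \<real>\<^sub>\<ge>\<^sub>0 \<longrightarrow> s x \<in> \<real>\<^sub>\<ge>\<^sub>0)) \<and>
     (\<forall>x. x \<noteq> 0 \<longrightarrow> (t x)^2 = qnum_c h x / x)"

lemma ex_fps_sqrt:
  fixes a :: "complex fps"
  assumes "a $ 0 \<noteq> 0"
  shows "\<exists>b. b^2 = a"
proof -
  have "fps_radical (\<lambda>_. csqrt) (Suc 1) a ^ Suc 1 = a"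
    using power_radical[of a "\<lambda>_. csqrt" 1] assms by (simp flip: power2_eq_square)
  then show ?thesis by (metis Suc_1)
qed

lemma qnum_h_nth_0: "qnum_h x $ 0 = x"
proof -
  define d :: "complex \<Rightarrow> complex fps"
    where "d x = fps_shift 1 (fps_exp (x/2) - fps_exp (- x/2))" for x
  have eq: "fps_exp (x/2) - fps_exp (- x/2) = d x * fps_X" for x :: complex
    by (rule fps_ext) (simp add: d_def)
  have d0: "d x $ 0 = x" for x by (simp add: d_def)
  have "qnum_h x = (d x * fps_X) / (d 1 * fps_X)"
    unfolding qnum_h_def eq[of x] using eq[of 1] by simp
  also have "\<dots> = d x / d 1" by simp
  also have "\<dots> = d x * inverse (d 1)" using d0[of 1] by (simp add: fps_divide_unit)
  finally show ?thesis using d0 by simp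
qed

lemma ex_roots_h: "\<exists>s t. is_roots_h s t"
proof -
  have "\<exists>b. b^2 = qnum_h x" for x
  proof (cases "x = 0")
    case True
    then show ?thesis by (intro exI[of _ 0]) (simp add: qnum_h_def)
  qed (use ex_fps_sqrt qnum_h_nth_0 in auto)
  moreover have "\<exists>b. x \<noteq> 0 \<longrightarrow> b^2 = qnum_h x / fps_const x" for x
    using ex_fps_sqrt[of "qnum_h x / fps_const x"]
    by (cases "x = 0") (simp_all add: fps_divide_unit fps_const_inverse qnum_h_nth_0)
  ultimately show ?thesis unfolding is_roots_h_def by metis
qed

lemma ex_roots_c: "\<exists>s t. is_roots_c h s t"
proof -
  have "csqrt z \<in> \<real>\<^sub>\<ge>\<^sub>0" if "z \<in> \<real>\<^sub>\<ge>\<^sub>0" for z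
    using that by (auto simp: nonneg_Reals_def csqrt_of_real_nonneg)
  then have "is_roots_c h (\<lambda>x. csqrt (qnum_c h x)) (\<lambda>x. csqrt (qnum_c h x / x))"
    by (simp add: is_roots_c_def)
  then show ?thesis by blast
qed

text \<open>
  \<open>ang n t i (N\<^sub>i + c)\<close> is \<open>\<langle>N\<^sub>i + c\<rangle>\<close>, and \<open>tot n m\<close> is the function giving \<open>N\<close>.
  In the three definitions after it, \<open>cr\<close>, \<open>an\<close> and \<open>fn\<close> are the images of the generators
  in the ambient ring, and \<open>P\<close> is \<open>p\<close> as an element of it.
\<close>

definition ang :: "nat \<Rightarrow> (complex \<Rightarrow> 'k::one) \<Rightarrow> nat \<Rightarrow> complex \<Rightarrow> 'k" where
  "ang n t i x = (if theta n i then 1 else t x)"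

definition tot :: "nat \<Rightarrow> nat \<Rightarrow> (nat \<Rightarrow> complex) \<Rightarrow> complex" where
  "tot n m x = (\<Sum>i\<in>{1..<n+m}. x i)"

definition pi_h :: "nat \<Rightarrow> nat \<Rightarrow> (nat \<Rightarrow> 'b) \<Rightarrow> (nat \<Rightarrow> 'b) \<Rightarrow> 'b \<Rightarrow> nat \<Rightarrow> 'b::ring_1" where
  "pi_h n m cr an P i =
     (if i = 1 then P - (\<Sum>j\<in>{1..<n+m}. cr j * an j) else cr (i-1) * an (i-1))"

definition pi_e :: "nat \<Rightarrow> nat \<Rightarrow> (complex \<Rightarrow> 'k::one) \<Rightarrow> (complex \<Rightarrow> 'k) \<Rightarrow> complex \<Rightarrow>
    (((nat \<Rightarrow> complex) \<Rightarrow> 'k) \<Rightarrow> 'b) \<Rightarrow> (nat \<Rightarrow> 'b) \<Rightarrow> (nat \<Rightarrow> 'b) \<Rightarrow> nat \<Rightarrow> 'b::ring_1" where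
  "pi_e n m s t p fn cr an i =
     (if i = 1
      then fn (\<lambda>x. s (p - tot n m x)) * fn (\<lambda>x. ang n t 1 (x 1 + 1)) * an 1
      else fn (\<lambda>x. ang n t (i-1) (x (i-1))) * fn (\<lambda>x. ang n t i (x i + 1)) * cr (i-1) * an i)"

definition pi_f :: "nat \<Rightarrow> nat \<Rightarrow> (complex \<Rightarrow> 'k::one) \<Rightarrow> (complex \<Rightarrow> 'k) \<Rightarrow> complex \<Rightarrow>
    (((nat \<Rightarrow> complex) \<Rightarrow> 'k) \<Rightarrow> 'b) \<Rightarrow> (nat \<Rightarrow> 'b) \<Rightarrow> (nat \<Rightarrow> 'b) \<Rightarrow> nat \<Rightarrow> 'b::ring_1" where
  "pi_f n m s t p fn cr an i =
     (if i = 1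
      then fn (\<lambda>x. s (p - tot n m x + 1)) * fn (\<lambda>x. ang n t 1 (x 1)) * cr 1
      else fn (\<lambda>x. ang n t (i-1) (x (i-1) + 1)) * fn (\<lambda>x. ang n t i (x i)) * cr i * an (i-1))"

definition is_pi_h :: "nat \<Rightarrow> nat \<Rightarrow> (complex \<Rightarrow> complex fps) \<Rightarrow> (complex \<Rightarrow> complex fps) \<Rightarrow>
    complex \<Rightarrow> (ugen free_alg fps set \<Rightarrow> wgen free_alg fps set) \<Rightarrow> bool" where
  "is_pi_h n m s t p \<pi> \<longleftrightarrow>
     (let I = U_ideal_h n m; J = W_ideal_h n m;
          cr = (\<lambda>i. fgen_h (Cr i)); an = (\<lambda>i. fgen_h (An i)) in
      \<pi> \<in> alg_hom (U_alg_h n m) (W_alg_h n m) \<and>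
      (\<forall>d. \<pi> ` U_part_h n m d \<subseteq> W_part_h n m d) \<and>
      (\<forall>i\<in>{1..n+m}.
         \<pi> (cls I (fgen_h (GH i))) = cls J (pi_h n m cr an (fconst_h (fps_const p)) i)) \<and>
      (\<forall>i\<in>{1..<n+m}.
         \<pi> (cls I (fgen_h (GE i))) = cls J (pi_e n m s t p fn_h cr an i) \<and>
         \<pi> (cls I (fgen_h (GF i))) = cls J (pi_f n m s t p fn_h cr an i)))"

definition is_pi_c :: "nat \<Rightarrow> nat \<Rightarrow> complex \<Rightarrow> (complex \<Rightarrow> complex) \<Rightarrow> (complex \<Rightarrow> complex) \<Rightarrow>
    complex \<Rightarrow> (cgen free_alg set \<Rightarrow> wgen free_alg set) \<Rightarrow> bool" where
  "is_pi_c n m h s t p \<pi> \<longleftrightarrow>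
     (let I = U_ideal_c n m h; J = W_ideal_c n m;
          cr = (\<lambda>i. fgen (Cr i)); an = (\<lambda>i. fgen (An i)); fn = (\<lambda>\<phi>. fgen (Fn \<phi>));
          num = (\<lambda>i x. if i = 1 then p - tot n m x else x (i-1)) in
      \<pi> \<in> alg_hom (U_alg_c n m h) (W_alg_c n m) \<and>
      (\<forall>d. \<pi> ` U_part_c n m h d \<subseteq> W_part_c n m d) \<and>
      (\<forall>i\<in>{1..n+m}.
         \<pi> (cls I (fgen (CH i))) = cls J (pi_h n m cr an (fconst p) i) \<and>
         \<pi> (cls I (fgen (CQ i))) = cls J (fn (\<lambda>x. exp (h * num i x / 2))) \<and>
         \<pi> (cls I (fgen (CQi i))) = cls J (fn (\<lambda>x. exp (- (h * num i x / 2))))) \<and>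
      (\<forall>i\<in>{1..<n+m}.
         \<pi> (cls I (fgen (CE i))) = cls J (pi_e n m s t p fn cr an i) \<and>
         \<pi> (cls I (fgen (CF i))) = cls J (pi_f n m s t p fn cr an i)))"


section \<open>The Fock space\<close>

text \<open>
  The basis vector \<open>|l)\<close> is \<open>Poly_Mapping.single l 1\<close>, for \<open>l \<in> occ n m\<close>; on other
  sequences nothing meaningful is claimed.
\<close>

type_synonym fock = "(nat \<Rightarrow> nat) \<Rightarrow>\<^sub>0 complex"

definition occ :: "nat \<Rightarrow> nat \<Rightarrow> (nat \<Rightarrow> nat) set" where
  "occ n m = {l. (\<forall>i. i \<notin> {1..<n+m} \<longrightarrow> l i = 0) \<and> (\<forall>i. n \<le> i \<longrightarrow> l i \<le> 1)}"

definition ket :: "(nat \<Rightarrow> nat) \<Rightarrow> fock" where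
  "ket l = Poly_Mapping.single l 1"

definition fscale :: "complex \<Rightarrow> fock \<Rightarrow> fock" where
  "fscale c v = Poly_Mapping.map ((*) c) v"

definition fscale_h :: "complex fps \<Rightarrow> fock fps \<Rightarrow> fock fps" where
  "fscale_h c v = Abs_fps (\<lambda>k. \<Sum>i=0..k. fscale (c $ i) (v $ (k - i)))"

text \<open>
  The action of the generators on \<open>|l)\<close>. The sign counts the Fermi creation operators which
  \<open>A\<^sub>i\<^sup>\<plusminus>\<close> has to pass in the ordered product defining \<open>|l)\<close>; see \<open>fock_vacuum\<close> and
  \<open>fock_basis\<close> below.
\<close>

definition fsign :: "nat \<Rightarrow> nat \<Rightarrow> (nat \<Rightarrow> nat) \<Rightarrow> complex" where
  "fsign n i l = (-1) ^ (\<Sum>j\<in>{n..<i}. l j)"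

fun act_ket :: "nat \<Rightarrow> nat \<Rightarrow> wgen \<Rightarrow> (nat \<Rightarrow> nat) \<Rightarrow> fock" where
  "act_ket n m (Cr i) l =
     (if i \<notin> {1..<n+m} then 0
      else if i < n then fscale (of_real (sqrt (real (l i + 1)))) (ket (l(i := l i + 1)))
      else if l i = 0 then fscale (fsign n i l) (ket (l(i := 1))) else 0)"
| "act_ket n m (An i) l =
     (if i \<notin> {1..<n+m} \<or> l i = 0 then 0
      else if i < n then fscale (of_real (sqrt (real (l i)))) (ket (l(i := l i - 1)))
      else fscale (fsign n i l) (ket (l(i := 0))))"
| "act_ket n m (Fn \<phi>) l = fscale (\<phi> (\<lambda>i. of_nat (l i))) (ket l)"

definition act_gen :: "nat \<Rightarrow> nat \<Rightarrow> wgen \<Rightarrow> fock \<Rightarrow> fock" where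
  "act_gen n m g v =
     (\<Sum>l\<in>Poly_Mapping.keys v. fscale (Poly_Mapping.lookup v l) (act_ket n m g l))"

definition act_c :: "nat \<Rightarrow> nat \<Rightarrow> wgen free_alg \<Rightarrow> fock \<Rightarrow> fock" where
  "act_c n m a v =
     (\<Sum>w\<in>Poly_Mapping.keys a. fscale (Poly_Mapping.lookup a w) (foldr (act_gen n m) w v))"

definition act_h :: "nat \<Rightarrow> nat \<Rightarrow> wgen free_alg fps \<Rightarrow> fock fps \<Rightarrow> fock fps" where
  "act_h n m a v = Abs_fps (\<lambda>k. \<Sum>i=0..k. act_c n m (a $ i) (v $ (k - i)))"

text \<open>The action of the quotient algebra, through any representative of a coset.\<close>

definition Fock_act_c :: "nat \<Rightarrow> nat \<Rightarrow> wgen free_alg set \<Rightarrow> fock \<Rightarrow> fock" where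
  "Fock_act_c n m X v = the_elem ((\<lambda>a. act_c n m a v) ` X)"

definition Fock_act_h :: "nat \<Rightarrow> nat \<Rightarrow> wgen free_alg fps set \<Rightarrow> fock fps \<Rightarrow> fock fps" where
  "Fock_act_h n m X v = the_elem ((\<lambda>a. act_h n m a v) ` X)"

subsection \<open>Linear structure\<close>

lemma lookup_fscale [simp]: "Poly_Mapping.lookup (fscale c v) l = c * Poly_Mapping.lookup v l"
  by (simp add: fscale_def Poly_Mapping.map.rep_eq when_def)

interpretation fock: vector_space fscale
  by standard (auto intro!: poly_mapping_eqI simp: lookup_add algebra_simps)

interpretation fock_h: Modules.module fscale_h
proof
  fix a b :: "complex fps" and x y :: "fock fps"
  show "fscale_h a (x + y) = fscale_h a x + fscale_h a y"
    by (simp add: fscale_h_def fps_eq_iff fock.scale_right_distrib sum.distrib)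
  show "fscale_h (a + b) x = fscale_h a x + fscale_h b x"
    by (simp add: fscale_h_def fps_eq_iff fock.scale_left_distrib sum.distrib)
  show "fscale_h a (fscale_h b x) = fscale_h (a * b) x"
  proof (rule fps_ext)
    fix k
    have "fscale_h (a * b) x $ k =
        (\<Sum>j=0..k. \<Sum>i=0..j. fscale (a $ i * b $ (j - i)) (x $ (k - j)))"
      by (simp add: fscale_h_def fps_mult_nth fock.scale_sum_left)
    also have "\<dots> = (\<Sum>j=0..k. \<Sum>i=0..k - j. fscale (a $ j * b $ i) (x $ (k - j - i)))"
      using fps_mult_assoc_lemma[where f = "\<lambda>i j d. fscale (a $ i * b $ j) (x $ d)" and k = k and n = k] by simp
    also have "\<dots> = fscale_h a (fscale_h b x) $ k"
      by (simp add: fscale_h_def fock.scale_sum_right)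
    finally show "fscale_h a (fscale_h b x) $ k = fscale_h (a * b) x $ k" by simp
  qed
  show "fscale_h 1 x = x"
  proof (rule fps_ext)
    fix k
    have "fscale_h 1 x $ k = (\<Sum>i=0..k. if i = 0 then x $ k else 0)"
      unfolding fscale_h_def fps_nth_Abs_fps by (rule sum.cong) auto
    then show "fscale_h 1 x $ k = x $ k" by simp
  qed
qed

definition Fock0_c :: "nat \<Rightarrow> nat \<Rightarrow> nat \<Rightarrow> fock set" where
  "Fock0_c n m p = fock.span (ket ` {l \<in> occ n m. (\<Sum>i\<in>{1..<n+m}. l i) \<le> p})"

definition Fock1_c :: "nat \<Rightarrow> nat \<Rightarrow> nat \<Rightarrow> fock set" where
  "Fock1_c n m p = fock.span (ket ` {l \<in> occ n m. (\<Sum>i\<in>{1..<n+m}. l i) > p})"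

text \<open>
  For formal \<open>h\<close> the Fock space is the topologically free module with basis \<open>|l)\<close>, and spans
  are closed in the \<open>h\<close>-adic topology.
\<close>

definition Fock0_h :: "nat \<Rightarrow> nat \<Rightarrow> nat \<Rightarrow> fock fps set" where
  "Fock0_h n m p = {v. \<forall>k. v $ k \<in> Fock0_c n m p}"

definition Fock1_h :: "nat \<Rightarrow> nat \<Rightarrow> nat \<Rightarrow> fock fps set" where
  "Fock1_h n m p = {v. \<forall>k. v $ k \<in> Fock1_c n m p}"

text \<open>The scalar product, antilinear in the first argument, with orthonormal basis \<open>|l)\<close>.\<close>

definition fock_inner :: "fock \<Rightarrow> fock \<Rightarrow> complex" where
  "fock_inner x y =
     (\<Sum>l\<in>Poly_Mapping.keys x. cnj (Poly_Mapping.lookup x l) * Poly_Mapping.lookup y l)"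

lemma fock_inner_ket: "fock_inner (ket l) (ket k) = of_bool (l = k)"
  by (simp add: fock_inner_def ket_def lookup_single when_def)

subsection \<open>The basis from the vacuum\<close>

lemma fscale_zero [simp]: "fscale c 0 = 0"
  by (rule fock.scale_zero_right)

lemma act_gen_scale_ket: "act_gen n m g (fscale c (ket l)) = fscale c (act_ket n m g l)"
proof (cases "c = 0")
  case False
  then have "Poly_Mapping.keys (fscale c (ket l)) = {l}"
    by (auto simp: Poly_Mapping.in_keys_iff ket_def lookup_single when_def split: if_splits)
  then show ?thesis by (simp add: act_gen_def ket_def lookup_single)
qed (simp add: act_gen_def)

lemma fock_vacuum: "act_gen n m (An i) (ket (\<lambda>_. 0)) = 0"
  using act_gen_scale_ket[of n m "An i" 1 "\<lambda>_. 0"] by simp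

lemma act_Cr_pow:
  assumes "i \<in> {1..<n+m}" "n \<le> i \<Longrightarrow> k \<le> 1" "\<forall>j\<le>i. l j = 0"
  shows "foldr (act_gen n m) (replicate k (Cr i)) (fscale c (ket l)) =
         fscale (of_real (sqrt (fact k)) * c) (ket (l(i := k)))"
  using assms(2)
proof (induction k)
  case 0
  then show ?case using assms by (simp add: fun_upd_idem)
next
  case (Suc k)
  show ?case
  proof (cases "i < n")
    case True
    then show ?thesis using Suc assms
      by (simp add: act_gen_scale_ket real_sqrt_mult mult_ac fun_upd_def cong: if_cong del: of_nat_Suc)
  next
    case False
    then have "k = 0" using Suc.prems by simp
    moreover have "(\<Sum>j\<in>{n..<i}. l j) = 0" using assms(3) by simp
    ultimately show ?thesis using False assms by (simp add: act_gen_scale_ket fsign_def fun_upd_def)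
  qed
qed

lemma fock_basis:
  assumes l: "l \<in> occ n m" and nm: "n + m \<ge> 1"
  shows "foldr (act_gen n m) (concat (map (\<lambda>i. replicate (l i) (Cr i)) [1..<n+m])) (ket (\<lambda>_. 0)) =
         fscale (\<Prod>i\<in>{1..<n+m}. of_real (sqrt (fact (l i)))) (ket l)"
proof -
  define v where "v k = (\<lambda>i. if k \<le> i then l i else 0)" for k :: nat
  have "foldr (act_gen n m) (concat (map (\<lambda>i. replicate (l i) (Cr i)) [k..<n+m])) (ket (\<lambda>_. 0)) =
        fscale (\<Prod>i\<in>{k..<n+m}. of_real (sqrt (fact (l i)))) (ket (v k))"
    if "1 \<le> k" "k \<le> n + m" for k
    using that(2,1)
  proof (induction k rule: inc_induct)
    case base
    have "v (n + m) = (\<lambda>_. 0)" using l by (auto simp: v_def occ_def)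
    then show ?case by simp
  next
    case (step k)
    have upd: "(v (Suc k))(k := l k) = v k" by (auto simp: v_def fun_eq_iff)
    have "foldr (act_gen n m) (concat (map (\<lambda>i. replicate (l i) (Cr i)) [k..<n+m])) (ket (\<lambda>_. 0)) =
          foldr (act_gen n m) (replicate (l k) (Cr k))
            (fscale (\<Prod>i\<in>{Suc k..<n+m}. of_real (sqrt (fact (l i)))) (ket (v (Suc k))))"
      using step by (simp add: upt_conv_Cons)
    also have "\<dots> = fscale (of_real (sqrt (fact (l k))) *
                    (\<Prod>i\<in>{Suc k..<n+m}. of_real (sqrt (fact (l i))))) (ket (v k))"
      using act_Cr_pow[of k n m "l k" "v (Suc k)"] step l unfolding upd
      by (auto simp: occ_def v_def)
    also have "\<dots> = fscale (\<Prod>i\<in>{k..<n+m}. of_real (sqrt (fact (l i)))) (ket (v k))"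
      using step by (simp add: prod.atLeast_Suc_lessThan)
    finally show ?case .
  qed
  from this[of 1] nm have "foldr (act_gen n m)
      (concat (map (\<lambda>i. replicate (l i) (Cr i)) [1..<n+m])) (ket (\<lambda>_. 0)) =
      fscale (\<Prod>i\<in>{1..<n+m}. of_real (sqrt (fact (l i)))) (ket (v 1))" by simp
  moreover have "v 1 = l" using l by (auto simp: v_def occ_def fun_eq_iff)
  ultimately show ?thesis by simp
qed


section \<open>Representations\<close>

definition rep_on :: "('k::comm_ring_1, 'a, 'z) module_scheme \<Rightarrow> ('k \<Rightarrow> 'v \<Rightarrow> 'v::ab_group_add) \<Rightarrow>
    'v set \<Rightarrow> ('a \<Rightarrow> 'v \<Rightarrow> 'v) \<Rightarrow> bool" where
  "rep_on A sc M \<rho> \<longleftrightarrow> Modules.module.subspace sc M \<and>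
     (\<forall>a\<in>carrier A. \<forall>x\<in>M. \<rho> a x \<in> M \<and>
        (\<forall>y\<in>M. \<rho> a (x + y) = \<rho> a x + \<rho> a y) \<and>
        (\<forall>c. \<rho> a (sc c x) = sc c (\<rho> a x)) \<and>
        (\<forall>c. \<rho> (c \<odot>\<^bsub>A\<^esub> a) x = sc c (\<rho> a x)) \<and>
        (\<forall>b\<in>carrier A. \<rho> (a \<oplus>\<^bsub>A\<^esub> b) x = \<rho> a x + \<rho> b x \<and> \<rho> (a \<otimes>\<^bsub>A\<^esub> b) x = \<rho> a (\<rho> b x))) \<and>
     (\<forall>x\<in>M. \<rho> \<one>\<^bsub>A\<^esub> x = x)"

definition invariant :: "('k, 'a, 'z) module_scheme \<Rightarrow> ('a \<Rightarrow> 'v \<Rightarrow> 'v) \<Rightarrow> 'v set \<Rightarrow> bool" where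
  "invariant A \<rho> M \<longleftrightarrow> (\<forall>a\<in>carrier A. \<forall>x\<in>M. \<rho> a x \<in> M)"

definition fin_dim :: "('k::comm_ring_1 \<Rightarrow> 'v \<Rightarrow> 'v::ab_group_add) \<Rightarrow> 'v set \<Rightarrow> bool" where
  "fin_dim sc M \<longleftrightarrow> (\<exists>B. finite B \<and> B \<subseteq> M \<and> Modules.module.span sc B = M)"

definition irreducible_c ::
  "(complex, 'a, 'z) module_scheme \<Rightarrow> fock set \<Rightarrow> ('a \<Rightarrow> fock \<Rightarrow> fock) \<Rightarrow> bool" where
  "irreducible_c A M \<rho> \<longleftrightarrow> M \<noteq> {0} \<and>
     (\<forall>L. fock.subspace L \<and> L \<subseteq> M \<and> invariant A \<rho> L \<longrightarrow> L = {0} \<or> L = M)"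

text \<open>
  Over \<open>complex fps\<close> every module \<open>M \<noteq> 0\<close> considered here has the submodules \<open>h\<^sup>k M\<close>. Irreducibility
  is understood up to these: only submodules \<open>L\<close> with \<open>h\<close>-torsion-free quotient \<open>M / L\<close> are taken
  into account.
\<close>

definition irreducible_h ::
  "(complex fps, 'a, 'z) module_scheme \<Rightarrow> fock fps set \<Rightarrow> ('a \<Rightarrow> fock fps \<Rightarrow> fock fps) \<Rightarrow> bool" where
  "irreducible_h A M \<rho> \<longleftrightarrow> M \<noteq> {0} \<and>
     (\<forall>L. fock_h.subspace L \<and> L \<subseteq> M \<and> invariant A \<rho> L \<and>
          (\<forall>v\<in>M. fscale_h fps_X v \<in> L \<longrightarrow> v \<in> L) \<longrightarrow> L = {0} \<or> L = M)"

definition equivalent_reps :: "('k, 'a, 'z) module_scheme \<Rightarrow> ('k \<Rightarrow> 'v \<Rightarrow> 'v::plus) \<Rightarrow>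
    'v set \<Rightarrow> ('a \<Rightarrow> 'v \<Rightarrow> 'v) \<Rightarrow> 'v set \<Rightarrow> ('a \<Rightarrow> 'v \<Rightarrow> 'v) \<Rightarrow> bool" where
  "equivalent_reps A sc M \<rho> M' \<rho>' \<longleftrightarrow>
     (\<exists>T. bij_betw T M M' \<and>
          (\<forall>x\<in>M. \<forall>y\<in>M. T (x + y) = T x + T y) \<and>
          (\<forall>c. \<forall>x\<in>M. T (sc c x) = sc c (T x)) \<and>
          (\<forall>a\<in>carrier A. \<forall>x\<in>M. T (\<rho> a x) = \<rho>' a (T x)))"

end

theory Submission
  imports Defs
begin

text \<open>
  The map \<open>\<pi>\<close> becomes transparent in terms of the deformed oscillators
  \<open>b\<^sub>i\<^sup>+ = \<langle>N\<^sub>i\<rangle> A\<^sub>i\<^sup>+\<close> and \<open>b\<^sub>i\<^sup>- = \<langle>N\<^sub>i + 1\<rangle> A\<^sub>i\<^sup>-\<close>. Operators at different sites commute or anticommute,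
  at a Bose site \<open>b\<^sup>+ b\<^sup>- = [N]\<close> and \<open>b\<^sup>- b\<^sup>+ = [N + 1]\<close>, and at a Fermi site the operators square to
  zero. For \<open>i \<ge> 2\<close> the images of \<open>e\<^sub>i\<close> and \<open>f\<^sub>i\<close> are, up to sign, the hopping operators
  \<open>b\<^sub>i\<^sub>-\<^sub>1\<^sup>+ b\<^sub>i\<^sup>-\<close> and \<open>b\<^sub>i\<^sub>-\<^sub>1\<^sup>- b\<^sub>i\<^sup>+\<close>, which move one quantum between neighbouring sites. The images of
  \<open>e\<^sub>1\<close> and \<open>f\<^sub>1\<close> are of the same kind: there is a further Bose site \<open>0\<close>, whose occupation number is
  \<open>p - N\<close> because all sites together contain \<open>p\<close> quanta, and whose operators are replaced by the
  functions \<open>sqrt [p - N]\<close> and \<open>sqrt [p - N + 1]\<close>.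

  The relations of \<open>U\<^sub>q[gl(n/m)]\<close> reduce to identities at one or two sites. The relation between \<open>e\<^sub>i\<close>
  and \<open>f\<^sub>i\<close> is \<open>[a] [b + 1] - [a + 1] [b] = [a - b]\<close> (\<open>br_exchange\<close>) for two Bose sites, and can be
  read off from the occupation numbers \<open>0\<close> and \<open>1\<close> if Fermi sites are involved (\<open>fn_fermi\<close>). In the
  Serre relations the operators at the outer sites factor out. What remains at the site which the two
  hopping operators share vanishes at a Fermi site because of a square, and at a Bose site because of
  \<open>[x + 1] - (q + q\<^sup>-\<^sup>1) [x] + [x - 1] = 0\<close> (\<open>b_serre\<close>). The relation of degree four reduces to the
  last identity at the Bose site \<open>n - 1\<close> (\<open>serre4_shared\<close>). Numerical and formal \<open>q\<close> are instances of
  one computation (\<open>gl_rels_vanish\<close>), in which only the ring of scalars differs. For formal \<open>q\<close>, an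
  element belongs to the ideal of relations of \<open>W(n-1/m)\<close> iff each coefficient does so over the complex
  numbers (\<open>top_ideal_const\<close>), and an algebra homomorphism is automatically continuous, whence \<open>\<pi>\<close> is
  determined by its values on the generators (\<open>pi_h_determined\<close>).

  In the Fock space each generator maps a basis vector to a multiple of a basis vector. The matrix
  elements between basis vectors with \<open>p\<close> and with \<open>p + 1\<close> quanta contain \<open>sqrt [0] = 0\<close>, so that the
  two subspaces are invariant. A nonzero invariant subspace of \<open>F\<^sub>0\<close>, for formal \<open>q\<close> one with torsion-free
  quotient, contains a basis vector, since the \<open>h\<^sub>i\<close> separate the basis vectors (\<open>some_kt\<close>). The operator \<open>e\<^sub>i\<close> for the first occupied site \<open>i\<close> moves
  a quantum to the left with a nonzero coefficient, and in this way any basis vector is connected with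
  the vacuum (\<open>kt_iff_vacuum\<close>); so the representation is irreducible. The sum of all \<open>h\<^sub>i\<close> acts as
  \<open>p\<close>, hence different \<open>p\<close> give inequivalent representations. Finally the matrices of \<open>e\<^sub>i\<close> and \<open>f\<^sub>i\<close>
  are transposed to each other (\<open>ec_fc\<close>), and on \<open>F\<^sub>0\<close> they are real for real \<open>h\<close>, as \<open>[k] \<ge> 0\<close> for
  natural numbers \<open>k\<close>.
\<close>

section \<open>Two-sided ideals and quotient algebras\<close>

text \<open>
  As the carrier of \<^const>\<open>type_ring\<close> is a whole type, its ideals can be described by type class
  algebra.
\<close>

definition two_sided :: "'a::ring_1 set \<Rightarrow> bool" where
  "two_sided I \<longleftrightarrow> 0 \<in> I \<and> (\<forall>x\<in>I. \<forall>y\<in>I. x - y \<in> I) \<and> (\<forall>x\<in>I. \<forall>a. a * x \<in> I \<and> x * a \<in> I)"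

lemma ring_type_ring: "Ring.ring (type_ring :: 'a::ring_1 ring)"
proof -
  have "\<exists>y. y + x = 0 \<and> x + y = 0" for x :: 'a by (rule exI[of _ "- x"]) simp
  then have "carrier (add_monoid type_ring) \<subseteq> Units (add_monoid (type_ring :: 'a ring))"
    by (auto simp: Units_def type_ring_def)
  then show ?thesis by unfold_locales (auto simp: type_ring_def algebra_simps)
qed

lemma ideal_type_ring_iff: "ideal I type_ring \<longleftrightarrow> two_sided I"
proof
  assume "ideal I (type_ring :: 'a ring)"
  then interpret ideal I "type_ring :: 'a ring" .
  have inv: "\<ominus>\<^bsub>type_ring\<^esub> x = - x" for x :: 'a
    by (rule minus_equality) (simp_all add: type_ring_def)
  show "two_sided I"
    unfolding two_sided_def
  proof (intro conjI ballI allI)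
    show "0 \<in> I" using additive_subgroup.zero_closed[OF is_additive_subgroup] by (simp add: type_ring_def)
    fix x a assume x: "x \<in> I"
    show "a * x \<in> I" "x * a \<in> I"
      using I_l_closed[OF x, of a] I_r_closed[OF x, of a] by (simp_all add: type_ring_def)
    fix y assume "y \<in> I"
    then have "x \<oplus>\<^bsub>type_ring\<^esub> (\<ominus>\<^bsub>type_ring\<^esub> y) \<in> I" using x
      by (intro additive_subgroup.a_closed[OF is_additive_subgroup]
          additive_subgroup.a_inv_closed[OF is_additive_subgroup])
    then show "x - y \<in> I" unfolding inv by (simp add: type_ring_def)
  qed
next
  assume I: "two_sided I"
  have "subgroup I (add_monoid (type_ring :: 'a ring))"
  proof -
    interpret Ring.ring "type_ring :: 'a ring" by (rule ring_type_ring)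
    have inv: "inv\<^bsub>add_monoid (type_ring :: 'a ring)\<^esub> x = - x" for x :: 'a
      using minus_equality[of "- x" x] by (simp add: type_ring_def a_inv_def)
    have neg: "- x \<in> I" if "x \<in> I" for x
      using I that unfolding two_sided_def by (metis diff_0)
    have "x + y \<in> I" if "x \<in> I" "y \<in> I" for x y
      using I that neg[of y] unfolding two_sided_def by (metis diff_minus_eq_add)
    moreover have "inv\<^bsub>add_monoid type_ring\<^esub> x \<in> I" if "x \<in> I" for x
      using neg[OF that] by (simp only: inv)
    ultimately show ?thesis
      using I unfolding two_sided_def by (intro subgroup.intro) (auto simp: type_ring_def)
  qed
  then show "ideal I (type_ring :: 'a ring)"
    using I unfolding two_sided_def
    by (intro idealI ring_type_ring) (auto simp: type_ring_def)
qed

context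
  fixes I :: "'a::ring_1 set"
  assumes I: "two_sided I"
begin

lemma two_sided_zero: "0 \<in> I"
  and two_sided_diff: "x \<in> I \<Longrightarrow> y \<in> I \<Longrightarrow> x - y \<in> I"
  and two_sided_left: "x \<in> I \<Longrightarrow> a * x \<in> I"
  and two_sided_right: "x \<in> I \<Longrightarrow> x * a \<in> I"
  using I by (auto simp: two_sided_def)

lemma two_sided_minus: "x \<in> I \<Longrightarrow> - x \<in> I"
  using two_sided_diff[OF two_sided_zero, of x] by simp

lemma two_sided_minus_iff: "- x \<in> I \<longleftrightarrow> x \<in> I"
  using two_sided_minus[of x] two_sided_minus[of "- x"] by auto

lemma two_sided_add: "x \<in> I \<Longrightarrow> y \<in> I \<Longrightarrow> x + y \<in> I"
  using two_sided_diff[of x "- y"] two_sided_minus[of y] by simp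

lemma two_sided_sum: "(\<And>i. i \<in> A \<Longrightarrow> f i \<in> I) \<Longrightarrow> sum f A \<in> I"
  by (induction A rule: infinite_finite_induct) (auto intro: two_sided_zero two_sided_add)

lemma two_sided_mult_diff: "x - x' \<in> I \<Longrightarrow> y - y' \<in> I \<Longrightarrow> x * y - x' * y' \<in> I"
  using two_sided_add[OF two_sided_right[of "x - x'" y] two_sided_left[of "y - y'" x']]
  by (simp add: algebra_simps)

lemma two_sided_add_diff: "x - x' \<in> I \<Longrightarrow> y - y' \<in> I \<Longrightarrow> (x + y) - (x' + y') \<in> I"
  using two_sided_add[of "x - x'" "y - y'"] by (simp add: algebra_simps)

lemma mem_cls_iff: "y \<in> cls I x \<longleftrightarrow> y - x \<in> I"
proof -
  have "(\<exists>a\<in>I. y = a + x) \<longleftrightarrow> y - x \<in> I" by (metis add_diff_cancel diff_add_cancel)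
  then show ?thesis by (auto simp: cls_def a_r_coset_def r_coset_def type_ring_def)
qed

lemma cls_eq_iff: "cls I x = cls I y \<longleftrightarrow> x - y \<in> I"
proof
  assume "cls I x = cls I y"
  moreover have "x \<in> cls I x" by (simp add: mem_cls_iff two_sided_zero)
  ultimately show "x - y \<in> I" by (simp add: mem_cls_iff)
next
  assume xy: "x - y \<in> I"
  have "z - x \<in> I \<longleftrightarrow> z - y \<in> I" for z
    using two_sided_add[OF _ xy, of "z - x"] two_sided_diff[OF _ xy, of "z - y"] by auto
  then show "cls I x = cls I y" by (auto simp: mem_cls_iff)
qed

lemma carrier_quot_alg: "carrier (quot_alg sc I) = range (cls I)"
  by (auto simp: quot_alg_def ring.extend_def FactRing_def A_RCOSETS_def RCOSETS_def cls_def
      a_r_coset_def type_ring_def)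

lemma one_quot_alg: "\<one>\<^bsub>quot_alg sc I\<^esub> = cls I 1"
  by (simp add: quot_alg_def ring.extend_def FactRing_def cls_def type_ring_def)

lemma add_quot_alg: "cls I x \<oplus>\<^bsub>quot_alg sc I\<^esub> cls I y = cls I (x + y)"
proof -
  interpret ideal I type_ring using I by (simp add: ideal_type_ring_iff)
  show ?thesis
    using a_rcos_sum[of x y]
    by (simp add: quot_alg_def ring.extend_def FactRing_def cls_def type_ring_def)
qed

lemma mult_quot_alg: "cls I x \<otimes>\<^bsub>quot_alg sc I\<^esub> cls I y = cls I (x * y)"
proof -
  interpret ideal I type_ring using I by (simp add: ideal_type_ring_iff)
  show ?thesis
    using rcoset_mult_add[of x y]
    by (simp add: quot_alg_def ring.extend_def FactRing_def cls_def type_ring_def)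
qed

lemma smult_quot_alg: "c \<odot>\<^bsub>quot_alg (\<lambda>c x. k c * x) I\<^esub> cls I x = cls I (k c * x)"
proof -
  have "cls I (k c * y) = cls I (k c * x)" if "y \<in> cls I x" for y
    using that two_sided_left[of "y - x" "k c"] by (simp add: cls_eq_iff mem_cls_iff algebra_simps)
  moreover have "x \<in> cls I x" by (simp add: mem_cls_iff two_sided_zero)
  ultimately have "(\<Union>y\<in>cls I x. cls I (k c * y)) = cls I (k c * x)" by blast
  then show ?thesis by (simp add: quot_alg_def ring.extend_def module.fields_def)
qed

end

lemmas quot_alg_simps = carrier_quot_alg one_quot_alg add_quot_alg mult_quot_alg smult_quot_alg

definition ring_map :: "('a::ring_1 \<Rightarrow> 'b::ring_1) \<Rightarrow> bool" where
  "ring_map f \<longleftrightarrow> f 1 = 1 \<and> (\<forall>x y. f (x + y) = f x + f y) \<and> (\<forall>x y. f (x * y) = f x * f y)"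

lemma ring_map_simps:
  assumes "ring_map f"
  shows "f 1 = 1" "f (x + y) = f x + f y" "f (x * y) = f x * f y" "f 0 = 0"
    "f (- x) = - f x" "f (x - y) = f x - f y" "f (x ^ k) = f x ^ k" "f (sum g A) = (\<Sum>i\<in>A. f (g i))"
proof -
  show *: "f 1 = 1" "f (x + y) = f x + f y" "f (x * y) = f x * f y" for x y
    using assms by (auto simp: ring_map_def)
  show 0: "f 0 = 0" using *(2)[of 0 0] by simp
  show m: "f (- x) = - f x" for x using *(2)[of x "- x"] 0 by (simp add: eq_neg_iff_add_eq_0 add.commute)
  show "f (x - y) = f x - f y" using *(2)[of x "- y"] m by simp
  show "f (x ^ k) = f x ^ k" by (induction k) (simp_all add: *)
  show "f (sum g A) = (\<Sum>i\<in>A. f (g i))"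
    by (induction A rule: infinite_finite_induct) (simp_all add: * 0)
qed

lemma two_sided_vimage: "ring_map f \<Longrightarrow> two_sided J \<Longrightarrow> two_sided (f -` J)"
  by (auto simp: two_sided_def ring_map_simps)

text \<open>A ring map that is compatible with scalars and ideals descends to the quotient algebras.\<close>

lemma quot_alg_hom_exists:
  assumes f: "ring_map f" and I: "two_sided I" and J: "two_sided J" and IJ: "\<And>x. x \<in> I \<Longrightarrow> f x \<in> J"
    and k: "\<And>c. f (k c) = k' c"
  shows "\<exists>\<pi>. \<pi> \<in> alg_hom (quot_alg (\<lambda>c x. k c * x) I) (quot_alg (\<lambda>c x. k' c * x) J) \<and>
    (\<forall>x. \<pi> (cls I x) = cls J (f x))"
proof -
  define \<pi> where "\<pi> X = cls J (f (SOME x. cls I x = X))" for X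
  have \<pi>: "\<pi> (cls I x) = cls J (f x)" for x
  proof -
    have "cls I (SOME y. cls I y = cls I x) = cls I x" by (rule someI[of _ x]) simp
    then show ?thesis
      using IJ by (simp add: \<pi>_def cls_eq_iff[OF I] cls_eq_iff[OF J] flip: ring_map_simps(6)[OF f])
  qed
  have "\<pi> \<in> ring_hom (quot_alg (\<lambda>c x. k c * x) I) (quot_alg (\<lambda>c x. k' c * x) J)"
    by (rule ring_hom_memI)
      (auto simp: quot_alg_simps[OF I] quot_alg_simps[OF J] \<pi> ring_map_simps[OF f])
  then have "\<pi> \<in> alg_hom (quot_alg (\<lambda>c x. k c * x) I) (quot_alg (\<lambda>c x. k' c * x) J)"
    by (auto simp: alg_hom_def quot_alg_simps[OF I] smult_quot_alg[OF I] smult_quot_alg[OF J]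
       \<pi> ring_map_simps[OF f] k)
  with \<pi> show ?thesis by blast
qed

lemma alg_hom_quot_simps:
  assumes \<pi>: "\<pi> \<in> alg_hom (quot_alg (\<lambda>c x. k c * x) I) (quot_alg (\<lambda>c x. k' c * x) J)"
    and I: "two_sided I" and J: "two_sided J"
  shows "\<exists>y. \<pi> (cls I x) = cls J y"
    "\<pi> (cls I 1) = cls J 1"
    "\<pi> (cls I x) = cls J x' \<Longrightarrow> \<pi> (cls I y) = cls J y' \<Longrightarrow> \<pi> (cls I (x + y)) = cls J (x' + y')"
    "\<pi> (cls I x) = cls J x' \<Longrightarrow> \<pi> (cls I y) = cls J y' \<Longrightarrow> \<pi> (cls I (x * y)) = cls J (x' * y')"
    "\<pi> (cls I x) = cls J x' \<Longrightarrow> \<pi> (cls I (k c * x)) = cls J (k' c * x')"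
proof -
  let ?A = "quot_alg (\<lambda>c x. k c * x) I" and ?B = "quot_alg (\<lambda>c x. k' c * x) J"
  have h: "\<pi> \<in> ring_hom ?A ?B" and s: "\<And>c x. \<pi> (c \<odot>\<^bsub>?A\<^esub> cls I x) = c \<odot>\<^bsub>?B\<^esub> \<pi> (cls I x)"
    using \<pi> by (auto simp: alg_hom_def carrier_quot_alg[OF I])
  have c: "cls I x \<in> carrier ?A" for x by (simp add: carrier_quot_alg[OF I])
  show "\<exists>y. \<pi> (cls I x) = cls J y"
    using ring_hom_closed[OF h c[of x]] by (auto simp: carrier_quot_alg[OF J])
  show "\<pi> (cls I 1) = cls J 1"
    using ring_hom_one[OF h] by (simp add: one_quot_alg[OF I] one_quot_alg[OF J])
  show "\<pi> (cls I (x + y)) = cls J (x' + y')"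
    if "\<pi> (cls I x) = cls J x'" "\<pi> (cls I y) = cls J y'"
    using ring_hom_add[OF h c c, of x y] that by (simp add: add_quot_alg[OF I] add_quot_alg[OF J])
  show "\<pi> (cls I (x * y)) = cls J (x' * y')"
    if "\<pi> (cls I x) = cls J x'" "\<pi> (cls I y) = cls J y'"
    using ring_hom_mult[OF h c c, of x y] that by (simp add: mult_quot_alg[OF I] mult_quot_alg[OF J])
  show "\<pi> (cls I (k c * x)) = cls J (k' c * x')" if "\<pi> (cls I x) = cls J x'"
    using s[of c x] that by (simp add: smult_quot_alg[OF I] smult_quot_alg[OF J])
qed

section \<open>The product of all quotients of a ring\<close>

text \<open>
  The quotient of a ring by an ideal that depends on parameters is not a type, but the product of the
  quotients by all two-sided ideals is one. It contains each single quotient as a factor, so that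
  computations in a quotient algebra can be done by type class algebra. An element of the product is
  represented by a function choosing a representative for each ideal.
\<close>

definition quots_rel :: "('a::ring_1 set \<Rightarrow> 'a) \<Rightarrow> ('a set \<Rightarrow> 'a) \<Rightarrow> bool" where
  "quots_rel f g \<longleftrightarrow> (\<forall>I. two_sided I \<longrightarrow> f I - g I \<in> I)"

lemma quots_rel_trans: "quots_rel f g \<Longrightarrow> quots_rel g h \<Longrightarrow> quots_rel f h"
  unfolding quots_rel_def
proof (intro allI impI)
  fix I :: "'a set"
  assume "\<forall>I. two_sided I \<longrightarrow> f I - g I \<in> I" "\<forall>I. two_sided I \<longrightarrow> g I - h I \<in> I" "two_sided I"
  then show "f I - h I \<in> I" using two_sided_add[of I "f I - g I" "g I - h I"] by simp
qed

lemma quots_rel_sym: "quots_rel f g \<Longrightarrow> quots_rel g f"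
  unfolding quots_rel_def using two_sided_minus_iff by (metis minus_diff_eq)

lemma quots_rel_diff:
  "quots_rel f f' \<Longrightarrow> quots_rel g g' \<Longrightarrow> quots_rel (\<lambda>I. f I - g I) (\<lambda>I. f' I - g' I)"
  unfolding quots_rel_def
proof (intro allI impI)
  fix I :: "'a set"
  assume "\<forall>I. two_sided I \<longrightarrow> f I - f' I \<in> I" "\<forall>I. two_sided I \<longrightarrow> g I - g' I \<in> I" "two_sided I"
  then show "f I - g I - (f' I - g' I) \<in> I"
    using two_sided_diff[of I "f I - f' I" "g I - g' I"] by (simp add: algebra_simps)
qed

quotient_type (overloaded) 'a quots = "'a::ring_1 set \<Rightarrow> 'a" / quots_rel
proof (rule equivpI)
  show "reflp quots_rel"
    by (simp add: quots_rel_def reflp_def two_sided_zero)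
  show "symp quots_rel"
    unfolding symp_def using quots_rel_sym by blast
  show "transp quots_rel"
    unfolding transp_def using quots_rel_trans by blast
qed

instantiation quots :: (ring_1) ring
begin

lift_definition zero_quots :: "'a quots" is "\<lambda>_. 0" .

lift_definition plus_quots :: "'a quots \<Rightarrow> 'a quots \<Rightarrow> 'a quots" is "\<lambda>f g I. f I + g I"
  unfolding quots_rel_def by (simp add: two_sided_add_diff)

lift_definition minus_quots :: "'a quots \<Rightarrow> 'a quots \<Rightarrow> 'a quots" is "\<lambda>f g I. f I - g I"
  by (rule quots_rel_diff)

lift_definition uminus_quots :: "'a quots \<Rightarrow> 'a quots" is "\<lambda>f I. - f I"
  using quots_rel_sym by (auto simp: quots_rel_def)

lift_definition times_quots :: "'a quots \<Rightarrow> 'a quots \<Rightarrow> 'a quots" is "\<lambda>f g I. f I * g I"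
  unfolding quots_rel_def by (simp add: two_sided_mult_diff)

instance
  by standard (transfer; simp add: quots_rel_def two_sided_zero algebra_simps)+

end

text \<open>
  The inclusion of the factor with index \<open>I\<close>. It does not preserve the unit, which is why the
  computations with operators below take place in rings without unit.
\<close>

lift_definition emb :: "'a::ring_1 set \<Rightarrow> 'a \<Rightarrow> 'a quots" is "\<lambda>I x J. if J = I then x else 0"  .

lemma emb_add: "emb I (x + y) = emb I x + emb I y"
  and emb_mult: "emb I (x * y) = emb I x * emb I y"
  and emb_diff: "emb I (x - y) = emb I x - emb I y"
  and emb_minus: "emb I (- x) = - emb I x"
  and emb_zero: "emb I 0 = 0"
  by (transfer; simp add: quots_rel_def two_sided_zero)+

lemma emb_eq_iff: "two_sided I \<Longrightarrow> emb I x = emb I y \<longleftrightarrow> x - y \<in> I"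
  by transfer (auto simp: quots_rel_def two_sided_zero)

lemma emb_eq_0_iff: "two_sided I \<Longrightarrow> emb I x = 0 \<longleftrightarrow> x \<in> I"
  using emb_eq_iff[of I x 0] by (simp add: emb_zero)

lemma emb_sum: "emb I (sum f A) = (\<Sum>i\<in>A. emb I (f i))"
  by (induction A rule: infinite_finite_induct) (simp_all add: emb_zero emb_add)

section \<open>Free algebras\<close>

lemma poly_mapping_sum_singles:
  "(\<Sum>w\<in>Poly_Mapping.keys a. Poly_Mapping.single w (Poly_Mapping.lookup a w)) = (a :: 'w \<Rightarrow>\<^sub>0 'c::comm_monoid_add)"
  by (rule poly_mapping_eqI)
    (auto simp: lookup_sum lookup_single when_def sum.delta Poly_Mapping.in_keys_iff)

lemma poly_mapping_single_induct:
  assumes single: "\<And>w c. P (Poly_Mapping.single w c)" and add: "\<And>a b. P a \<Longrightarrow> P b \<Longrightarrow> P (a + b)"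
  shows "P (a :: 'w \<Rightarrow>\<^sub>0 'c::comm_monoid_add)"
proof -
  have "P (\<Sum>w\<in>S. Poly_Mapping.single w (Poly_Mapping.lookup a w))" for S
    using single[of undefined 0] by (induction S rule: infinite_finite_induct) (auto intro: single add)
  then show ?thesis using poly_mapping_sum_singles[of a] by metis
qed

text \<open>
  The support of a sum may be smaller than the union of the supports. As \<open>F w 0 = 0\<close>, both sides can be
  written as sums over this union.
\<close>

lemma keys_sum_add:
  assumes "\<And>w. F w 0 = (0 :: 'b::comm_monoid_add)" "\<And>w x y. F w (x + y) = F w x + F w y"
  shows "(\<Sum>w\<in>Poly_Mapping.keys (a + b). F w (Poly_Mapping.lookup (a + b) w)) =
    (\<Sum>w\<in>Poly_Mapping.keys a. F w (Poly_Mapping.lookup a w)) +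
    (\<Sum>w\<in>Poly_Mapping.keys b. F w (Poly_Mapping.lookup b w))"
proof -
  let ?S = "Poly_Mapping.keys a \<union> Poly_Mapping.keys b"
  have *: "(\<Sum>w\<in>Poly_Mapping.keys c. F w (Poly_Mapping.lookup c w)) =
      (\<Sum>w\<in>?S. F w (Poly_Mapping.lookup c w))" if "Poly_Mapping.keys c \<subseteq> ?S" for c
    by (rule sum.mono_neutral_left) (use that in \<open>auto simp: assms(1) Poly_Mapping.in_keys_iff\<close>)
  show ?thesis
    unfolding *[OF keys_add] *[OF Un_upper1] *[OF Un_upper2]
    by (simp add: lookup_add assms(2) sum.distrib)
qed

lemma single_Cons: "Poly_Mapping.single (g # w) c = fgen g * Poly_Mapping.single w (c :: complex)"
  by (simp add: fgen_def mult_single plus_list_def)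

lemma fconst_mult_single: "fconst d * Poly_Mapping.single w c = Poly_Mapping.single w (d * c)"
  by (simp add: fconst_def mult_single plus_list_def)

lemma single_mult_fconst: "Poly_Mapping.single w c * fconst d = Poly_Mapping.single w (d * c)"
  by (simp add: fconst_def mult_single plus_list_def mult.commute)

lemma ring_map_fconst: "ring_map fconst"
  by (auto simp: ring_map_def fconst_def single_add mult_single plus_list_def zero_list_def
      simp flip: single_one)

lemmas fconst_simps = ring_map_simps[OF ring_map_fconst]

lemma fconst_central: "fconst c * a = a * fconst c"
  by (induction a rule: poly_mapping_single_induct)
    (simp_all add: fconst_mult_single single_mult_fconst distrib_left distrib_right)

lemma free_alg_induct [case_names const gen add mult]:
  assumes const: "\<And>c. P (fconst c)" and gen: "\<And>g. P (fgen g)"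
    and add: "\<And>a b. P a \<Longrightarrow> P b \<Longrightarrow> P (a + b)" and mult: "\<And>a b. P a \<Longrightarrow> P b \<Longrightarrow> P (a * b)"
  shows "P a"
proof (induction a rule: poly_mapping_single_induct)
  case (1 w c)
  show ?case
  proof (induction w)
    case Nil
    then show ?case using const[of c] by (simp add: fconst_def)
  qed (auto simp: single_Cons intro: gen mult)
qed (rule add)

subsection \<open>Substitution\<close>

text \<open>
  The substitution of elements of a ring for the generators, the map \<open>\<kappa>\<close> saying what becomes
  of the scalars.
\<close>

definition subst :: "(complex \<Rightarrow> 'b::ring_1) \<Rightarrow> ('g \<Rightarrow> 'b) \<Rightarrow> 'g free_alg \<Rightarrow> 'b" where
  "subst \<kappa> g a = (\<Sum>w\<in>Poly_Mapping.keys a. \<kappa> (Poly_Mapping.lookup a w) * prod_list (map g w))"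

context
  fixes \<kappa> :: "complex \<Rightarrow> 'b::ring_1"
  assumes \<kappa>: "ring_map \<kappa>" and central: "\<And>c y. \<kappa> c * y = y * \<kappa> c"
begin

lemma subst_single: "subst \<kappa> g (Poly_Mapping.single w c) = \<kappa> c * prod_list (map g w)"
  by (simp add: subst_def ring_map_simps(4)[OF \<kappa>])

lemma subst_add: "subst \<kappa> g (a + b) = subst \<kappa> g a + subst \<kappa> g b"
  unfolding subst_def by (rule keys_sum_add) (simp_all add: ring_map_simps[OF \<kappa>] distrib_right)

lemma subst_mult: "subst \<kappa> g (a * b) = subst \<kappa> g a * subst \<kappa> g b"
proof (induction a rule: poly_mapping_single_induct)
  case (1 v c)
  show ?case
  proof (induction b rule: poly_mapping_single_induct)
    case (1 w d)
    have "prod_list (map g v) * (\<kappa> d * prod_list (map g w)) =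
        \<kappa> d * (prod_list (map g v) * prod_list (map g w))"
      by (metis central mult.assoc)
    then show ?case
      by (simp add: subst_single mult_single plus_list_def ring_map_simps[OF \<kappa>] mult.assoc)
  qed (simp add: subst_add distrib_left)
qed (simp add: subst_add distrib_right)

lemma subst_fconst: "subst \<kappa> g (fconst c) = \<kappa> c"
  by (simp add: fconst_def subst_single)

lemma subst_fgen: "subst \<kappa> g (fgen x) = g x"
  by (simp add: fgen_def subst_single ring_map_simps[OF \<kappa>])

lemma ring_map_subst: "ring_map (subst \<kappa> g)"
  unfolding ring_map_def using subst_fconst[of g 1]
  by (simp add: subst_add subst_mult fconst_simps ring_map_simps[OF \<kappa>])

text \<open>Substitution respects a grading if it does so on the generators.\<close>

lemma subst_graded:
  assumes G0: "\<And>d. 0 \<in> G d" and Ga: "\<And>d x y. x \<in> G d \<Longrightarrow> y \<in> G d \<Longrightarrow> x + y \<in> G d"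
    and Gm: "\<And>d e x y. x \<in> G d \<Longrightarrow> y \<in> G e \<Longrightarrow> x * y \<in> G (d \<noteq> e)"
    and Gk: "\<And>c. \<kappa> c \<in> G False" and Gg: "\<And>x. g x \<in> G (deg x)"
    and a: "a \<in> homog deg d"
  shows "subst \<kappa> g a \<in> G d"
proof -
  have w: "prod_list (map g w) \<in> G (odd (length (filter deg w)))" for w
  proof (induction w)
    case Nil
    then show ?case using Gk[of 1] by (simp add: ring_map_simps[OF \<kappa>])
  next
    case (Cons x w)
    show ?case using Gm[OF Gg[of x] Cons] by (cases "deg x") simp_all
  qed
  have sum: "(\<And>w. w \<in> S \<Longrightarrow> f w \<in> G d) \<Longrightarrow> sum f S \<in> G d" for f and S :: "'g list set"
    by (induction S rule: infinite_finite_induct) (auto intro: G0 Ga)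
  show ?thesis
    unfolding subst_def
  proof (rule sum)
    fix w assume "w \<in> Poly_Mapping.keys a"
    then have "odd (length (filter deg w)) = d" using a by (simp add: homog_def)
    then show "\<kappa> (Poly_Mapping.lookup a w) * prod_list (map g w) \<in> G d"
      using Gm[OF Gk[of "Poly_Mapping.lookup a w"] w[of w]] by simp
  qed
qed

end

lemma homog_zero: "0 \<in> homog deg d"
  by (simp add: homog_def)

lemma homog_add: "x \<in> homog deg d \<Longrightarrow> y \<in> homog deg d \<Longrightarrow> x + y \<in> homog deg d"
  using keys_add[of x y] by (auto simp: homog_def)

lemma homog_minus: "x \<in> homog deg d \<Longrightarrow> - x \<in> homog deg d"
  by (simp add: homog_def)

lemma homog_sum: "(\<And>i. i \<in> S \<Longrightarrow> f i \<in> homog deg d) \<Longrightarrow> sum f S \<in> homog deg d"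
  by (induction S rule: infinite_finite_induct) (auto intro: homog_zero homog_add)

lemma homog_mult: "x \<in> homog deg d \<Longrightarrow> y \<in> homog deg e \<Longrightarrow> x * y \<in> homog deg (d \<noteq> e)"
proof -
  assume *: "x \<in> homog deg d" "y \<in> homog deg e"
  have "x * y = (\<Sum>v\<in>Poly_Mapping.keys x. Poly_Mapping.single v (Poly_Mapping.lookup x v)) *
      (\<Sum>w\<in>Poly_Mapping.keys y. Poly_Mapping.single w (Poly_Mapping.lookup y w))"
    by (simp only: poly_mapping_sum_singles)
  also have "\<dots> = (\<Sum>v\<in>Poly_Mapping.keys x. \<Sum>w\<in>Poly_Mapping.keys y.
      Poly_Mapping.single (v + w) (Poly_Mapping.lookup x v * Poly_Mapping.lookup y w))"
    by (simp add: sum_product mult_single)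
  also have "\<dots> \<in> homog deg (d \<noteq> e)"
    using * by (intro homog_sum) (auto simp: homog_def plus_list_def)
  finally show ?thesis .
qed

lemma homog_fconst: "fconst c \<in> homog deg False"
  by (simp add: homog_def fconst_def)

lemma homog_fgen: "fgen g \<in> homog deg (deg g)"
  by (simp add: homog_def fgen_def)

lemma homog_h_zero: "0 \<in> homog_h deg d"
  by (simp add: homog_h_def homog_zero)

lemma homog_h_add: "x \<in> homog_h deg d \<Longrightarrow> y \<in> homog_h deg d \<Longrightarrow> x + y \<in> homog_h deg d"
  by (simp add: homog_h_def homog_add)

lemma homog_h_diff: "x \<in> homog_h deg d \<Longrightarrow> y \<in> homog_h deg d \<Longrightarrow> x - y \<in> homog_h deg d"
  using homog_h_add[of x deg d "- y"] by (simp add: homog_h_def homog_minus)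

lemma homog_h_sum: "(\<And>i. i \<in> S \<Longrightarrow> f i \<in> homog_h deg d) \<Longrightarrow> sum f S \<in> homog_h deg d"
  by (induction S rule: infinite_finite_induct) (auto intro: homog_h_zero homog_h_add)

lemma homog_h_mult: "x \<in> homog_h deg d \<Longrightarrow> y \<in> homog_h deg e \<Longrightarrow> x * y \<in> homog_h deg (d \<noteq> e)"
  by (simp only: homog_h_def fps_mult_nth mem_Collect_eq) (blast intro: homog_sum homog_mult)

lemma homog_h_fconst: "fconst_h c \<in> homog_h deg False"
  by (simp add: homog_h_def fconst_h_def homog_fconst)

lemma homog_h_const: "a \<in> homog deg d \<Longrightarrow> fps_const a \<in> homog_h deg d"
  by (simp add: homog_h_def homog_zero)

section \<open>Power series over a ring\<close>

lemma ring_map_fconst_h: "ring_map fconst_h"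
  by (auto simp: ring_map_def fconst_h_def fps_eq_iff fps_mult_nth fconst_simps)

lemmas fconst_h_simps = ring_map_simps[OF ring_map_fconst_h]

lemma fconst_h_central: "fconst_h c * x = x * fconst_h c"
proof (rule fps_ext)
  fix k
  have "(fconst_h c * x) $ k = (\<Sum>i=0..k. x $ (k - i) * fconst (c $ i))"
    by (simp add: fps_mult_nth fconst_h_def fconst_central)
  also have "\<dots> = (\<Sum>i=0..k. x $ i * fconst (c $ (k - i)))"
    by (subst sum.atLeastAtMost_rev) simp
  finally show "(fconst_h c * x) $ k = (x * fconst_h c) $ k" by (simp add: fps_mult_nth fconst_h_def)
qed

lemma fconst_h_const: "fconst_h (fps_const c) = fps_const (fconst c)"
  by (simp add: fconst_h_def fps_eq_iff fconst_simps)

lemma fconst_h_X: "fconst_h fps_X = fps_X"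
  by (simp add: fconst_h_def fps_eq_iff fps_X_def fconst_simps)

lemma ring_map_fps_const: "ring_map (fps_const :: 'a::ring_1 \<Rightarrow> 'a fps)"
  by (simp add: ring_map_def)

lemma ring_map_comp: "ring_map f \<Longrightarrow> ring_map g \<Longrightarrow> ring_map (\<lambda>x. f (g x))"
  by (simp add: ring_map_def)

lemma fps_split: "x = fps_const (x $ 0) + fps_X * fps_shift 1 (x :: 'a::ring_1 fps)"
  by (rule fps_ext) (simp add: fps_X_mult_nth)

lemma fps_split_at: "\<exists>y. x = (\<Sum>j<k. fps_X ^ j * fps_const (x $ j)) + fps_X ^ k * (y :: 'a::ring_1 fps)"
proof (induction k)
  case (Suc k)
  then obtain y where y: "x = (\<Sum>j<k. fps_X ^ j * fps_const (x $ j)) + fps_X ^ k * y" by blast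
  have "x $ k = (\<Sum>j<k. (fps_X ^ j * fps_const (x $ j)) $ k) + (fps_X ^ k * y) $ k"
    by (subst y) (simp add: fps_sum_nth)
  also have "(\<Sum>j<k. (fps_X ^ j * fps_const (x $ j)) $ k) = 0"
    by (rule sum.neutral) (auto simp: fps_X_power_mult_nth)
  finally have y0: "y $ 0 = x $ k" by (simp add: fps_X_power_mult_nth)
  have "fps_X ^ k * y = fps_X ^ k * fps_const (x $ k) + fps_X ^ Suc k * fps_shift 1 y"
    by (subst fps_split[of y]) (simp add: y0 distrib_left power_Suc2 mult.assoc del: power_Suc)
  with y have "x = (\<Sum>j<Suc k. fps_X ^ j * fps_const (x $ j)) + fps_X ^ Suc k * fps_shift 1 y"
    by (simp add: add.assoc del: power_Suc)
  then show ?case by blast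
qed simp

lemma fps_X_mult_left: "fps_X * (a * b) = a * (fps_X * (b :: 'a::ring_1 fps))"
proof -
  have "fps_X * (a * b) = (fps_X * a) * b" by (rule mult.assoc[symmetric])
  also have "\<dots> = (a * fps_X) * b" by (subst fps_mult_fps_X_commute) (rule refl)
  also have "\<dots> = a * (fps_X * b)" by (rule mult.assoc)
  finally show ?thesis .
qed

text \<open>The continuous \<open>h\<close>-linear extension of a map into a ring of power series.\<close>

definition ext :: "('a::ring_1 \<Rightarrow> 'b::ring_1 fps) \<Rightarrow> 'a fps \<Rightarrow> 'b fps" where
  "ext S x = Abs_fps (\<lambda>k. \<Sum>j=0..k. S (x $ j) $ (k - j))"

lemma ext_cong: "(\<And>j. j \<le> k \<Longrightarrow> x $ j = y $ j) \<Longrightarrow> ext S x $ k = ext S y $ k"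
  by (simp add: ext_def)

context
  fixes S :: "'a::ring_1 \<Rightarrow> 'b::ring_1 fps"
  assumes S: "ring_map S"
begin

lemma ext_add: "ext S (x + y) = ext S x + ext S y"
  by (simp add: ext_def fps_eq_iff ring_map_simps[OF S] sum.distrib)

lemma ext_const: "ext S (fps_const a) = S a"
proof (rule fps_ext)
  fix k
  have "ext S (fps_const a) $ k = (\<Sum>j=0..k. if j = 0 then S a $ k else 0)"
    unfolding ext_def fps_nth_Abs_fps by (rule sum.cong) (auto simp: ring_map_simps[OF S])
  then show "ext S (fps_const a) $ k = S a $ k" by simp
qed

lemma ext_X: "ext S (fps_X * x) = fps_X * ext S x"
proof (rule fps_ext)
  fix k
  show "ext S (fps_X * x) $ k = (fps_X * ext S x) $ k"
  proof (cases k)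
    case (Suc k')
    have "ext S (fps_X * x) $ k = (\<Sum>j=0..Suc k'. S ((fps_X * x) $ j) $ (Suc k' - j))"
      by (simp add: ext_def Suc)
    also have "\<dots> = (\<Sum>j=0..k'. S (x $ j) $ (k' - j))"
      by (subst sum.atLeast0_atMost_Suc_shift)
        (simp add: ring_map_simps[OF S] fps_X_mult_nth)
    finally show ?thesis by (simp add: Suc ext_def fps_X_mult_nth)
  qed (simp add: ext_def ring_map_simps[OF S] fps_X_mult_nth)
qed

text \<open>
  Splitting the constant term off \<open>y\<close> reduces the coefficient of degree \<open>k + 1\<close> to the one of degree
  \<open>k\<close> for the remaining factor.
\<close>

lemma ext_const_mult: "ext S (fps_const a * y) $ k = (S a * ext S y) $ k"
proof (induction k arbitrary: y)
  case (0 y)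
  show ?case by (simp add: ext_def ring_map_simps[OF S])
next
  case (Suc k)
  have "fps_const a * y = fps_const (a * y $ 0) + fps_X * (fps_const a * fps_shift 1 y)"
    by (rule fps_ext) (simp add: fps_X_mult_nth)
  then have "ext S (fps_const a * y) = S a * S (y $ 0) + fps_X * ext S (fps_const a * fps_shift 1 y)"
    by (simp add: ext_add ext_X ext_const ring_map_simps[OF S])
  then have "ext S (fps_const a * y) $ Suc k =
      (S a * S (y $ 0) + fps_X * (S a * ext S (fps_shift 1 y))) $ Suc k"
    by (simp add: fps_X_mult_nth Suc)
  also have "S a * S (y $ 0) + fps_X * (S a * ext S (fps_shift 1 y)) =
      S a * (S (y $ 0) + fps_X * ext S (fps_shift 1 y))"
    by (simp only: distrib_left fps_X_mult_left)
  also have "S (y $ 0) + fps_X * ext S (fps_shift 1 y) = ext S y"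
    by (subst (3) fps_split[of y]) (simp add: ext_add ext_X ext_const)
  finally show ?case .
qed

lemma ext_mult: "ext S (x * y) = ext S x * ext S y"
proof (rule fps_ext)
  fix k
  show "ext S (x * y) $ k = (ext S x * ext S y) $ k"
  proof (induction k arbitrary: x)
    case (0 x)
    show ?case by (simp add: ext_def ring_map_simps[OF S])
  next
    case (Suc k)
    have "x * y = fps_const (x $ 0) * y + fps_X * (fps_shift 1 x * y)"
      by (subst (1) fps_split[of x]) (simp add: distrib_right mult.assoc)
    then have "ext S (x * y) = ext S (fps_const (x $ 0) * y) + fps_X * ext S (fps_shift 1 x * y)"
      by (simp add: ext_add ext_X)
    then have "ext S (x * y) $ Suc k =
       (S (x $ 0) * ext S y + fps_X * (ext S (fps_shift 1 x) * ext S y)) $ Suc k"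
      by (simp add: ext_const_mult fps_X_mult_nth Suc)
    also have "S (x $ 0) * ext S y + fps_X * (ext S (fps_shift 1 x) * ext S y) =
        (S (x $ 0) + fps_X * ext S (fps_shift 1 x)) * ext S y"
      by (simp add: distrib_right mult.assoc)
    also have "S (x $ 0) + fps_X * ext S (fps_shift 1 x) = ext S x"
      by (subst (3) fps_split[of x]) (simp add: ext_add ext_X ext_const)
    finally show ?case .
  qed
qed

lemma ring_map_ext: "ring_map (ext S)"
  using ext_const[of 1] by (simp add: ring_map_def ext_add ext_mult ring_map_simps[OF S])

end

text \<open>
  In the \<open>h\<close>-adic topology a condition on finitely many coefficients defines an open and closed set.
\<close>

lemma closed_coefficientwise:
  assumes Q: "\<And>k x y. (\<And>j. j \<le> k \<Longrightarrow> x $ j = y $ j) \<Longrightarrow> Q k x \<longleftrightarrow> Q k y"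
  shows "closed {x :: 'a::group_add fps. \<forall>k. Q k x}"
  unfolding closed_def open_fps_iff
proof
  fix x assume "x \<in> - {x. \<forall>k. Q k x}"
  then obtain k where k: "\<not> Q k x" by auto
  have "\<not> Q k y" if y: "fps_cutoff (Suc k) y = fps_cutoff (Suc k) x" for y
  proof -
    have "x $ j = y $ j" if "j \<le> k" for j
      using arg_cong[OF y, of "\<lambda>z. z $ j"] that by simp
    with Q[of k x y] k show ?thesis by blast
  qed
  then show "\<exists>n. {y. fps_cutoff n y = fps_cutoff n x} \<subseteq> - {x. \<forall>k. Q k x}" by auto
qed

subsection \<open>Generated ideals\<close>

lemma genideal_minimal': "two_sided I \<Longrightarrow> S \<subseteq> I \<Longrightarrow> genideal type_ring S \<subseteq> I"
  by (auto simp: genideal_def ideal_type_ring_iff)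

lemma genideal_incl: "S \<subseteq> genideal type_ring S"
  by (auto simp: genideal_def)

lemma two_sided_Inter: "(\<And>I. I \<in> C \<Longrightarrow> two_sided I) \<Longrightarrow> two_sided (\<Inter>C)"
  by (simp add: two_sided_def)

lemma two_sided_genideal: "two_sided (genideal type_ring S)"
  unfolding genideal_def by (rule two_sided_Inter) (simp add: ideal_type_ring_iff)

lemma top_ideal_minimal:
  "two_sided I \<Longrightarrow> S \<subseteq> I \<Longrightarrow> closed I \<Longrightarrow> (\<And>x. fps_X * x \<in> I \<Longrightarrow> x \<in> I) \<Longrightarrow> top_ideal S \<subseteq> I"
  by (auto simp: top_ideal_def ideal_type_ring_iff)

lemma top_ideal_incl: "S \<subseteq> top_ideal S"
  unfolding top_ideal_def by blast

lemma two_sided_top_ideal: "two_sided (top_ideal S)"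
  unfolding top_ideal_def by (rule two_sided_Inter) (simp add: ideal_type_ring_iff)

lemma two_sided_coefficientwise:
  assumes I: "two_sided I"
  shows "two_sided {x :: 'a::ring_1 fps. \<forall>k. x $ k \<in> I}"
  unfolding two_sided_def[of "{x. _ x}"]
  by (simp add: fps_mult_nth two_sided_zero[OF I] two_sided_diff[OF I] two_sided_sum[OF I]
      two_sided_left[OF I] two_sided_right[OF I])

text \<open>
  For relations not involving \<open>h\<close>, the topologically free algebra consists of the power series
  over the algebra which the relations define over the complex numbers.
\<close>

lemma top_ideal_const:
  "top_ideal (fps_const ` S) = {x :: 'a::ring_1 fps. \<forall>k. x $ k \<in> genideal type_ring S}"
proof
  let ?J = "genideal type_ring S"
  have "0 \<in> ?J" by (rule two_sided_zero[OF two_sided_genideal])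
  then show "top_ideal (fps_const ` S) \<subseteq> {x. \<forall>k. x $ k \<in> ?J}"
  proof (intro top_ideal_minimal two_sided_coefficientwise two_sided_genideal)
    show "fps_const ` S \<subseteq> {x. \<forall>k. x $ k \<in> ?J}" using subsetD[OF genideal_incl[of S]] \<open>0 \<in> ?J\<close> by auto
    show "closed {x. \<forall>k. x $ k \<in> ?J}" by (rule closed_coefficientwise) auto
    fix x assume x: "fps_X * x \<in> {x. \<forall>k. x $ k \<in> ?J}"
    have "x $ k \<in> ?J" for k using x[simplified, rule_format, of "Suc k"] by (simp add: fps_X_mult_nth)
    then show "x \<in> {x. \<forall>k. x $ k \<in> ?J}" by simp
  qed
next
  show "{x :: 'a fps. \<forall>k. x $ k \<in> genideal type_ring S} \<subseteq> top_ideal (fps_const ` S)"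
    unfolding top_ideal_def
  proof (safe, goal_cases)
    case (1 x I)
    then have I: "two_sided I" by (simp add: ideal_type_ring_iff)
    have "two_sided (fps_const -` I)" by (rule two_sided_vimage[OF ring_map_fps_const I])
    then have J: "genideal type_ring S \<subseteq> fps_const -` I"
      using 1 by (intro genideal_minimal') auto
    have part: "fps_cutoff k x \<in> I" for k
    proof -
      have "fps_cutoff k x = (\<Sum>j<k. fps_X ^ j * fps_const (x $ j))"
      proof (rule fps_ext)
        fix i
        have "(\<Sum>j<k. fps_X ^ j * fps_const (x $ j)) $ i = (\<Sum>j<k. if j = i then x $ i else 0)"
          unfolding fps_sum_nth by (rule sum.cong) (auto simp: fps_X_power_mult_nth)
        then show "fps_cutoff k x $ i = (\<Sum>j<k. fps_X ^ j * fps_const (x $ j)) $ i" by simp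
      qed
      also have "\<dots> \<in> I" using J 1(1) by (intro two_sided_sum[OF I] two_sided_left[OF I]) auto
      finally show ?thesis .
    qed
    have "open (- I)" using 1 by (simp add: closed_def)
    show "x \<in> I"
    proof (rule ccontr)
      assume "x \<notin> I"
      then obtain k where "{G. fps_cutoff k G = fps_cutoff k x} \<subseteq> - I"
        using \<open>open (- I)\<close> unfolding open_fps_iff by blast
      moreover have "fps_cutoff k (fps_cutoff k x) = fps_cutoff k x" by (simp add: fps_eq_iff)
      ultimately show False using part[of k] by blast
    qed
  qed
qed

section \<open>Serre relations from commutation relations\<close>

definition comm :: "'b::ring \<Rightarrow> 'b \<Rightarrow> bool" where
  "comm a b \<longleftrightarrow> a * b = b * a"

text \<open>Commutation up to sign suffices wherever a product vanishes because of a square.\<close>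

definition skew :: "'b::ring \<Rightarrow> 'b \<Rightarrow> bool" where
  "skew a b \<longleftrightarrow> a * b = b * a \<or> a * b = - (b * a)"

lemma comm_sym: "comm a b \<Longrightarrow> comm b a"
  by (simp add: comm_def)

lemma comm_left: "comm a b \<Longrightarrow> a * (b * c) = b * (a * c)"
  unfolding comm_def by (metis mult.assoc)

lemma comm_mult_right: "comm a b \<Longrightarrow> comm a c \<Longrightarrow> comm a (b * c)"
  unfolding comm_def by (metis mult.assoc)

lemma comm_mult_left: "comm a c \<Longrightarrow> comm b c \<Longrightarrow> comm (a * b) c"
  unfolding comm_def by (metis mult.assoc)

lemma comm_minus: "comm a b \<Longrightarrow> comm a (- b)" "comm a b \<Longrightarrow> comm (- a) b"
  by (simp_all add: comm_def)

lemma skew_mult_right: assumes "skew a b" "skew a c" shows "skew a (b * c)"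
proof -
  have "a * (b * c) = b * (a * c) \<or> a * (b * c) = - (b * (a * c))"
    using assms(1) unfolding skew_def by (metis mult.assoc minus_mult_left)
  moreover have "b * (a * c) = (b * c) * a \<or> b * (a * c) = - ((b * c) * a)"
    using assms(2) unfolding skew_def by (metis mult.assoc minus_mult_right)
  ultimately show ?thesis by (auto simp: skew_def)
qed

lemma skew_square_zero: "a * a = 0 \<Longrightarrow> skew a z \<Longrightarrow> a * (z * a) = 0"
proof -
  assume a: "a * a = 0" and "skew a z"
  then have "z * a = a * z \<or> z * a = - (a * z)" by (auto simp: skew_def)
  moreover have "a * (a * z) = 0" using a by (simp flip: mult.assoc)
  ultimately show ?thesis by auto
qed

lemma skew_comm_product:
  assumes "a * b = - (b * a)" "a * c = - (c * a)" shows "comm a (b * c)"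
proof -
  have "a * (b * c) = - (b * (a * c))" using assms(1) by (metis mult.assoc minus_mult_left)
  also have "\<dots> = (b * c) * a" using assms(2) by (simp add: mult.assoc)
  finally show ?thesis by (simp add: comm_def)
qed

text \<open>
  The Serre relations say that \<open>serre\<close> and \<open>serre4\<close> vanish on neighbouring generators, where
  \<open>k = q + q\<^sup>-\<^sup>1\<close>.
\<close>

definition serre :: "'b::ring \<Rightarrow> 'b \<Rightarrow> 'b \<Rightarrow> 'b" where
  "serre k x y = x * x * y - k * (x * y * x) + y * (x * x)"

definition serre4 :: "'b::ring \<Rightarrow> 'b \<Rightarrow> 'b \<Rightarrow> 'b \<Rightarrow> 'b" where
  "serre4 k x y z = y * x * y * z + x * y * z * y + y * z * y * x + z * y * x * y
     - k * (y * x * z * y)"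

text \<open>
  The hopping operators \<open>a x\<close> and \<open>y b\<close> share the site of \<open>x\<close> and \<open>y\<close>. The operators \<open>a\<close> and \<open>b\<close> at the
  outer sites commute with everything else, so they factor out.
\<close>

lemma serre_shared_left:
  assumes "comm a x" "comm a y" "comm b x" "comm b y" "comm a b" "comm a k"
    and "serre k x y = 0"
  shows "serre k (a * x) (y * b) = 0"
proof -
  note c = assms(1-5)[THEN comm_sym] assms(6)
  note r = c[unfolded comm_def] c[THEN comm_left]
  have "serre k (a * x) (y * b) = a * (a * (serre k x y * b))"
    by (simp add: serre_def mult.assoc r algebra_simps)
  then show ?thesis using assms(7) by simp
qed

lemma serre_shared_right:
  assumes "comm a x" "comm a y" "comm b x" "comm b y" "comm a b" "comm a k"
    and "serre k y x = 0"
  shows "serre k (y * b) (a * x) = 0"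
proof -
  note c = assms(1-5)[THEN comm_sym] assms(6)
  note r = c[unfolded comm_def] c[THEN comm_left]
  have "serre k (y * b) (a * x) = a * (serre k y x * (b * b))"
    by (simp add: serre_def mult.assoc r algebra_simps)
  then show ?thesis using assms(7) by simp
qed

text \<open>
  If \<open>a\<close> squares to zero and passes all other operators up to sign, a product containing \<open>a\<close> twice
  vanishes; every term of the Serre relation is of this form.
\<close>

lemma serre_zero_left:
  assumes "a * a = 0" "skew a x" "skew a z"
  shows "serre k (a * x) z = 0"
proof -
  have "(a * x) * (a * x) = (a * (x * a)) * x" "(a * x) * z * (a * x) = (a * ((x * z) * a)) * x"
    by (simp_all add: mult.assoc)
  then have "(a * x) * (a * x) = 0" "(a * x) * z * (a * x) = 0"
    using assms by (simp_all add: skew_square_zero skew_mult_right)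
  then show ?thesis by (simp add: serre_def)
qed

lemma serre_zero_right:
  assumes "b * b = 0" "skew b y" "skew b z"
  shows "serre k (y * b) z = 0"
proof -
  have "(y * b) * (y * b) = y * (b * (y * b))" "(y * b) * z * (y * b) = y * (b * ((z * y) * b))"
    by (simp_all add: mult.assoc)
  then have "(y * b) * (y * b) = 0" "(y * b) * z * (y * b) = 0"
    using assms by (simp_all add: skew_square_zero skew_mult_right)
  then show ?thesis by (simp add: serre_def)
qed

text \<open>
  Here \<open>x\<close>, \<open>y\<close> belong to a shared Bose site and \<open>x'\<close>, \<open>y'\<close> to a shared Fermi site. The first and the
  fourth term contain \<open>x' x'\<close>; in the other three \<open>x' y' d x'\<close> factors out together with \<open>a\<close>, leaving a
  Serre relation at the Bose site.
\<close>

lemma serre4_shared: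
  assumes "comm a x" "comm a y" "comm a x'" "comm a y'" "comm a d"
    "comm x x'" "comm x y'" "comm x d" "comm y x'" "comm y y'" "comm y d" "comm a k"
    and x': "x' * x' = 0" and "serre k y x = 0"
  shows "serre4 k (a * x) (y * x') (y' * d) = 0"
proof -
  note c = assms(1-11)[THEN comm_sym] assms(12)
  note r = c[unfolded comm_def] c[THEN comm_left]
  have x'': "x' * (x' * z) = 0" for z using x' by (simp flip: mult.assoc)
  have "serre4 k (a * x) (y * x') (y' * d) = a * (serre k y x * (x' * (y' * (d * x'))))"
    by (simp add: serre_def serre4_def mult.assoc r x' x'' algebra_simps)
  then show ?thesis using assms(14) by simp
qed

lemma serre_minus: "serre k (- x) y = serre k x y" "serre k x (- y) = - serre k x y"
  by (simp_all add: serre_def)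

lemma serre4_minus: "serre4 k x y (- z) = - serre4 k x y z" "serre4 k x (- y) z = serre4 k x y z"
  by (simp_all add: serre4_def)

text \<open>
  For the first generator \<open>s\<close> is a function of \<open>N\<close>. It is passed to the left, and becomes \<open>s'\<close> on
  passing \<open>x\<close>, which changes \<open>N\<close> by one.
\<close>

lemma serre_scaled:
  assumes "x * s = s' * x" "comm y s" "comm y s'" "comm s k" "comm s' k"
  shows "serre k (s * x) y = s * (s' * serre k x y)" "serre k y (s * x) = s * serre k y x"
proof -
  have x: "x * (s * z) = s' * (x * z)" for z using assms(1) by (metis mult.assoc)
  note c = assms(2-5)
  note r = c[unfolded comm_def] c[THEN comm_left]
  show "serre k (s * x) y = s * (s' * serre k x y)" "serre k y (s * x) = s * serre k y x"
    by (simp_all add: serre_def mult.assoc r x algebra_simps)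
qed

lemma serre4_scaled:
  assumes "comm y s" "comm z s" "comm s k"
  shows "serre4 k (s * x) y z = s * serre4 k x y z"
proof -
  note r = assms[unfolded comm_def] assms[THEN comm_left]
  show ?thesis by (simp add: serre4_def mult.assoc r algebra_simps)
qed

section \<open>Bose and Fermi operators\<close>

text \<open>
  The scalars are the complex numbers for numerical \<open>q\<close> and the power series for formal \<open>q\<close>. Here \<open>Q x\<close>
  is \<open>q\<^sup>x\<close>, \<open>br x\<close> is \<open>[x]\<close>, and \<open>s x\<close> and \<open>t x\<close> are square roots of \<open>[x]\<close> and \<open>[x] / x\<close>.
\<close>

locale q_numbers =
  fixes \<iota> :: "complex \<Rightarrow> 'k::idom" and Q br :: "complex \<Rightarrow> 'k" and qs :: 'k and s t :: "complex \<Rightarrow> 'k"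
  assumes \<iota>: "ring_map \<iota>"
    and Q_add: "Q (x + y) = Q x * Q y" and Q_0: "Q 0 = 1" and Q_1: "Q 1 \<noteq> Q (-1)"
    and br: "br x * (Q 1 - Q (-1)) = Q x - Q (- x)"
    and qs: "qs = Q 1 + Q (-1)"
    and s: "s x * s x = br x" and t: "x \<noteq> 0 \<Longrightarrow> t x * t x * \<iota> x = br x"
begin

lemma br_simps: "br 0 = 0" "br 1 = 1" "br (-1) = -1"
proof -
  have d: "Q 1 - Q (-1) \<noteq> 0" using Q_1 by simp
  have "br 0 * (Q 1 - Q (-1)) = 0 * (Q 1 - Q (-1))" "br 1 * (Q 1 - Q (-1)) = 1 * (Q 1 - Q (-1))"
    "br (-1) * (Q 1 - Q (-1)) = -1 * (Q 1 - Q (-1))"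
    by (simp_all only: br) simp_all
  then show "br 0 = 0" "br 1 = 1" "br (-1) = -1" using d by (metis mult_right_cancel)+
qed

lemma t_sq: "t x * t x * \<iota> x = br x"
  using t[of x] by (cases "x = 0") (simp_all add: br_simps ring_map_simps[OF \<iota>])

text \<open>
  If \<open>a\<close> and \<open>b\<close> are the occupation numbers of two neighbouring Bose sites, \<open>[a] [b + 1]\<close> and
  \<open>[a + 1] [b]\<close> are the eigenvalues of \<open>e\<^sub>i f\<^sub>i\<close> and \<open>f\<^sub>i e\<^sub>i\<close>.
\<close>

lemma br_exchange: "br a * br (b + 1) - br (a + 1) * br b = br (a - b)"
proof -
  let ?d = "Q 1 - Q (-1)"
  have inv: "Q x * Q (- x) = 1" for x using Q_add[of x "- x"] Q_0 by simp
  have Qm: "Q (- (x + y)) = Q (- x) * Q (- y)" "Q (x - y) = Q x * Q (- y)"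
     "Q (- (x - y)) = Q (- x) * Q y" "Q (y - x) = Q (- x) * Q y" for x y
    using Q_add[of "- x" "- y"] Q_add[of x "- y"] Q_add[of "- x" y] by (simp_all add: algebra_simps)
  have "(br a * br (b + 1) - br (a + 1) * br b) * (?d * ?d) =
      (br a * ?d) * (br (b + 1) * ?d) - (br (a + 1) * ?d) * (br b * ?d)" by (simp add: algebra_simps)
  also have "\<dots> = ?d * (br (a - b) * ?d)"
    unfolding br Q_add Qm by (simp add: algebra_simps)
  finally have "(br a * br (b + 1) - br (a + 1) * br b) * (?d * ?d) = br (a - b) * (?d * ?d)"
    by (simp add: algebra_simps)
  then show ?thesis using Q_1 by simp
qed

text \<open>
  Both \<open>q\<^sup>x\<close> and \<open>q\<^sup>-\<^sup>x\<close> satisfy the recursion, whose characteristic roots are \<open>q\<close> and \<open>q\<^sup>-\<^sup>1\<close>.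
\<close>

lemma br_recursion: "br (x + 1) - qs * br x + br (x - 1) = 0"
proof -
  let ?d = "Q 1 - Q (-1)"
  have Qm: "Q (- (x + 1)) = Q (- x) * Q (- 1)" "Q (x - 1) = Q x * Q (- 1)"
     "Q (- (x - 1)) = Q (- x) * Q 1" "Q (1 - x) = Q (- x) * Q 1"
    using Q_add[of "- x" "- 1"] Q_add[of x "- 1"] Q_add[of "- x" 1] by (simp_all add: algebra_simps)
  have "(br (x + 1) - qs * br x + br (x - 1)) * ?d = br (x + 1) * ?d - qs * (br x * ?d) + br (x - 1) * ?d"
    by (simp add: algebra_simps)
  also have "\<dots> = 0" unfolding br qs Q_add Qm by (simp add: algebra_simps)
  finally show ?thesis using Q_1 by simp
qed

end

lemma tot_upd: "i \<in> {1..<n+m} \<Longrightarrow> tot n m (x(i := y)) = tot n m x - x i + y"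
  unfolding tot_def by (simp add: sum.remove[of _ i])

text \<open>
  The functions of the number operators, and the creation (\<open>op True i\<close>) and annihilation operators
  (\<open>op False i\<close>). The constants act through the functions of the number operators, and the constant
  function \<open>1\<close> takes the place of a unit.
\<close>

locale oscillators = q_numbers \<iota> Q br qs s t
  for \<iota> :: "complex \<Rightarrow> 'k::idom" and Q br qs s t +
  fixes n m :: nat and p :: complex and fn :: "((nat \<Rightarrow> complex) \<Rightarrow> 'k) \<Rightarrow> 'b::ring" and op :: "bool \<Rightarrow> nat \<Rightarrow> 'b"
  assumes n: "n \<ge> 1"
    and fn_add: "fn (\<lambda>x. \<phi> x + \<psi> x) = fn \<phi> + fn \<psi>"
    and fn_mult: "fn \<phi> * fn \<psi> = fn (\<lambda>x. \<phi> x * \<psi> x)"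
    and fn_num: "i \<in> {1..<n+m} \<Longrightarrow> op True i * op False i = fn (\<lambda>x. \<iota> (x i))"
    and fn_num': "i \<in> {1..<n+m} \<Longrightarrow>
      op False i * op True i = fn (\<lambda>x. if n \<le> i then 1 - \<iota> (x i) else \<iota> (x i + 1))"
    and op_fn: "i \<in> {1..<n+m} \<Longrightarrow> op u i * fn \<phi> = fn (\<lambda>x. \<phi> (x(i := if u then x i - 1 else x i + 1))) * op u i"
    and one_op: "fn (\<lambda>_. 1) * op u i = op u i"
    and op_op: "i \<in> {1..<n+m} \<Longrightarrow> j \<in> {1..<n+m} \<Longrightarrow> i \<noteq> j \<Longrightarrow>
      op u i * op v j = (if n \<le> i \<and> n \<le> j then - (op v j * op u i) else op v j * op u i)"
    and op_sq: "i \<in> {1..<n+m} \<Longrightarrow> n \<le> i \<Longrightarrow> op u i * op u i = 0"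
begin

lemma fn_zero: "fn (\<lambda>_. 0) = 0"
  using fn_add[of "\<lambda>_. 0" "\<lambda>_. 0"] by simp

lemma fn_diff: "fn (\<lambda>x. \<phi> x - \<psi> x) = fn \<phi> - fn \<psi>"
  using fn_add[of "\<lambda>x. \<phi> x - \<psi> x" \<psi>] by simp

lemma fn_mult_left: "fn \<phi> * (fn \<psi> * z) = fn (\<lambda>x. \<phi> x * \<psi> x) * z"
  by (simp add: fn_mult flip: mult.assoc)

lemma fn_comm: "comm (fn \<phi>) (fn \<psi>)"
  by (simp add: comm_def fn_mult mult.commute)

text \<open>
  A Fermi number operator satisfies \<open>N\<^sub>i (1 - N\<^sub>i) = 0\<close>, and \<open>\<phi>\<close> is a multiple of \<open>x\<^sub>i (1 - x\<^sub>i)\<close>.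
\<close>

lemma fn_fermi:
  assumes i: "i \<in> {1..<n+m}" "n \<le> i" and \<phi>: "\<And>x. x i = 0 \<or> x i = 1 \<Longrightarrow> \<phi> x = 0"
  shows "fn \<phi> = 0"
proof -
  let ?N = "fn (\<lambda>x. \<iota> (x i))"
  have "fn (\<lambda>x. \<iota> (x i) * (1 - \<iota> (x i))) = (op True i * op False i) * (op False i * op True i)"
    using i by (simp add: fn_num fn_num' fn_mult)
  also have "\<dots> = op True i * (op False i * op False i) * op True i" by (simp add: mult.assoc)
  also have "\<dots> = 0" using i by (simp add: op_sq)
  finally have N: "fn (\<lambda>x. \<iota> (x i) * (1 - \<iota> (x i))) = 0" .
  \<comment> \<open>if the denominator is zero, \<open>\<phi> x\<close> is zero, so the value of the quotient does not matter\<close>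
  let ?\<psi> = "\<lambda>x. \<iota> (1 / (x i * (1 - x i))) * \<phi> x"
  have "\<iota> (x i) * (1 - \<iota> (x i)) * ?\<psi> x = \<phi> x" for x
  proof (cases "x i = 0 \<or> x i = 1")
    case False
    then have "1 = x i * (1 - x i) * (1 / (x i * (1 - x i)))" by simp
    from arg_cong[OF this, of \<iota>] have "\<iota> (x i) * (1 - \<iota> (x i)) * \<iota> (1 / (x i * (1 - x i))) = 1"
      by (simp only: ring_map_simps[OF \<iota>])
    then show ?thesis by (simp flip: mult.assoc)
  qed (simp add: \<phi>)
  then have "fn \<phi> = fn (\<lambda>x. \<iota> (x i) * (1 - \<iota> (x i))) * fn ?\<psi>"
    by (simp only: fn_mult)
  then show ?thesis by (simp add: N)
qed

lemma fn_fermi_cong: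
  assumes i: "i \<in> {1..<n+m}" "n \<le> i" and "\<And>x. x i = 0 \<or> x i = 1 \<Longrightarrow> \<phi> x = \<psi> x"
  shows "fn \<phi> = fn \<psi>"
  using fn_fermi[OF i, of "\<lambda>x. \<phi> x - \<psi> x"] assms(3) by (simp add: fn_diff)

definition g :: "bool \<Rightarrow> nat \<Rightarrow> complex \<Rightarrow> 'k" where
  "g u i x = ang n t i (if u then x else x + 1)"

text \<open>
  The deformed oscillators \<open>\<langle>N\<^sub>i\<rangle> A\<^sub>i\<^sup>+\<close> and \<open>\<langle>N\<^sub>i + 1\<rangle> A\<^sub>i\<^sup>-\<close>. The unit at site \<open>0\<close> makes the images of \<open>e\<^sub>1\<close>
  and \<open>f\<^sub>1\<close> instances of hopping operators, up to a function of \<open>N\<close>.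
\<close>

definition b :: "bool \<Rightarrow> nat \<Rightarrow> 'b" where
  "b u i = (if i = 0 then fn (\<lambda>_. 1) else fn (\<lambda>x. g u i (x i)) * op u i)"

text \<open>
  The values of \<open>b\<^sup>+ b\<^sup>-\<close> and of \<open>b\<^sup>- b\<^sup>+\<close> at occupation number \<open>x\<close>.
\<close>

definition lo :: "nat \<Rightarrow> complex \<Rightarrow> 'k" where
  "lo i x = (if n \<le> i then \<iota> x else br x)"

definition hi :: "nat \<Rightarrow> complex \<Rightarrow> 'k" where
  "hi i x = (if n \<le> i then 1 - \<iota> x else br (x + 1))"

lemma one_b: "fn (\<lambda>_. 1) * b u i = b u i"
  by (simp add: b_def fn_mult fn_mult_left)

lemma b_one: "i < n + m \<Longrightarrow> b u i * fn (\<lambda>_. 1) = b u i"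
  using op_fn[of i u "\<lambda>_. 1"] by (simp add: b_def fn_mult mult.assoc one_op)

lemma b_fn:
  assumes i: "i \<in> {1..<n+m}"
  shows "b u i * fn \<phi> = fn (\<lambda>x. \<phi> (x(i := if u then x i - 1 else x i + 1))) * b u i"
  using i by (simp add: b_def mult.assoc op_fn fn_mult_left mult.commute)

lemma b_fn_indep:
  assumes i: "i < n+m" and \<phi>: "\<And>x y. \<phi> (x(i := y)) = \<phi> x"
  shows "comm (b u i) (fn \<phi>)"
proof (cases "i = 0")
  case False
  then show ?thesis using b_fn[of i u \<phi>] i by (simp add: comm_def \<phi>)
qed (simp add: comm_def b_def fn_mult)

lemma b_const: "i < n+m \<Longrightarrow> comm (b u i) (fn (\<lambda>_. c))"
  by (simp add: b_fn_indep)

lemma b_b: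
  assumes ij: "i < n+m" "j < n+m" "i \<noteq> j"
  shows "b u i * b v j = (if n \<le> i \<and> n \<le> j then - (b v j * b u i) else b v j * b u i)"
proof (cases "i = 0 \<or> j = 0")
  case True
  then show ?thesis using n ij b_one[of i u] b_one[of j v] one_b[of u i] one_b[of v j] by (auto simp: b_def)
next
  case False
  then have "b u i * b v j = fn (\<lambda>x. g v j (x j) * g u i (x i)) * (op u i * op v j)"
    "b v j * b u i = fn (\<lambda>x. g v j (x j) * g u i (x i)) * (op v j * op u i)"
    using ij op_fn[of i u] op_fn[of j v]
    by (auto simp: b_def mult.assoc fn_mult_left mult.commute simp flip: mult.assoc[of "op u i"] mult.assoc[of "op v j"])
  then show ?thesis using False ij by (simp add: op_op[of i j u v])
qed

lemma b_comm: "i < n+m \<Longrightarrow> j < n+m \<Longrightarrow> i \<noteq> j \<Longrightarrow> i < n \<or> j < n \<Longrightarrow> comm (b u i) (b v j)"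
  by (auto simp: comm_def b_b[of i j])

lemma b_skew: "i < n+m \<Longrightarrow> j < n+m \<Longrightarrow> i \<noteq> j \<Longrightarrow> skew (b u i) (b v j)"
  by (auto simp: skew_def b_b[of i j])

lemma b_sq:
  assumes i: "i \<in> {1..<n+m}" "n \<le> i" shows "b u i * b u i = 0"
proof -
  have "b u i * b u i = fn (\<lambda>x. g u i (x i)) * ((op u i * fn (\<lambda>x. g u i (x i))) * op u i)"
    using i by (simp add: b_def mult.assoc)
  also have "\<dots> = 0" using i by (simp add: op_fn op_sq mult.assoc)
  finally show ?thesis .
qed

lemma b_lo: "i \<in> {1..<n+m} \<Longrightarrow> b True i * b False i = fn (\<lambda>x. lo i (x i))"
  and b_hi: "i \<in> {1..<n+m} \<Longrightarrow> b False i * b True i = fn (\<lambda>x. hi i (x i))"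
proof -
  assume i: "i \<in> {1..<n+m}"
  have *: "b u i * b (\<not> u) i = fn (\<lambda>x. g u i (x i) * g (\<not> u) i (if u then x i - 1 else x i + 1)) *
      (op u i * op (\<not> u) i)" for u
  proof -
    have "b u i * b (\<not> u) i = fn (\<lambda>x. g u i (x i)) * ((op u i * fn (\<lambda>x. g (\<not> u) i (x i))) * op (\<not> u) i)"
      using i by (simp add: b_def mult.assoc)
    then show ?thesis unfolding op_fn[OF i] by (simp add: fn_mult_left mult.assoc)
  qed
  show "b True i * b False i = fn (\<lambda>x. lo i (x i))"
    using *[of True] i
    by (cases "n \<le> i") (simp_all add: fn_num fn_mult g_def ang_def theta_def lo_def t_sq)
  show "b False i * b True i = fn (\<lambda>x. hi i (x i))"
    using *[of False] i
    by (cases "n \<le> i") (simp_all add: fn_num' fn_mult g_def ang_def theta_def hi_def t_sq)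
qed

text \<open>
  The products of \<open>b\<^sup>+\<close> and \<open>b\<^sup>-\<close> are functions of \<open>N\<^sub>i\<close>. Moving them to the left of the remaining operator
  shifts the argument by one, and the three coefficients cancel by the recursion for \<open>[x]\<close>.
\<close>

lemma b_serre: assumes i: "i \<in> {1..<n+m}" "i < n" shows "serre (fn (\<lambda>_. qs)) (b u i) (b (\<not> u) i) = 0"
proof -
  let ?x = "b u i" and ?y = "b (\<not> u) i"
  define \<phi> where "\<phi> = (\<lambda>x :: nat \<Rightarrow> complex. br (if u then x i else x i + 1))"
  define \<psi> where "\<psi> = (\<lambda>x :: nat \<Rightarrow> complex. br (if u then x i + 1 else x i))"
  have xy: "?x * ?y = fn \<phi>" and yx: "?y * ?x = fn \<psi>"
    using i b_lo[of i] b_hi[of i] by (cases u; simp add: \<phi>_def \<psi>_def lo_def hi_def)+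
  have "?x * ?x * ?y = fn (\<lambda>x. \<phi> (x(i := if u then x i - 1 else x i + 1))) * ?x"
    using i by (simp add: mult.assoc xy b_fn)
  moreover have "?x * ?y * ?x = fn \<phi> * ?x" "?y * (?x * ?x) = fn \<psi> * ?x"
    by (simp_all add: xy yx flip: mult.assoc)
  ultimately have "serre (fn (\<lambda>_. qs)) ?x ?y =
      fn (\<lambda>x. \<phi> (x(i := if u then x i - 1 else x i + 1)) - qs * \<phi> x + \<psi> x) * ?x"
    by (simp add: serre_def fn_add fn_diff fn_mult_left distrib_right left_diff_distrib)
  also have "(\<lambda>x. \<phi> (x(i := if u then x i - 1 else x i + 1)) - qs * \<phi> x + \<psi> x) = (\<lambda>_. 0)"
  proof
    fix x :: "nat \<Rightarrow> complex"
    show "\<phi> (x(i := if u then x i - 1 else x i + 1)) - qs * \<phi> x + \<psi> x = 0"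
      using br_recursion[of "x i"] br_recursion[of "x i + 1"]
      by (cases u) (simp_all add: \<phi>_def \<psi>_def algebra_simps)
  qed
  finally show ?thesis by (simp add: fn_zero)
qed

subsection \<open>Images of the generators\<close>

text \<open>
  The operator that moves a quantum from site \<open>i\<close> to site \<open>i - 1\<close> if \<open>v\<close> holds, and back otherwise.
\<close>

definition D :: "bool \<Rightarrow> nat \<Rightarrow> 'b" where
  "D v i = b v (i - 1) * b (\<not> v) i"

text \<open>On passing two Fermi operators, a Fermi operator picks up two signs, which cancel.\<close>

lemma comm_b_pair:
  assumes "i < n+m" "j < n+m" "k < n+m" "i \<noteq> j" "i \<noteq> k" "n \<le> i \<Longrightarrow> n \<le> j \<longleftrightarrow> n \<le> k"
  shows "comm (b u i) (b v j * b w k)"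
proof (cases "n \<le> i \<and> n \<le> j")
  case True
  then show ?thesis using assms by (intro skew_comm_product) (simp_all add: b_b[of i j] b_b[of i k])
next
  case False
  then have "i < n \<or> j < n" "i < n \<or> k < n"
    using assms(6) by (cases "n \<le> i"; simp add: not_le)+
  then show ?thesis using assms by (intro comm_mult_right b_comm)
qed

lemma D_comm: assumes "i \<in> {1..<n+m}" "j \<in> {1..<n+m}" "i + 1 < j" shows "comm (D v i) (D w j)"
  unfolding D_def using assms by (intro comm_mult_left comm_b_pair) auto

text \<open>
  Hopping operators of opposite direction contain the same operator \<open>z\<close> at their common site; if it is a
  Fermi site, both products vanish because of \<open>z z = 0\<close>.
\<close>

lemma D_comm_adjacent:
  assumes "i \<in> {1..<n+m}" "i + 1 \<in> {1..<n+m}" shows "comm (D v i) (D (\<not> v) (i + 1))"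
proof -
  let ?a = "b v (i - 1)" and ?z = "b (\<not> v) i" and ?c = "b v (i + 1)"
  have D: "D v i = ?a * ?z" "D (\<not> v) (i + 1) = ?z * ?c" by (simp_all add: D_def)
  show ?thesis
  proof (cases "i < n")
    case True
    then have "comm ?z ?a" "comm ?c ?a" "comm ?c ?z" using assms by (auto intro!: b_comm)
    note r = this[unfolded comm_def] this[THEN comm_left]
    show ?thesis unfolding D comm_def by (simp only: mult.assoc r)
  next
    case False
    then have z: "?z * ?z = 0" using assms by (intro b_sq) auto
    have "?z * ((?c * ?a) * ?z) = 0"
      using assms by (intro skew_square_zero z skew_mult_right b_skew) auto
    moreover have "?z * (?z * ?c) = 0" using z by (simp flip: mult.assoc)
    ultimately show ?thesis unfolding D comm_def by (simp only: mult.assoc) (simp only: mult_zero_right)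
  qed
qed

text \<open>
  Hopping between the sites \<open>1, \<dots>, n+m-1\<close> preserves the total number of quanta.
\<close>

lemma D_tot:
  assumes "j \<in> {2..<n+m}" shows "comm (D v j) (fn (\<lambda>x. f (tot n m x)))"
proof -
  have j: "j \<in> {1..<n+m}" "j - 1 \<in> {1..<n+m}" "j \<noteq> j - 1" using assms by auto
  have tot: "tot n m (x(j - 1 := if v then x (j - 1) - 1 else x (j - 1) + 1,
      j := if v then x j + 1 else x j - 1)) = tot n m x" for x
    unfolding tot_upd[OF j(1)] tot_upd[OF j(2)] using j by simp
  have upd: "(x(j - 1 := a)) j = x j" for x :: "nat \<Rightarrow> complex" and a using j(3) by simp
  have "D v j * fn (\<lambda>x. f (tot n m x)) = b v (j - 1) * (b (\<not> v) j * fn (\<lambda>x. f (tot n m x)))"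
    by (simp add: D_def mult.assoc)
  also have "\<dots> = (b v (j - 1) * fn (\<lambda>x. f (tot n m (x(j := if v then x j + 1 else x j - 1))))) * b (\<not> v) j"
    using b_fn[OF j(1), of "\<not> v"] by (cases v) (simp_all add: mult.assoc)
  also have "\<dots> = fn (\<lambda>x. f (tot n m x)) * D v j"
    unfolding b_fn[OF j(2)] upd tot by (simp add: D_def mult.assoc)
  finally show ?thesis by (simp add: comm_def)
qed

lemma D_1_fn:
  "1 \<in> {1..<n+m} \<Longrightarrow> D v 1 * fn \<phi> = fn (\<lambda>x. \<phi> (x(1 := if v then x 1 + 1 else x 1 - 1))) * D v 1"
  using b_fn[of 1 "\<not> v" \<phi>] by (cases v) (simp_all add: D_def b_def[of _ 0] fn_mult_left mult.assoc fn_mult)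

lemma D_sq: assumes "n \<in> {1..<n+m}" shows "D v n * D v n = 0"
proof -
  have "D v n * D v n = b v (n - 1) * (b (\<not> v) n * (b v (n - 1) * b (\<not> v) n))"
    by (simp add: D_def mult.assoc)
  also have "\<dots> = 0"
    using assms n skew_square_zero[OF b_sq[of n "\<not> v"] b_skew[of n "n - 1" "\<not> v" v]] by simp
  finally show ?thesis .
qed

lemma serre_D:
  assumes i: "i \<in> {1..<n+m}" "i + 1 \<in> {1..<n+m}"
  shows "i \<noteq> n \<Longrightarrow> serre (fn (\<lambda>_. qs)) (D v i) (D v (i + 1)) = 0"
    and "i + 1 \<noteq> n \<Longrightarrow> serre (fn (\<lambda>_. qs)) (D v (i + 1)) (D v i) = 0"
proof -
  let ?a = "b v (i - 1)" and ?x = "b (\<not> v) i" and ?y = "b v i" and ?b = "b (\<not> v) (i + 1)"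
  have D: "D v i = ?a * ?x" "D v (i + 1) = ?y * ?b" by (simp_all add: D_def)
  have a: "comm ?a (fn (\<lambda>_. qs))" using i by (intro b_const) auto
  have bose: "comm ?a ?x" "comm ?a ?y" "comm ?b ?x" "comm ?b ?y" "comm ?a ?b"
    "serre (fn (\<lambda>_. qs)) ?x ?y = 0" "serre (fn (\<lambda>_. qs)) ?y ?x = 0" if "i < n"
    using i that b_serre[of i "\<not> v"] b_serre[of i v] by (auto intro!: b_comm)
  show "serre (fn (\<lambda>_. qs)) (D v i) (D v (i + 1)) = 0" if "i \<noteq> n"
  proof (cases "i < n")
    case True
    then show ?thesis unfolding D by (intro serre_shared_left bose a)
  next
    case False
    then show ?thesis
      unfolding D using i that n by (intro serre_zero_left b_sq skew_mult_right b_skew) auto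
  qed
  show "serre (fn (\<lambda>_. qs)) (D v (i + 1)) (D v i) = 0" if "i + 1 \<noteq> n"
  proof (cases "i < n")
    case True
    then show ?thesis unfolding D by (intro serre_shared_right bose a)
  next
    case False
    then show ?thesis
      unfolding D using i by (intro serre_zero_right b_sq skew_mult_right b_skew) auto
  qed
qed

lemma serre4_D:
  assumes n': "n - 1 \<in> {1..<n+m}" "n + 1 \<in> {1..<n+m}"
  shows "serre4 (fn (\<lambda>_. qs)) (D v (n - 1)) (D v n) (D v (n + 1)) = 0"
proof -
  have D: "D v (n - 1) = b v (n - 2) * b (\<not> v) (n - 1)" "D v n = b v (n - 1) * b (\<not> v) n"
    "D v (n + 1) = b v n * b (\<not> v) (n + 1)" by (simp_all add: D_def numeral_2_eq_2)
  have "serre (fn (\<lambda>_. qs)) (b v (n - 1)) (b (\<not> v) (n - 1)) = 0"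
    using n' by (intro b_serre) auto
  then show ?thesis
    unfolding D using n' by (intro serre4_shared b_comm b_sq b_const) auto
qed

text \<open>
  The images of the \<open>e\<^sub>i\<close> and of the \<open>f\<^sub>i\<close> are two instances of one pattern: up to sign they are the
  hopping operators \<^const>\<open>D\<close>, the first of them multiplied by a function of \<open>N\<close>.
\<close>

context
  fixes X :: "nat \<Rightarrow> 'b" and v and f
  assumes X_1: "X 1 = fn (\<lambda>x. f (tot n m x)) * D v 1"
    and X: "i \<in> {2..<n+m} \<Longrightarrow> X i = D v i \<or> X i = - D v i"
begin

lemma X_comm_D: assumes ij: "i \<in> {1..<n+m}" "j \<in> {2..<n+m}" and D: "comm (D v i) (D w j)" shows "comm (X i) (D w j)"
proof (cases "i = 1")
  case True
  show ?thesis
    unfolding True X_1 using D D_tot[OF ij(2), of w f] True by (intro comm_mult_left) (auto intro: comm_sym)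
next
  case False
  then show ?thesis using X[of i] ij D comm_minus by auto
qed

lemma X_comm: assumes ij: "i \<in> {1..<n+m}" "j \<in> {1..<n+m}" "i \<noteq> j + 1" "j \<noteq> i + 1" shows "comm (X i) (X j)"
proof -
  have *: "comm (X i) (X j)" if "i \<in> {1..<n+m}" "j \<in> {1..<n+m}" "i + 1 < j" for i j
    using X_comm_D[of i j v] D_comm[of i j v v] X[of j] that comm_minus[of "X i" "D v j"] by auto
  consider "i = j" | "i + 1 < j" | "j + 1 < i" using ij by linarith
  then show ?thesis using * ij by cases (auto simp: comm_def)
qed

lemma X_sq: assumes "n \<in> {1..<n+m}" shows "X n * X n = 0"
proof (cases "n = 1")
  case True
  let ?f = "fn (\<lambda>x. f (tot n m x))"
  have "D v n = D v 1" using True by (rule arg_cong)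
  then have sq: "D v 1 * D v 1 = 0" using D_sq[OF assms, of v] by simp
  have "1 \<in> {1..<n+m}" using assms by simp
  then have "D v 1 * (?f * D v 1) = 0"
    using D_1_fn[of v "\<lambda>x. f (tot n m x)"] sq by (simp only: mult.assoc[symmetric]) (simp only: mult.assoc sq mult_zero_right)
  then have "X 1 * X 1 = 0" unfolding X_1 by (simp only: mult.assoc mult_zero_right)
  moreover have "X n = X 1" using True by (rule arg_cong)
  ultimately show ?thesis by simp
next
  case False
  then show ?thesis using X[of n] D_sq[OF assms, of v] assms by auto
qed

lemma X_serre:
  assumes i: "i \<in> {1..<n+m}" "i + 1 \<in> {1..<n+m}"
  shows "i \<noteq> n \<Longrightarrow> serre (fn (\<lambda>_. qs)) (X i) (X (i + 1)) = 0"
    and "i + 1 \<noteq> n \<Longrightarrow> serre (fn (\<lambda>_. qs)) (X (i + 1)) (X i) = 0"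
proof -
  let ?k = "fn (\<lambda>_. qs)"
  have *: "(i \<noteq> n \<longrightarrow> serre ?k (X i) (D v (i + 1)) = 0) \<and> (i + 1 \<noteq> n \<longrightarrow> serre ?k (D v (i + 1)) (X i) = 0)"
  proof (cases "i = 1")
    case True
    define f' where "f' y = f (if v then y + 1 else y - 1)" for y
    have sh: "D v 1 * fn (\<lambda>x. f (tot n m x)) = fn (\<lambda>x. f' (tot n m x)) * D v 1"
    proof -
      have 1: "1 \<in> {1..<n+m}" using i by auto
      have "tot n m (x(1 := if v then x 1 + 1 else x 1 - 1)) =
          (if v then tot n m x + 1 else tot n m x - 1)" for x
        unfolding tot_upd[OF 1] by simp
      then show ?thesis using D_1_fn[OF 1, of v "\<lambda>x. f (tot n m x)"] by (simp add: f'_def)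
    qed
    have c: "comm (D v (i + 1)) (fn (\<lambda>x. g (tot n m x)))" for g
      using i by (intro D_tot) auto
    show ?thesis
      using serre_scaled[where k = ?k, OF sh c[unfolded True] c[unfolded True] fn_comm fn_comm] serre_D[OF i, of v]
      unfolding True X_1 by simp
  next
    case False
    then show ?thesis using serre_D[OF i, of v] X[of i] i by (auto simp: serre_minus)
  qed
  show "i \<noteq> n \<Longrightarrow> serre ?k (X i) (X (i + 1)) = 0" "i + 1 \<noteq> n \<Longrightarrow> serre ?k (X (i + 1)) (X i) = 0"
    using * X[of "i + 1"] i by (auto simp: serre_minus)
qed

lemma X_serre4:
  assumes n': "n - 1 \<in> {1..<n+m}" "n + 1 \<in> {1..<n+m}"
  shows "serre4 (fn (\<lambda>_. qs)) (X (n - 1)) (X n) (X (n + 1)) = 0"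
proof -
  let ?k = "fn (\<lambda>_. qs)"
  have "serre4 ?k (X (n - 1)) (D v n) (D v (n + 1)) = 0"
  proof (cases "n - 1 = 1")
    case True
    have "comm (D v n) (fn (\<lambda>x. f (tot n m x)))" "comm (D v (n + 1)) (fn (\<lambda>x. f (tot n m x)))"
      using n' True by (auto intro!: D_tot)
    then have "serre4 ?k (fn (\<lambda>x. f (tot n m x)) * D v 1) (D v n) (D v (n + 1)) = 0"
      using serre4_D[OF n', of v] True by (simp add: serre4_scaled fn_comm)
    then show ?thesis unfolding True X_1 .
  next
    case False
    then have "X (n - 1) = D v (n - 1) \<or> X (n - 1) = - D v (n - 1)" using n' by (intro X) auto
    moreover have "serre4 k (- x) y z = - serre4 k x y z" for k x y z :: 'b by (simp add: serre4_def)
    ultimately show ?thesis using serre4_D[OF n', of v] by auto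
  qed
  moreover have "X n = D v n \<or> X n = - D v n" "X (n + 1) = D v (n + 1) \<or> X (n + 1) = - D v (n + 1)"
    using n' by (auto intro!: X)
  ultimately show ?thesis by (auto simp: serre4_minus)
qed

end

end

context oscillators
begin

text \<open>
  The images of \<open>e\<^sub>i\<close> and \<open>f\<^sub>i\<close>, and the eigenvalue of the image of \<open>h\<^sub>i\<close>, which is the occupation number
  of site \<open>i - 1\<close>.
\<close>

definition E :: "nat \<Rightarrow> 'b" where
  "E i = (if i = 1 then fn (\<lambda>x. s (p - tot n m x)) * b False 1 else b True (i - 1) * b False i)"

definition F :: "nat \<Rightarrow> 'b" where
  "F i = (if i = 1 then fn (\<lambda>x. s (p - tot n m x + 1)) * b True 1 else b True i * b False (i - 1))"

definition Hn :: "nat \<Rightarrow> (nat \<Rightarrow> complex) \<Rightarrow> complex" where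
  "Hn i x = (if i = 1 then p - tot n m x else x (i - 1))"

lemma D_1: "D v 1 = b (\<not> v) 1"
  by (simp add: D_def b_def fn_mult_left)

lemma E_1: "E 1 = fn (\<lambda>x. s (p - tot n m x)) * D True 1"
  and F_1: "F 1 = fn (\<lambda>x. s (p - tot n m x + 1)) * D False 1"
  by (simp_all add: E_def F_def D_1 flip: One_nat_def)

lemma E_D: "i \<in> {2..<n+m} \<Longrightarrow> E i = D True i"
  by (auto simp: E_def D_def)

lemma F_D: "i \<in> {2..<n+m} \<Longrightarrow> F i = D False i \<or> F i = - D False i"
  using b_b[of i "i - 1" True False] by (auto simp: F_def D_def)

lemmas E_X = E_1 disjI1[OF E_D]
lemmas F_X = F_1 F_D

lemma E_F_comm:
  assumes ij: "i \<in> {1..<n+m}" "j \<in> {1..<n+m}" "i \<noteq> j" shows "comm (E i) (F j)"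
proof -
  have D: "comm (D v i) (D (\<not> v) j)" if "i \<in> {1..<n+m}" "j \<in> {1..<n+m}" "i < j" for i j v
    using D_comm[of i j v "\<not> v"] D_comm_adjacent[of i v] that by (cases "j = i + 1") auto
  show ?thesis
  proof (cases "i < j")
    case True
    then have "comm (E i) (D False j)"
      using X_comm_D[OF E_X, of i j False] D[of i j True] ij by auto
    then show ?thesis using F_D[of j] True ij comm_minus[of "E i" "D False j"] by auto
  next
    case False
    then have "comm (F j) (D True i)"
      using X_comm_D[OF F_X, of j i True] D[of j i False] ij by auto
    then show ?thesis using E_D[of i] False ij by (auto intro: comm_sym)
  qed
qed

lemma E_F: "i \<in> {1..<n+m} \<Longrightarrow> E i * F i =
    fn (\<lambda>x. (if i = 1 then br (p - tot n m x) else lo (i - 1) (x (i - 1))) * hi i (x i))"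
  and F_E: "i \<in> {1..<n+m} \<Longrightarrow> F i * E i =
    fn (\<lambda>x. (if i = 1 then br (p - tot n m x + 1) else hi (i - 1) (x (i - 1))) * lo i (x i))"
proof -
  assume i: "i \<in> {1..<n+m}"
  show "E i * F i =
    fn (\<lambda>x. (if i = 1 then br (p - tot n m x) else lo (i - 1) (x (i - 1))) * hi i (x i))"
  proof (cases "i = 1")
    case True
    have "E i * F i = fn (\<lambda>x. s (p - tot n m x)) *
        ((b False 1 * fn (\<lambda>x. s (p - tot n m x + 1))) * b True 1)"
      using True by (simp add: E_def F_def mult.assoc)
    also have "\<dots> = fn (\<lambda>x. s (p - tot n m x) * s (p - tot n m x)) * (b False 1 * b True 1)"
      using i True by (subst b_fn) (auto simp: fn_mult_left mult.assoc tot_upd)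
    finally show ?thesis using i True by (simp add: s b_hi fn_mult)
  next
    case False
    then have ne: "i \<noteq> i - Suc 0" and lt: "i - 1 < n + m" and i1: "i - 1 \<in> {1..<n+m}"
      using i by auto
    have "E i * F i = (b True (i - 1) * (b False i * b True i)) * b False (i - 1)"
      using False by (simp add: E_def F_def mult.assoc)
    also have "b True (i - 1) * (b False i * b True i) = fn (\<lambda>x. hi i (x i)) * b True (i - 1)"
      unfolding b_hi[OF i] using b_fn_indep[OF lt, of "\<lambda>x. hi i (x i)" True] ne
      by (simp add: comm_def)
    finally show ?thesis using b_lo[OF i1] False by (simp add: mult.assoc fn_mult mult.commute)
  qed
  show "F i * E i =
    fn (\<lambda>x. (if i = 1 then br (p - tot n m x + 1) else hi (i - 1) (x (i - 1))) * lo i (x i))"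
  proof (cases "i = 1")
    case True
    have "F i * E i = fn (\<lambda>x. s (p - tot n m x + 1)) *
        ((b True 1 * fn (\<lambda>x. s (p - tot n m x))) * b False 1)"
      using True by (simp add: E_def F_def mult.assoc)
    also have "\<dots> = fn (\<lambda>x. s (p - tot n m x + 1) * s (p - tot n m x + 1)) * (b True 1 * b False 1)"
      using i True by (subst b_fn) (auto simp: fn_mult_left mult.assoc tot_upd algebra_simps)
    finally show ?thesis using i True by (simp add: s b_lo fn_mult)
  next
    case False
    then have i1: "i - 1 \<in> {1..<n+m}" and lt: "i < n + m" and ne: "i - Suc 0 \<noteq> i" using i by auto
    have "F i * E i = (b True i * (b False (i - 1) * b True (i - 1))) * b False i"
      using False by (simp add: E_def F_def mult.assoc)
    also have "b True i * (b False (i - 1) * b True (i - 1)) = fn (\<lambda>x. hi (i - 1) (x (i - 1))) * b True i"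
      unfolding b_hi[OF i1] using b_fn_indep[OF lt, of "\<lambda>x. hi (i - 1) (x (i - 1))" True] ne
      by (simp add: comm_def)
    finally show ?thesis using b_lo[of i] i False by (simp add: mult.assoc fn_mult mult.commute)
  qed
qed

text \<open>
  For two Bose sites this is \<open>br_exchange\<close>. For two Fermi sites it suffices to compare the two sides for
  occupation numbers \<open>0\<close> and \<open>1\<close>.
\<close>

lemma E_F_even:
  assumes i: "i \<in> {1..<n+m}" "i \<noteq> n"
  shows "E i * F i - F i * E i = fn (\<lambda>x. br (Hn i x - Hn (i + 1) x))"
proof (cases "i < n")
  case True
  then have "\<not> n \<le> i" "\<not> n \<le> i - 1" by auto
  then show ?thesis
    using i br_exchange
    by (cases "i = 1") (simp_all add: E_F F_E lo_def hi_def Hn_def flip: fn_diff)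
next
  case False
  define \<phi> where "\<phi> = (\<lambda>x. \<iota> (x (i - 1)) * (1 - \<iota> (x i)) - (1 - \<iota> (x (i - 1))) * \<iota> (x i))"
  define \<psi> where "\<psi> = (\<lambda>x :: nat \<Rightarrow> complex. br (x (i - 1) - x i))"
  \<comment> \<open>\<open>\<chi>\<close> agrees with \<open>\<phi>\<close> if \<open>x\<^sub>i\<close> is \<open>0\<close> or \<open>1\<close>, and with \<open>\<psi>\<close> if \<open>x\<^sub>i\<^sub>-\<^sub>1\<close> is \<open>0\<close> or \<open>1\<close>\<close>
  define \<chi> where "\<chi> = (\<lambda>x. if x i = 0 \<or> x i = 1 then \<phi> x else \<psi> x)"
  have "fn \<phi> = fn \<chi>" using i False by (intro fn_fermi_cong[of i]) (auto simp: \<chi>_def)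
  also have "fn \<chi> = fn \<psi>"
    using i False n by (intro fn_fermi_cong[of "i - 1"])
      (auto simp: \<chi>_def \<phi>_def \<psi>_def br_simps ring_map_simps[OF \<iota>])
  finally have "fn \<phi> = fn \<psi>" .
  moreover have "n \<le> i - Suc 0" "i \<noteq> Suc 0" using False i n by auto
  ultimately show ?thesis
    using i False n by (simp add: E_F F_E lo_def hi_def Hn_def \<phi>_def \<psi>_def flip: fn_diff)
qed

text \<open>
  If \<open>a\<close> is the occupation number of the Bose site \<open>n - 1\<close> and \<open>b\<close> that of the Fermi site \<open>n\<close>, the left
  side is \<open>[a] (1 - b) + [a + 1] b\<close>, which is \<open>[a + b]\<close> for \<open>b = 0\<close> and for \<open>b = 1\<close>.
\<close>

lemma E_F_odd:
  assumes n': "n \<in> {1..<n+m}"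
  shows "E n * F n + F n * E n = fn (\<lambda>x. br (Hn n x + Hn (n + 1) x))"
proof -
  let ?l = "\<lambda>x. if n = 1 then br (p - tot n m x) else lo (n - 1) (x (n - 1))"
  let ?h = "\<lambda>x. if n = 1 then br (p - tot n m x + 1) else hi (n - 1) (x (n - 1))"
  have l: "?l = (\<lambda>x. br (Hn n x))" and h: "?h = (\<lambda>x. br (Hn n x + 1))"
    using n by (auto simp: Hn_def lo_def hi_def fun_eq_iff)
  have Hn_Suc: "Hn (Suc n) x = x n" for x using n by (simp add: Hn_def)
  have "E n * F n + F n * E n = fn (\<lambda>x. ?l x * hi n (x n) + ?h x * lo n (x n))"
    unfolding E_F[OF n'] F_E[OF n'] fn_add ..
  also have "\<dots> = fn (\<lambda>x. br (Hn n x) * hi n (x n) + br (Hn n x + 1) * lo n (x n))"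
    using fun_cong[OF l] fun_cong[OF h] by simp
  also have "\<dots> = fn (\<lambda>x. br (Hn n x + Hn (n + 1) x))"
    using n' by (intro fn_fermi_cong[of n]) (use n in \<open>auto simp: Hn_Suc lo_def hi_def ring_map_simps[OF \<iota>]\<close>)
  finally show ?thesis .
qed

text \<open>The effect on the occupation numbers of passing a function to the left of \<open>E j\<close>.\<close>

definition up :: "nat \<Rightarrow> (nat \<Rightarrow> complex) \<Rightarrow> nat \<Rightarrow> complex" where
  "up j x = (if j = 1 then x(1 := x 1 + 1) else x(j - 1 := x (j - 1) - 1, j := x j + 1))"

definition down :: "nat \<Rightarrow> (nat \<Rightarrow> complex) \<Rightarrow> nat \<Rightarrow> complex" where
  "down j x = (if j = 1 then x(1 := x 1 - 1) else x(j := x j - 1, j - 1 := x (j - 1) + 1))"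

lemma E_fn: assumes j: "j \<in> {1..<n+m}" shows "E j * fn \<phi> = fn (\<lambda>x. \<phi> (up j x)) * E j"
proof (cases "j = 1")
  case True
  then show ?thesis using b_fn[of 1 False \<phi>] j by (simp add: E_def up_def fn_mult_left mult.assoc mult.commute)
next
  case False
  have "E j * fn \<phi> = b True (j - 1) * (b False j * fn \<phi>)" using False by (simp add: E_def mult.assoc)
  also have "\<dots> = (b True (j - 1) * fn (\<lambda>x. \<phi> (x(j := x j + 1)))) * b False j"
    using b_fn[OF j, of False] by (simp add: mult.assoc)
  also have "\<dots> = fn (\<lambda>x. \<phi> (up j x)) * (b True (j - 1) * b False j)"
  proof -
    have j1: "j - 1 \<in> {1..<n+m}" and ne: "j \<noteq> j - Suc 0" using j False by auto
    show ?thesis unfolding b_fn[OF j1] using False by (simp add: ne up_def mult.assoc)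
  qed
  finally show ?thesis using False by (simp add: E_def)
qed

lemma F_fn: assumes j: "j \<in> {1..<n+m}" shows "F j * fn \<phi> = fn (\<lambda>x. \<phi> (down j x)) * F j"
proof (cases "j = 1")
  case True
  then show ?thesis using b_fn[of 1 True \<phi>] j by (simp add: F_def down_def fn_mult_left mult.assoc mult.commute)
next
  case False
  have "F j * fn \<phi> = b True j * (b False (j - 1) * fn \<phi>)" using False by (simp add: F_def mult.assoc)
  also have "\<dots> = (b True j * fn (\<lambda>x. \<phi> (x(j - 1 := x (j - 1) + 1)))) * b False (j - 1)"
  proof -
    have "j - 1 \<in> {1..<n+m}" using j False by auto
    from b_fn[OF this] show ?thesis by (simp add: mult.assoc)
  qed
  also have "\<dots> = fn (\<lambda>x. \<phi> (down j x)) * (b True j * b False (j - 1))"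
  proof -
    have ne: "j - Suc 0 \<noteq> j" using j False by auto
    show ?thesis unfolding b_fn[OF j] using False by (simp add: ne down_def mult.assoc)
  qed
  finally show ?thesis using False by (simp add: F_def)
qed

lemma Hn_up:
  assumes "i \<in> {1..n+m}" "j \<in> {1..<n+m}"
  shows "Hn i (up j x) = Hn i x - (of_bool (i = j) - of_bool (i = j + 1))"
    "Hn i (down j x) = Hn i x + (of_bool (i = j) - of_bool (i = j + 1))"
proof -
  have "j \<noteq> 1 \<Longrightarrow> j - 1 \<in> {1..<n+m} \<and> j \<noteq> j - 1" using assms by auto
  moreover have "j - 1 = i - 1 \<longleftrightarrow> i = j" "i - 1 = j \<longleftrightarrow> i = j + 1" using assms by auto
  ultimately show "Hn i (up j x) = Hn i x - (of_bool (i = j) - of_bool (i = j + 1))"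
    "Hn i (down j x) = Hn i x + (of_bool (i = j) - of_bool (i = j + 1))"
    using assms by (auto simp: Hn_def up_def down_def tot_upd)
qed

lemma one_E: "fn (\<lambda>_. 1) * E j = E j" and one_F: "fn (\<lambda>_. 1) * F j = F j"
  by (auto simp: E_def F_def fn_mult_left) (simp_all add: one_b flip: mult.assoc)

lemma fn_minus_one: "fn (\<lambda>_. 1) * z = z \<Longrightarrow> fn (\<lambda>_. -1) * z = - z"
  using fn_diff[of "\<lambda>_. 0" "\<lambda>_. 1"] by (simp add: fn_zero)

lemma H_E:
  assumes ij: "i \<in> {1..n+m}" "j \<in> {1..<n+m}"
  shows "fn (\<lambda>x. \<iota> (Hn i x)) * E j - E j * fn (\<lambda>x. \<iota> (Hn i x)) =
      (if i = j then E j else if i = j + 1 then - E j else 0)"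
    "fn (\<lambda>x. \<iota> (Hn i x)) * F j - F j * fn (\<lambda>x. \<iota> (Hn i x)) =
      (if i = j then - F j else if i = j + 1 then F j else 0)"
proof -
  note \<iota> = ring_map_simps[OF \<iota>]
  have "fn (\<lambda>x. \<iota> (Hn i x)) * E j - E j * fn (\<lambda>x. \<iota> (Hn i x)) =
      fn (\<lambda>_. \<iota> (of_bool (i = j) - of_bool (i = j + 1))) * E j"
    unfolding E_fn[OF ij(2)] left_diff_distrib[symmetric] fn_diff[symmetric] Hn_up[OF ij] by (simp add: \<iota>)
  then show "fn (\<lambda>x. \<iota> (Hn i x)) * E j - E j * fn (\<lambda>x. \<iota> (Hn i x)) =
      (if i = j then E j else if i = j + 1 then - E j else 0)"
    by (auto simp: \<iota> one_E fn_minus_one fn_zero)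
  have "fn (\<lambda>x. \<iota> (Hn i x)) * F j - F j * fn (\<lambda>x. \<iota> (Hn i x)) =
      fn (\<lambda>_. - \<iota> (of_bool (i = j) - of_bool (i = j + 1))) * F j"
    unfolding F_fn[OF ij(2)] left_diff_distrib[symmetric] fn_diff[symmetric] Hn_up[OF ij] by (simp add: \<iota>)
  then show "fn (\<lambda>x. \<iota> (Hn i x)) * F j - F j * fn (\<lambda>x. \<iota> (Hn i x)) =
      (if i = j then - F j else if i = j + 1 then F j else 0)"
    by (auto simp: \<iota> one_F fn_minus_one fn_zero)
qed

text \<open>
  The map \<open>\<Phi>\<close> is a substitution followed by the inclusion of a quotient algebra into the product of
  quotients, so it does not preserve the unit.
\<close>

lemma gl_rels_vanish:
  fixes \<Phi> :: "'a::ring_1 \<Rightarrow> 'b"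
  assumes add: "\<And>x y. \<Phi> (x + y) = \<Phi> x + \<Phi> y" and mult: "\<And>x y. \<Phi> (x * y) = \<Phi> x * \<Phi> y"
    and h: "\<And>i. \<Phi> (h i) = (if i \<in> {1..n+m} then fn (\<lambda>x. \<iota> (Hn i x)) else 0)"
    and e: "\<And>i. \<Phi> (e i) = (if i \<in> {1..<n+m} then E i else 0)"
    and f: "\<And>i. \<Phi> (f i) = (if i \<in> {1..<n+m} then F i else 0)"
    and k: "\<Phi> k = fn (\<lambda>_. qs)"
    and c: "\<And>i. i \<in> {1..<n+m} \<Longrightarrow>
      \<Phi> (c i) = fn (\<lambda>x. br (if i \<noteq> n then Hn i x - Hn (i + 1) x else Hn i x + Hn (i + 1) x))"
    and r: "r \<in> gl_rels n m k c h e f"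
  shows "\<Phi> r = 0"
proof -
  have zero: "\<Phi> 0 = 0" using add[of 0 0] by simp
  have minus: "\<Phi> (- x) = - \<Phi> x" for x using add[of x "- x"] by (simp add: zero eq_neg_iff_add_eq_0 add.commute)
  have diff: "\<Phi> (x - y) = \<Phi> x - \<Phi> y" for x y using add[of x "- y"] by (simp add: minus)
  have serre: "\<Phi> r = 0"
    if r: "r \<in> serre_rels n m k z" and z: "\<And>i. i \<in> {1..<n+m} \<Longrightarrow> \<Phi> (z i) = Z i"
      and Z: "Z 1 = fn (\<lambda>x. g (tot n m x)) * D v 1" "\<And>i. i \<in> {2..<n+m} \<Longrightarrow> Z i = D v i \<or> Z i = - D v i"
    for z Z g v
    using r unfolding serre_rels_def
  proof (elim UnE)
    assume "r \<in> {z i * z j - z j * z i |i j. i \<in> {1..<n + m} \<and> j \<in> {1..<n + m} \<and> i \<noteq> j + 1 \<and> j \<noteq> i + 1}"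
    then show ?thesis using X_comm[OF Z] by (auto simp: diff mult z comm_def)
  next
    assume "r \<in> {z n ^ 2 |_::unit. n \<in> {1..<n+m}}"
    then show ?thesis using X_sq[OF Z] by (auto simp: power2_eq_square mult z)
  next
    assume "r \<in> {z i ^ 2 * z (i+1) - k * (z i * z (i+1) * z i) + z (i+1) * z i ^ 2 | i.
        i \<in> {1..<n+m} \<and> i + 1 \<in> {1..<n+m} \<and> i \<noteq> n}"
    then obtain i where i: "i \<in> {1..<n+m}" "i + 1 \<in> {1..<n+m}" "i \<noteq> n"
      and r: "r = z i ^ 2 * z (i+1) - k * (z i * z (i+1) * z i) + z (i+1) * z i ^ 2" by blast
    show ?thesis
      using X_serre(1)[OF Z i] z[OF i(1)] z[OF i(2)] unfolding r power2_eq_square add diff mult k serre_def by simp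
  next
    assume "r \<in> {z (i+1) ^ 2 * z i - k * (z (i+1) * z i * z (i+1)) + z i * z (i+1) ^ 2 | i.
        i \<in> {1..<n+m} \<and> i + 1 \<in> {1..<n+m} \<and> i + 1 \<noteq> n}"
    then obtain i where i: "i \<in> {1..<n+m}" "i + 1 \<in> {1..<n+m}" "i + 1 \<noteq> n"
      and r: "r = z (i+1) ^ 2 * z i - k * (z (i+1) * z i * z (i+1)) + z i * z (i+1) ^ 2" by blast
    show ?thesis
      using X_serre(2)[OF Z i] z[OF i(1)] z[OF i(2)] unfolding r power2_eq_square add diff mult k serre_def by simp
  next
    assume "r \<in> {z n * z (n-1) * z n * z (n+1) + z (n-1) * z n * z (n+1) * z n
        + z n * z (n+1) * z n * z (n-1) + z (n+1) * z n * z (n-1) * z n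
        - k * (z n * z (n-1) * z (n+1) * z n) | _::unit. n - 1 \<in> {1..<n+m} \<and> n + 1 \<in> {1..<n+m}}"
    then have i: "n - 1 \<in> {1..<n+m}" "n + 1 \<in> {1..<n+m}" "n \<in> {1..<n+m}"
      and r: "r = z n * z (n-1) * z n * z (n+1) + z (n-1) * z n * z (n+1) * z n
        + z n * z (n+1) * z n * z (n-1) + z (n+1) * z n * z (n-1) * z n
        - k * (z n * z (n-1) * z (n+1) * z n)" by auto
    show ?thesis
      using X_serre4[OF Z i(1,2)] z[OF i(1)] z[OF i(2)] z[OF i(3)]
      unfolding r add diff mult k serre4_def by simp
  qed
  show ?thesis
    using r unfolding gl_rels_def
  proof (elim UnE)
    assume "r \<in> serre_rels n m k e"
    then show ?thesis by (rule serre[OF _ _ E_X]) (use e in auto)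
  next
    assume "r \<in> serre_rels n m k f"
    then show ?thesis by (rule serre[OF _ _ F_X]) (use f in auto)
  next
    assume "r \<in> {h i * h j - h j * h i | i j. i \<in> {1..n+m} \<and> j \<in> {1..n+m}}"
    then show ?thesis using fn_comm by (auto simp: diff mult h comm_def)
  next
    assume "r \<in> {h i * e j - e j * h i - (of_bool (i = j) - of_bool (i = j + 1)) * e j | i j.
        i \<in> {1..n+m} \<and> j \<in> {1..<n+m}}"
    then obtain i j where ij: "i \<in> {1..n+m}" "j \<in> {1..<n+m}"
      and r: "r = h i * e j - e j * h i - (of_bool (i = j) - of_bool (i = j + 1)) * e j" by blast
    have "\<Phi> r = (if i = j then E j else if i = j + 1 then - E j else 0) -
        \<Phi> ((of_bool (i = j) - of_bool (i = j + 1)) * e j)"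
      using ij unfolding r diff mult[of "h i"] mult[of "e j"] h e by (simp add: H_E(1)[OF ij])
    then show ?thesis using ij by (auto simp: minus e zero)
  next
    assume "r \<in> {h i * f j - f j * h i - (- of_bool (i = j) + of_bool (i = j + 1)) * f j | i j.
        i \<in> {1..n+m} \<and> j \<in> {1..<n+m}}"
    then obtain i j where ij: "i \<in> {1..n+m}" "j \<in> {1..<n+m}"
      and r: "r = h i * f j - f j * h i - (- of_bool (i = j) + of_bool (i = j + 1)) * f j" by blast
    have "\<Phi> r = (if i = j then - F j else if i = j + 1 then F j else 0) -
        \<Phi> ((- of_bool (i = j) + of_bool (i = j + 1)) * f j)"
      using ij unfolding r diff mult[of "h i"] mult[of "f j"] h f by (simp add: H_E(2)[OF ij])
    then show ?thesis using ij by (auto simp: minus f zero)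
  next
    assume "r \<in> {e i * f j - f j * e i | i j. i \<in> {1..<n+m} \<and> j \<in> {1..<n+m} \<and> i \<noteq> j}"
    then show ?thesis using E_F_comm by (auto simp: diff mult e f comm_def)
  next
    assume "r \<in> {e i * f i - f i * e i - c i | i. i \<in> {1..<n+m} \<and> i \<noteq> n}"
    then show ?thesis using E_F_even by (auto simp: diff mult e f c)
  next
    assume "r \<in> {e i * f i + f i * e i - c i | i. i \<in> {1..<n+m} \<and> i = n}"
    then show ?thesis using E_F_odd by (auto simp: diff add mult e f c)
  qed (auto simp: h e f)
qed

text \<open>
  In the definition of \<open>\<pi>\<close> all functions of the number operators stand on the left. A function of \<open>N\<^sub>i\<close>
  commutes with the operators at the other sites.
\<close>

lemma E_expand: "i \<in> {2..<n+m} \<Longrightarrow> E i =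
    fn (\<lambda>x. ang n t (i-1) (x (i-1))) * fn (\<lambda>x. ang n t i (x i + 1)) * op True (i-1) * op False i"
proof -
  assume i: "i \<in> {2..<n+m}"
  have ne: "i \<noteq> i - Suc 0" and i1: "i - 1 \<in> {1..<n+m}" using i by auto
  have "E i = fn (\<lambda>x. ang n t (i - 1) (x (i - 1))) *
      (op True (i - 1) * fn (\<lambda>x. ang n t i (x i + 1))) * op False i"
    using i by (simp add: E_def b_def g_def mult.assoc)
  also have "op True (i - 1) * fn (\<lambda>x. ang n t i (x i + 1)) =
      fn (\<lambda>x. ang n t i (x i + 1)) * op True (i - 1)"
    unfolding op_fn[OF i1] by (simp add: ne)
  finally show "E i = fn (\<lambda>x. ang n t (i-1) (x (i-1))) * fn (\<lambda>x. ang n t i (x i + 1)) * op True (i-1) * op False i"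
    by (simp add: mult.assoc)
qed

lemma F_expand: "i \<in> {2..<n+m} \<Longrightarrow> F i =
    fn (\<lambda>x. ang n t (i-1) (x (i-1) + 1)) * fn (\<lambda>x. ang n t i (x i)) * op True i * op False (i-1)"
proof -
  assume i: "i \<in> {2..<n+m}"
  have ne: "i - Suc 0 \<noteq> i" using i by auto
  have "F i = fn (\<lambda>x. ang n t i (x i)) *
      (op True i * fn (\<lambda>x. ang n t (i - 1) (x (i - 1) + 1))) * op False (i - 1)"
    using i by (simp add: F_def b_def g_def mult.assoc)
  also have "op True i * fn (\<lambda>x. ang n t (i - 1) (x (i - 1) + 1)) =
      fn (\<lambda>x. ang n t (i - 1) (x (i - 1) + 1)) * op True i"
    using op_fn[of i True] i by (simp add: ne)
  finally show "F i = fn (\<lambda>x. ang n t (i-1) (x (i-1) + 1)) * fn (\<lambda>x. ang n t i (x i)) * op True i * op False (i-1)"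
    by (simp add: mult.assoc fn_mult_left mult.commute)
qed

lemma E_F_1_expand:
  "E 1 = fn (\<lambda>x. s (p - tot n m x)) * fn (\<lambda>x. ang n t 1 (x 1 + 1)) * op False 1"
  "F 1 = fn (\<lambda>x. s (p - tot n m x + 1)) * fn (\<lambda>x. ang n t 1 (x 1)) * op True 1"
  by (simp_all add: E_def F_def b_def g_def mult.assoc)

end

section \<open>Relations of the oscillator algebra\<close>

text \<open>
  The functions of the number operators and the creation and annihilation operators as elements of the
  oscillator algebra.
\<close>

definition wfn :: "nat \<Rightarrow> nat \<Rightarrow> ((nat \<Rightarrow> complex) \<Rightarrow> complex) \<Rightarrow> wgen free_alg quots" where
  "wfn n m \<phi> = emb (W_ideal_c n m) (fgen (Fn \<phi>))"

definition wop :: "nat \<Rightarrow> nat \<Rightarrow> bool \<Rightarrow> nat \<Rightarrow> wgen free_alg quots" where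
  "wop n m u i = emb (W_ideal_c n m) (fgen (if u then Cr i else An i))"

lemma two_sided_W_c: "two_sided (W_ideal_c n m)"
  unfolding W_ideal_c_def by (rule two_sided_genideal)

lemma two_sided_W_h: "two_sided (W_ideal_h n m)"
  unfolding W_ideal_h_def by (rule two_sided_top_ideal)

lemma mem_W_ideal_h: "x \<in> W_ideal_h n m \<longleftrightarrow> (\<forall>k. x $ k \<in> W_ideal_c n m)"
  by (simp add: W_ideal_h_def W_ideal_c_def top_ideal_const)

lemma emb_W_h_eq_iff:
  "emb (W_ideal_h n m) x = emb (W_ideal_h n m) y \<longleftrightarrow>
    (\<forall>k. emb (W_ideal_c n m) (x $ k) = emb (W_ideal_c n m) (y $ k))"
  by (simp add: emb_eq_iff two_sided_W_c two_sided_W_h mem_W_ideal_h)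

lemma emb_W_rel: "x \<in> W_rels n m \<Longrightarrow> emb (W_ideal_c n m) x = 0"
  using subsetD[OF genideal_incl, of x "W_rels n m"]
  by (simp add: emb_eq_0_iff two_sided_W_c) (simp add: W_ideal_c_def)

lemma emb_W_rel_diff: "x - y \<in> W_rels n m \<Longrightarrow> emb (W_ideal_c n m) x = emb (W_ideal_c n m) y"
  using emb_W_rel[of "x - y" n m] by (simp add: emb_diff)

lemma wfn_add: "wfn n m (\<lambda>x. \<phi> x + \<psi> x) = wfn n m \<phi> + wfn n m \<psi>"
  unfolding wfn_def emb_add[symmetric] by (rule emb_W_rel_diff) (unfold W_rels_def, blast)

lemma wfn_mult: "wfn n m \<phi> * wfn n m \<psi> = wfn n m (\<lambda>x. \<phi> x * \<psi> x)"
  unfolding wfn_def emb_mult[symmetric] by (rule emb_W_rel_diff[symmetric]) (unfold W_rels_def, blast)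

lemma wfn_const: "wfn n m (\<lambda>_. c) = emb (W_ideal_c n m) (fconst c)"
  unfolding wfn_def by (rule emb_W_rel_diff) (unfold W_rels_def, blast)

lemma wfn_one: "wfn n m (\<lambda>_. 1) = emb (W_ideal_c n m) 1"
  using wfn_const[of n m 1] by (simp add: fconst_simps)

lemma wfn_zero: "wfn n m (\<lambda>_. 0) = 0"
  using wfn_const[of n m 0] by (simp add: fconst_simps emb_zero)

lemma wfn_diff: "wfn n m (\<lambda>x. \<phi> x - \<psi> x) = wfn n m \<phi> - wfn n m \<psi>"
  using wfn_add[of n m "\<lambda>x. \<phi> x - \<psi> x" \<psi>] by (simp add: algebra_simps)

lemma wfn_sum: "wfn n m (\<lambda>x. \<Sum>i\<in>A. \<phi> i x) = (\<Sum>i\<in>A. wfn n m (\<phi> i))"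
  by (induction A rule: infinite_finite_induct) (simp_all add: wfn_zero wfn_add)

lemma wop_num:
  assumes i: "i \<in> {1..<n+m}" shows "wop n m True i * wop n m False i = wfn n m (\<lambda>x. x i)"
proof -
  have "fgen (Fn (\<lambda>x. x i)) - fgen (Cr i) * fgen (An i) \<in> W_rels n m"
    using i unfolding W_rels_def by blast
  from emb_W_rel_diff[OF this] show ?thesis by (simp add: wfn_def wop_def emb_mult)
qed

lemma emb_supercomm:
  "emb J (supercomm n x y) = emb J (fgen x) * emb J (fgen y) -
    (if wdeg n x \<and> wdeg n y then - (emb J (fgen y) * emb J (fgen x)) else emb J (fgen y) * emb J (fgen x))"
  by (cases "wdeg n x"; cases "wdeg n y")
    (simp_all add: supercomm_def emb_diff emb_mult emb_add)

lemma wop_num':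
  assumes i: "i \<in> {1..<n+m}"
  shows "wop n m False i * wop n m True i = wfn n m (\<lambda>x. if n \<le> i then 1 - x i else x i + 1)"
proof -
  have "supercomm n (An i) (Cr i) - of_bool (i = i) \<in> W_rels n m"
    using i unfolding W_rels_def by blast
  from emb_W_rel_diff[OF this]
  have "wop n m False i * wop n m True i -
      (if n \<le> i then - (wop n m True i * wop n m False i) else wop n m True i * wop n m False i) = wfn n m (\<lambda>_. 1)"
    by (cases "n \<le> i") (simp_all add: emb_supercomm wop_def wfn_one theta_def)
  then show ?thesis
    by (cases "n \<le> i") (simp_all add: wop_num[OF i] wfn_add wfn_diff algebra_simps)
qed

lemma wop_fn:
  assumes i: "i \<in> {1..<n+m}"
  shows "wop n m u i * wfn n m \<phi> = wfn n m (\<lambda>x. \<phi> (x(i := if u then x i - 1 else x i + 1))) * wop n m u i"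
proof (cases u)
  case True
  let ?\<psi> = "\<lambda>x. \<phi> (x(i := x i - 1))"
  have "fgen (Fn ?\<psi>) * fgen (Cr i) - fgen (Cr i) * fgen (Fn (\<lambda>x. ?\<psi> (x(i := x i + 1)))) \<in> W_rels n m"
    using i unfolding W_rels_def by blast
  from emb_W_rel_diff[OF this] show ?thesis using True by (simp add: wfn_def wop_def emb_mult)
next
  case False
  let ?\<psi> = "\<lambda>x. \<phi> (x(i := x i + 1))"
  have "fgen (Fn ?\<psi>) * fgen (An i) - fgen (An i) * fgen (Fn (\<lambda>x. ?\<psi> (x(i := x i - 1)))) \<in> W_rels n m"
    using i unfolding W_rels_def by blast
  from emb_W_rel_diff[OF this] show ?thesis using False by (simp add: wfn_def wop_def emb_mult)
qed

lemma wop_one: "wfn n m (\<lambda>_. 1) * wop n m u i = wop n m u i"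
  by (simp add: wfn_one wop_def flip: emb_mult)

lemma wop_wop:
  assumes ij: "i \<in> {1..<n+m}" "j \<in> {1..<n+m}"
  shows "i \<noteq> j \<or> u = v \<Longrightarrow> wop n m u i * wop n m v j =
      (if n \<le> i \<and> n \<le> j then - (wop n m v j * wop n m u i) else wop n m v j * wop n m u i)"
proof -
  have AC: "wop n m False i * wop n m True j =
      (if n \<le> i \<and> n \<le> j then - (wop n m True j * wop n m False i) else wop n m True j * wop n m False i)"
    if ij: "i \<in> {1..<n+m}" "j \<in> {1..<n+m}" "i \<noteq> j" for i j
  proof -
    have "supercomm n (An i) (Cr j) - of_bool (i = j) \<in> W_rels n m"
      using ij unfolding W_rels_def by blast
    from emb_W_rel[OF this] ij show ?thesis
      by (auto simp: emb_supercomm wop_def theta_def)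
  qed
  have "supercomm n (Cr i) (Cr j) \<in> W_rels n m" "supercomm n (An i) (An j) \<in> W_rels n m"
    using ij unfolding W_rels_def by blast+
  from this[THEN emb_W_rel] have same: "wop n m u i * wop n m u j =
      (if n \<le> i \<and> n \<le> j then - (wop n m u j * wop n m u i) else wop n m u j * wop n m u i)"
    by (cases u; auto simp: emb_supercomm wop_def theta_def)
  assume "i \<noteq> j \<or> u = v"
  then show ?thesis
    using same AC[of i j] AC[of j i] ij by (cases u; cases v) auto
qed

text \<open>The supercommutator of a Fermi operator with itself is twice its square.\<close>

lemma wop_sq:
  assumes i: "i \<in> {1..<n+m}" "n \<le> i" shows "wop n m u i * wop n m u i = 0"
proof -
  let ?a = "fgen (if u then Cr i else An i) * fgen (if u then Cr i else An i)"
  have 2: "emb (W_ideal_c n m) (?a + ?a) = 0"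
    using wop_wop[of i n m i u u] i
    by (cases u) (simp_all add: wop_def emb_mult emb_add eq_neg_iff_add_eq_0)
  have "?a = fconst (1/2 + 1/2) * ?a" by (simp add: fconst_simps)
  also have "\<dots> = fconst (1/2) * (?a + ?a)" by (simp only: fconst_simps) (simp add: algebra_simps)
  finally have "emb (W_ideal_c n m) ?a = emb (W_ideal_c n m) (fconst (1/2)) * emb (W_ideal_c n m) (?a + ?a)"
    by (metis emb_mult)
  then show ?thesis using 2 by (simp add: wop_def emb_mult)
qed

definition wfn_h :: "nat \<Rightarrow> nat \<Rightarrow> ((nat \<Rightarrow> complex) \<Rightarrow> complex fps) \<Rightarrow> wgen free_alg fps quots" where
  "wfn_h n m \<phi> = emb (W_ideal_h n m) (fn_h \<phi>)"

definition wop_h :: "nat \<Rightarrow> nat \<Rightarrow> bool \<Rightarrow> nat \<Rightarrow> wgen free_alg fps quots" where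
  "wop_h n m u i = emb (W_ideal_h n m) (fgen_h (if u then Cr i else An i))"

lemma fgen_h_mult_nth: "(fgen_h a * x) $ k = fgen a * x $ k" "(x * fgen_h a) $ k = x $ k * fgen a"
  by (simp_all add: fgen_h_def)

lemma fn_h_nth: "fn_h \<phi> $ k = fgen (Fn (\<lambda>x. \<phi> x $ k))"
  by (simp add: fn_h_def)

lemma emb_fgen: "emb (W_ideal_c n m) (fgen (Fn \<phi>)) = wfn n m \<phi>"
  "emb (W_ideal_c n m) (fgen (if u then Cr i else An i)) = wop n m u i"
  by (simp_all add: wfn_def wop_def)

lemma wfn_h_const: "wfn_h n m (\<lambda>_. c) = emb (W_ideal_h n m) (fconst_h c)"
  by (simp add: wfn_h_def emb_W_h_eq_iff fn_h_nth emb_fgen wfn_const fconst_h_def)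

text \<open>
  The values of \<open>\<pi>\<close> on all symbols; those with an index out of range represent zero.
\<close>

definition gen_c :: "nat \<Rightarrow> nat \<Rightarrow> complex \<Rightarrow> (complex \<Rightarrow> complex) \<Rightarrow> (complex \<Rightarrow> complex) \<Rightarrow>
    complex \<Rightarrow> cgen \<Rightarrow> wgen free_alg" where
  "gen_c n m h s t p g =
     (let cr = (\<lambda>i. fgen (Cr i)); an = (\<lambda>i. fgen (An i)); fn = (\<lambda>\<phi>. fgen (Fn \<phi>));
          num = (\<lambda>i x. if i = 1 then p - tot n m x else x (i-1)) in
      case g of
        CH i \<Rightarrow> if i \<in> {1..n+m} then pi_h n m cr an (fconst p) i else 0
      | CE i \<Rightarrow> if i \<in> {1..<n+m} then pi_e n m s t p fn cr an i else 0
      | CF i \<Rightarrow> if i \<in> {1..<n+m} then pi_f n m s t p fn cr an i else 0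
      | CQ i \<Rightarrow> if i \<in> {1..n+m} then fn (\<lambda>x. exp (h * num i x / 2)) else 0
      | CQi i \<Rightarrow> if i \<in> {1..n+m} then fn (\<lambda>x. exp (- (h * num i x / 2))) else 0)"

definition gen_h :: "nat \<Rightarrow> nat \<Rightarrow> (complex \<Rightarrow> complex fps) \<Rightarrow> (complex \<Rightarrow> complex fps) \<Rightarrow>
    complex \<Rightarrow> ugen \<Rightarrow> wgen free_alg fps" where
  "gen_h n m s t p g =
     (let cr = (\<lambda>i. fgen_h (Cr i)); an = (\<lambda>i. fgen_h (An i)) in
      case g of
        GH i \<Rightarrow> if i \<in> {1..n+m} then pi_h n m cr an (fconst_h (fps_const p)) i else 0
      | GE i \<Rightarrow> if i \<in> {1..<n+m} then pi_e n m s t p fn_h cr an i else 0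
      | GF i \<Rightarrow> if i \<in> {1..<n+m} then pi_f n m s t p fn_h cr an i else 0)"

lemma q_numbers_c:
  assumes q: "\<forall>k\<ge>1. exp (h / 2) ^ k \<noteq> 1" and st: "is_roots_c h s t"
  shows "q_numbers (\<lambda>x. x) (\<lambda>x. exp (h * x / 2)) (qnum_c h) (exp (h/2) + exp (-h/2)) s t"
proof
  have ne: "exp (h / 2) \<noteq> exp (- h / 2)"
  proof
    assume "exp (h / 2) = exp (- h / 2)"
    then have "exp (h / 2) ^ 2 = exp (h / 2) * exp (- h / 2)" by (simp add: power2_eq_square)
    also have "\<dots> = 1" by (simp flip: exp_add)
    finally have "exp (h / 2) ^ 2 = 1" .
    then show False using q by simp
  qed
  show "exp (h * 1 / 2) \<noteq> exp (h * (-1) / 2)" using ne by simp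
  show "qnum_c h x * (exp (h * 1 / 2) - exp (h * -1 / 2)) = exp (h * x / 2) - exp (h * - x / 2)" for x
    using ne by (simp add: qnum_c_def)
  show "exp (h * (x + y) / 2) = exp (h * x / 2) * exp (h * y / 2)" for x y
    by (simp add: exp_add[symmetric] field_simps)
  show "s x * s x = qnum_c h x" for x using st by (simp add: is_roots_c_def power2_eq_square)
  show "t x * t x * x = qnum_c h x" if "x \<noteq> 0" for x
    using st that by (simp add: is_roots_c_def power2_eq_square)
qed (simp_all add: ring_map_def)

text \<open>
  The denominator \<open>q - q\<^sup>-\<^sup>1\<close> is \<open>h\<close> times a unit. The shifts cancel this factor \<open>h\<close>.
\<close>

lemma qnum_h_eq:
  "qnum_h x = inverse (fps_shift 1 (fps_exp (1/2) - fps_exp (-1/2))) * fps_shift 1 (fps_exp (x/2) - fps_exp (- x/2))"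
proof -
  define d :: "complex \<Rightarrow> complex fps"
    where "d x = fps_shift 1 (fps_exp (x/2) - fps_exp (- x/2))" for x
  have eq: "fps_exp (x/2) - fps_exp (- x/2) = d x * fps_X" for x :: complex
    by (rule fps_ext) (simp add: d_def)
  have d1: "d 1 $ 0 \<noteq> 0" by (simp add: d_def)
  have "qnum_h x = (d x * fps_X) / (d 1 * fps_X)"
    unfolding qnum_h_def eq[of x] using eq[of 1] by simp
  also have "\<dots> = d x / d 1" by simp
  also have "\<dots> = inverse (d 1) * d x" using d1 by (simp add: fps_divide_unit)
  finally show ?thesis by (simp add: d_def)
qed

lemma qnum_h_mult: "qnum_h x * (fps_exp (1/2) - fps_exp (-1/2)) = fps_exp (x/2) - fps_exp (- x/2)"
proof -
  let ?d = "\<lambda>x :: complex. fps_shift 1 (fps_exp (x/2) - fps_exp (- x/2))"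
  have eq: "fps_exp (x/2) - fps_exp (- x/2) = ?d x * fps_X" for x :: complex
    by (rule fps_ext) simp
  have "inverse (?d 1) * ?d 1 = 1" by (rule inverse_mult_eq_1) simp
  have "qnum_h x * (fps_exp (1/2) - fps_exp (-1/2)) = qnum_h x * (?d 1 * fps_X)"
    by (rule arg_cong[OF eq[of 1]])
  also have "\<dots> = (inverse (?d 1) * ?d 1) * (?d x * fps_X)"
    unfolding qnum_h_eq by (simp only: mult_ac)
  also have "\<dots> = ?d x * fps_X" by (subst \<open>inverse (?d 1) * ?d 1 = 1\<close>) (rule mult_1_left)
  also have "\<dots> = fps_exp (x/2) - fps_exp (- x/2)" by (rule eq[symmetric])
  finally show ?thesis .
qed

lemma q_numbers_h:
  assumes st: "is_roots_h s t"
  shows "q_numbers fps_const (\<lambda>x. fps_exp (x/2)) qnum_h (fps_exp (1/2) + fps_exp (-1/2)) s t"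
proof
  show "fps_exp (1 / 2) \<noteq> (fps_exp (-1 / 2) :: complex fps)"
  proof
    assume "fps_exp (1 / 2) = (fps_exp (-1 / 2) :: complex fps)"
    from arg_cong[OF this, of "\<lambda>f. f $ 1"] show False by simp
  qed
  show "t x * t x * fps_const x = qnum_h x" if "x \<noteq> 0" for x
  proof -
    have sq: "t x * t x = fps_const (inverse x) * qnum_h x"
      using st that by (simp add: is_roots_h_def power2_eq_square fps_divide_unit fps_const_inverse)
    have "t x * t x * fps_const x = (fps_const (inverse x) * fps_const x) * qnum_h x"
      unfolding sq by (simp only: mult_ac)
    also have "fps_const (inverse x) * fps_const x = 1" using that by simp
    finally show ?thesis by simp
  qed
  show "qnum_h x * (fps_exp (1 / 2) - fps_exp (-1 / 2)) = fps_exp (x / 2) - fps_exp (- x / 2)" for x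
    by (rule qnum_h_mult)
qed (use st in \<open>simp_all add: ring_map_fps_const fps_exp_add_mult add_divide_distrib
      is_roots_h_def power2_eq_square\<close>)

section \<open>The homomorphism for numerical q\<close>

lemma emb_gen: "emb (W_ideal_c n m) (fgen (Cr i)) = wop n m True i"
  "emb (W_ideal_c n m) (fgen (An i)) = wop n m False i"
  "emb (W_ideal_c n m) (fgen (Fn \<phi>)) = wfn n m \<phi>"
  "emb (W_ideal_c n m) (fconst c) = wfn n m (\<lambda>_. c)"
  by (simp_all add: wop_def wfn_def[symmetric] wfn_const)

lemma oscillators_c:
  assumes n: "n \<ge> 1" and q: "\<forall>k\<ge>1. exp (h / 2) ^ k \<noteq> 1" and st: "is_roots_c h s t"
  shows "oscillators (\<lambda>x. x) (\<lambda>x. exp (h * x / 2)) (qnum_c h) (exp (h/2) + exp (-h/2)) s t n m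
    (wfn n m) (wop n m)"
proof (intro oscillators.intro q_numbers_c[OF q st] oscillators_axioms.intro n)
  fix i j u v assume "i \<in> {1..<n+m}" "j \<in> {1..<n+m}" "i \<noteq> j"
  then show "wop n m u i * wop n m v j =
      (if n \<le> i \<and> n \<le> j then - (wop n m v j * wop n m u i) else wop n m v j * wop n m u i)"
    by (intro wop_wop disjI1)
qed (simp_all only: wfn_add wfn_mult wop_num wop_num' wop_fn wop_one wop_sq)

lemma homog_mult': "x \<in> homog deg d \<Longrightarrow> y \<in> homog deg e \<Longrightarrow> d' = (d \<noteq> e) \<Longrightarrow> x * y \<in> homog deg d'"
  by (simp only: homog_mult)

lemma homog_fgen': "deg g = d \<Longrightarrow> fgen g \<in> homog deg d"
  using homog_fgen[of g deg] by simp

lemma gen_c_graded: assumes n: "n \<ge> 1" shows "gen_c n m h s t p g \<in> homog (wdeg n) (cdeg n g)"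
proof -
  have Fn: "fgen (Fn \<phi>) \<in> homog (wdeg n) False" for \<phi> by (rule homog_fgen') simp
  have N: "fgen (Cr i) * fgen (An i) \<in> homog (wdeg n) False" for i
    by (rule homog_mult'[OF homog_fgen homog_fgen]) simp
  have H: "pi_h n m (\<lambda>i. fgen (Cr i)) (\<lambda>i. fgen (An i)) (fconst p) i \<in> homog (wdeg n) False" for i
  proof -
    have "fconst p + - (\<Sum>j\<in>{1..<n+m}. fgen (Cr j) * fgen (An j)) \<in> homog (wdeg n) False"
      by (intro homog_add homog_fconst homog_minus homog_sum N)
    then show ?thesis by (simp add: pi_h_def N)
  qed
  have E: "pi_e n m s t p (\<lambda>\<phi>. fgen (Fn \<phi>)) (\<lambda>i. fgen (Cr i)) (\<lambda>i. fgen (An i)) i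
      \<in> homog (wdeg n) (theta n (i - 1) \<noteq> theta n i)"
    "pi_f n m s t p (\<lambda>\<phi>. fgen (Fn \<phi>)) (\<lambda>i. fgen (Cr i)) (\<lambda>i. fgen (An i)) i
      \<in> homog (wdeg n) (theta n (i - 1) \<noteq> theta n i)" for i
  proof -
    have 0: "\<not> theta n 0" using n by (simp add: theta_def)
    note 1 = homog_mult'[OF homog_mult'[OF Fn Fn refl] homog_fgen]
      and 2 = homog_mult'[OF homog_mult'[OF homog_mult'[OF Fn Fn refl] homog_fgen refl] homog_fgen]
    show "pi_e n m s t p (\<lambda>\<phi>. fgen (Fn \<phi>)) (\<lambda>i. fgen (Cr i)) (\<lambda>i. fgen (An i)) i
      \<in> homog (wdeg n) (theta n (i - 1) \<noteq> theta n i)"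
    proof (cases "i = 1")
      case True
      show ?thesis unfolding pi_e_def if_P[OF True] using True 0 by (intro 1) simp
    next
      case False
      show ?thesis unfolding pi_e_def if_not_P[OF False] by (intro 2) simp
    qed
    show "pi_f n m s t p (\<lambda>\<phi>. fgen (Fn \<phi>)) (\<lambda>i. fgen (Cr i)) (\<lambda>i. fgen (An i)) i
      \<in> homog (wdeg n) (theta n (i - 1) \<noteq> theta n i)"
    proof (cases "i = 1")
      case True
      show ?thesis unfolding pi_f_def if_P[OF True] using True 0 by (intro 1) simp
    next
      case False
      show ?thesis unfolding pi_f_def if_not_P[OF False] by (intro 2) auto
    qed
  qed
  show ?thesis
    using H E by (cases g) (auto simp: gen_c_def Let_def homog_zero Fn)
qed

lemma gl_rels_out:
  "i \<notin> {1..n+m} \<Longrightarrow> h i \<in> gl_rels n m k c h e f"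
  "i \<notin> {1..<n+m} \<Longrightarrow> e i \<in> gl_rels n m k c h e f"
  "i \<notin> {1..<n+m} \<Longrightarrow> f i \<in> gl_rels n m k c h e f"
  unfolding gl_rels_def by blast+

lemma q_rels_out:
  "i \<notin> {1..n+m} \<Longrightarrow> fgen (CQ i) \<in> q_rels n m q"
  "i \<notin> {1..n+m} \<Longrightarrow> fgen (CQi i) \<in> q_rels n m q"
  unfolding q_rels_def by blast+

lemma two_sided_U_c: "two_sided (U_ideal_c n m h)"
  unfolding U_ideal_c_def by (rule two_sided_genideal)

context
  fixes n m :: nat and h p :: complex and s t :: "complex \<Rightarrow> complex"
  assumes n: "n \<ge> 1" and q: "\<forall>k\<ge>1. exp (h / 2) ^ k \<noteq> 1" and st: "is_roots_c h s t"
begin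

interpretation oscillators "\<lambda>x. x" "\<lambda>x. exp (h * x / 2)" "qnum_c h" "exp (h/2) + exp (-h/2)" s t n m p
    "wfn n m" "wop n m"
  by (rule oscillators_c[OF n q st])

abbreviation (input) "S_c \<equiv> subst fconst (gen_c n m h s t p)"
abbreviation (input) "\<Phi>_c x \<equiv> emb (W_ideal_c n m) (S_c x)"

lemmas S_c_ring_map = ring_map_subst[OF ring_map_fconst fconst_central, of "gen_c n m h s t p"]
lemmas S_c_simps = ring_map_simps[OF S_c_ring_map] subst_fconst[OF ring_map_fconst fconst_central]
  subst_fgen[OF ring_map_fconst fconst_central]

lemma Phi_c_gen:
  "\<Phi>_c (fgen (CH i)) = (if i \<in> {1..n+m} then wfn n m (Hn i) else 0)"
  "\<Phi>_c (fgen (CE i)) = (if i \<in> {1..<n+m} then E i else 0)"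
  "\<Phi>_c (fgen (CF i)) = (if i \<in> {1..<n+m} then F i else 0)"
  "\<Phi>_c (fgen (CQ i)) = (if i \<in> {1..n+m} then wfn n m (\<lambda>x. exp (h * Hn i x / 2)) else 0)"
  "\<Phi>_c (fgen (CQi i)) = (if i \<in> {1..n+m} then wfn n m (\<lambda>x. exp (- (h * Hn i x / 2))) else 0)"
proof -
  have "wfn n m (\<lambda>x. p - tot n m x) = wfn n m (\<lambda>_. p) - (\<Sum>j\<in>{1..<n+m}. wop n m True j * wop n m False j)"
    unfolding tot_def by (simp add: wfn_diff wfn_sum wop_num)
  moreover have "i \<in> {1..n+m} \<Longrightarrow> i \<noteq> 1 \<Longrightarrow> wop n m True (i - 1) * wop n m False (i - 1) = wfn n m (\<lambda>x. x (i - 1))"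
    by (rule wop_num) auto
  ultimately show "\<Phi>_c (fgen (CH i)) = (if i \<in> {1..n+m} then wfn n m (Hn i) else 0)"
    by (auto simp: S_c_simps gen_c_def emb_zero pi_h_def emb_diff emb_sum emb_mult emb_gen wop_num Hn_def[abs_def])
  show "\<Phi>_c (fgen (CE i)) = (if i \<in> {1..<n+m} then E i else 0)"
    using E_F_1_expand(1) E_expand[of i]
    by (auto simp: S_c_simps gen_c_def emb_zero pi_e_def emb_mult emb_gen)
  show "\<Phi>_c (fgen (CF i)) = (if i \<in> {1..<n+m} then F i else 0)"
    using E_F_1_expand(2) F_expand[of i]
    by (auto simp: S_c_simps gen_c_def emb_zero pi_f_def emb_mult emb_gen)
qed (simp_all add: S_c_simps gen_c_def emb_zero emb_gen Hn_def[abs_def])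

lemma Phi_c_q_rels: assumes r: "r \<in> q_rels n m (exp (h / 2))" shows "\<Phi>_c r = 0"
proof -
  have comm: "wfn n m \<phi> * wfn n m \<psi> - wfn n m \<psi> * wfn n m \<phi> = 0" for \<phi> \<psi>
    using fn_comm[of \<phi> \<psi>] by (simp add: comm_def)
  have sc: "exp (h / 2) powi k * exp (h * (a - of_int k) / 2) = exp (h * a / 2)" for a k
    by (simp add: exp_power_int exp_add[symmetric] field_simps)
  have EF: "\<Phi>_c (fgen (CQ i) * fgen (CE j) - fconst (exp (h / 2) powi (of_bool (i = j) - of_bool (i = j + 1))) * fgen (CE j) * fgen (CQ i)) = 0"
    "\<Phi>_c (fgen (CQ i) * fgen (CF j) - fconst (exp (h / 2) powi (- of_bool (i = j) + of_bool (i = j + 1))) * fgen (CF j) * fgen (CQ i)) = 0"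
    if ij: "i \<in> {1..n+m}" "j \<in> {1..<n+m}" for i j
  proof -
    let ?\<phi> = "\<lambda>x. exp (h * Hn i x / 2)" and ?k = "of_bool (i = j) - of_bool (i = j + 1) :: int"
      and ?l = "- of_bool (i = j) + of_bool (i = j + 1) :: int"
    have "Hn i (up j x) = Hn i x - of_int ?k" "Hn i (down j x) = Hn i x - of_int ?l" for x
      by (simp_all add: Hn_up[OF ij])
    then have "exp (h / 2) powi ?k * ?\<phi> (up j x) = ?\<phi> x" "exp (h / 2) powi ?l * ?\<phi> (down j x) = ?\<phi> x" for x
      by (simp_all only: sc)
    then show "\<Phi>_c (fgen (CQ i) * fgen (CE j) - fconst (exp (h / 2) powi ?k) * fgen (CE j) * fgen (CQ i)) = 0"
      "\<Phi>_c (fgen (CQ i) * fgen (CF j) - fconst (exp (h / 2) powi ?l) * fgen (CF j) * fgen (CQ i)) = 0"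
      using ij by (simp_all only: S_c_simps(3,6) emb_diff emb_mult Phi_c_gen if_True S_c_simps(9) emb_gen
          mult.assoc E_fn F_fn fn_mult_left diff_self)
  qed
  have inv: "wfn n m (\<lambda>x. exp (h * Hn i x / 2)) * wfn n m (\<lambda>x. exp (- (h * Hn i x / 2))) = emb (W_ideal_c n m) 1"
    "wfn n m (\<lambda>x. exp (- (h * Hn i x / 2))) * wfn n m (\<lambda>x. exp (h * Hn i x / 2)) = emb (W_ideal_c n m) 1" for i
    by (simp_all add: wfn_mult wfn_one flip: exp_add)
  show ?thesis
    using r unfolding q_rels_def
  proof (elim UnE)
    assume "r \<in> {fgen (CQ i) * fgen (CE j)
        - fconst (exp (h / 2) powi (of_bool (i = j) - of_bool (i = j + 1))) * fgen (CE j) * fgen (CQ i) | i j.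
        i \<in> {1..n+m} \<and> j \<in> {1..<n+m}}"
    then show ?thesis using EF(1) by blast
  next
    assume "r \<in> {fgen (CQ i) * fgen (CF j)
        - fconst (exp (h / 2) powi (- of_bool (i = j) + of_bool (i = j + 1))) * fgen (CF j) * fgen (CQ i) | i j.
        i \<in> {1..n+m} \<and> j \<in> {1..<n+m}}"
    then show ?thesis using EF(2) by blast
  qed (auto simp: S_c_simps(1,3,6) emb_diff emb_mult Phi_c_gen comm inv)
qed

text \<open>
  Up to its last step this is \<open>gl_rels_vanish\<close>. The right-hand sides of the relations between \<open>e\<^sub>i\<close> and
  \<open>f\<^sub>i\<close> are functions of the number operators because the images of \<open>q\<close> to the powers \<open>\<plusminus>h\<^sub>i\<close> are.
\<close>

lemma U_ideal_c_image: "x \<in> U_ideal_c n m h \<Longrightarrow> S_c x \<in> W_ideal_c n m"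
proof -
  have br: "wfn n m (\<lambda>_. 1 / (exp (h/2) - exp (-h/2))) * (wfn n m (\<lambda>x. exp (h * a x / 2)) * wfn n m (\<lambda>x. exp (- (h * b x / 2)))
      - wfn n m (\<lambda>x. exp (- (h * a x / 2))) * wfn n m (\<lambda>x. exp (h * b x / 2))) = wfn n m (\<lambda>x. qnum_c h (a x - b x))"
    "wfn n m (\<lambda>_. 1 / (exp (h/2) - exp (-h/2))) * (wfn n m (\<lambda>x. exp (h * a x / 2)) * wfn n m (\<lambda>x. exp (h * b x / 2))
      - wfn n m (\<lambda>x. exp (- (h * a x / 2))) * wfn n m (\<lambda>x. exp (- (h * b x / 2)))) = wfn n m (\<lambda>x. qnum_c h (a x + b x))"
    for a b
    unfolding wfn_mult wfn_diff[symmetric]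
    by (simp_all add: qnum_c_def exp_add[symmetric] algebra_simps add_divide_distrib diff_divide_distrib)
  have gl: "\<Phi>_c r = 0" if "r \<in> gl_rels n m (fconst (exp (h/2) + exp (-h/2)))
        (\<lambda>i. fconst (1 / (exp (h/2) - exp (-h/2))) *
             (if i \<noteq> n then fgen (CQ i) * fgen (CQi (i+1)) - fgen (CQi i) * fgen (CQ (i+1))
              else fgen (CQ i) * fgen (CQ (i+1)) - fgen (CQi i) * fgen (CQi (i+1))))
        (\<lambda>i. fgen (CH i)) (\<lambda>i. fgen (CE i)) (\<lambda>i. fgen (CF i))" for r
  proof (rule gl_rels_vanish[OF _ _ _ _ _ _ _ that, of \<Phi>_c])
    fix i assume i: "i \<in> {1..<n+m}"
    then have "i \<in> {1..n+m}" "i + 1 \<in> {1..n+m}" by auto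
    then show "\<Phi>_c (fconst (1 / (exp (h/2) - exp (-h/2))) *
             (if i \<noteq> n then fgen (CQ i) * fgen (CQi (i+1)) - fgen (CQi i) * fgen (CQ (i+1))
              else fgen (CQ i) * fgen (CQ (i+1)) - fgen (CQi i) * fgen (CQi (i+1)))) =
         wfn n m (\<lambda>x. qnum_c h (if i \<noteq> n then Hn i x - Hn (i + 1) x else Hn i x + Hn (i + 1) x))"
      by (cases "i = n"; simp only: simp_thms if_True if_False S_c_simps(3,6,9) emb_diff emb_mult Phi_c_gen emb_gen br)
  qed (simp_all only: Phi_c_gen S_c_simps(2,3,9) emb_add emb_mult emb_gen)
  have "U_ideal_c n m h \<subseteq> S_c -` W_ideal_c n m"
    unfolding U_ideal_c_def
    using gl Phi_c_q_rels
    by (intro genideal_minimal' two_sided_vimage[OF S_c_ring_map two_sided_W_c])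
      (auto simp: emb_eq_0_iff[OF two_sided_W_c])
  then show "x \<in> U_ideal_c n m h \<Longrightarrow> S_c x \<in> W_ideal_c n m" by auto
qed

lemma pi_c_exists: "\<exists>\<pi>. is_pi_c n m h s t p \<pi>"
proof -
  obtain \<pi> where \<pi>: "\<pi> \<in> alg_hom (U_alg_c n m h) (W_alg_c n m)"
    and S: "\<And>x. \<pi> (cls (U_ideal_c n m h) x) = cls (W_ideal_c n m) (S_c x)"
    using quot_alg_hom_exists[OF S_c_ring_map two_sided_U_c[of n m h] two_sided_W_c U_ideal_c_image, where k = fconst and k' = fconst]
    unfolding U_alg_c_def W_alg_c_def by (auto simp: S_c_simps)
  have "\<pi> ` U_part_c n m h d \<subseteq> W_part_c n m d" for d
  proof
    fix y assume "y \<in> \<pi> ` U_part_c n m h d"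
    then obtain x where x: "x \<in> homog (cdeg n) d" and y: "y = cls (W_ideal_c n m) (S_c x)"
      by (auto simp: U_part_c_def S)
    have "S_c x \<in> homog (wdeg n) d"
      by (rule subst_graded[OF ring_map_fconst fconst_central homog_zero homog_add homog_mult homog_fconst
            gen_c_graded[OF n] x])
    then show "y \<in> W_part_c n m d" by (simp add: y W_part_c_def)
  qed
  with \<pi> show ?thesis
    by (intro exI[of _ \<pi>]) (auto simp: is_pi_c_def Let_def S S_c_simps gen_c_def)
qed

text \<open>
  A homomorphism is determined by its values on the symbols with an index in range, as the other symbols
  are relations.
\<close>

lemma pi_c_determined:
  assumes \<pi>: "is_pi_c n m h s t p \<pi>"
  shows "\<pi> (cls (U_ideal_c n m h) x) = cls (W_ideal_c n m) (S_c x)"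
proof -
  let ?I = "U_ideal_c n m h" and ?J = "W_ideal_c n m"
  have hom: "\<pi> \<in> alg_hom (quot_alg (\<lambda>c x. fconst c * x) ?I) (quot_alg (\<lambda>c x. fconst c * x) ?J)"
    using \<pi> by (simp add: is_pi_c_def Let_def U_alg_c_def W_alg_c_def)
  note s = alg_hom_quot_simps[OF hom two_sided_U_c two_sided_W_c]
  have const: "\<pi> (cls ?I (fconst c)) = cls ?J (fconst c)" for c
    using s(5)[OF s(2), of c] by simp
  have out: "\<pi> (cls ?I (fgen g)) = cls ?J 0" if "fgen g \<in> ?I" for g
  proof -
    have "cls ?I (fgen g) = cls ?I (fconst 0)"
      using that by (simp add: cls_eq_iff[OF two_sided_U_c] fconst_simps)
    then show ?thesis using const[of 0] by (simp add: fconst_simps)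
  qed
  have gl: "fgen g \<in> ?I" if "fgen g \<in> gl_rels n m (fconst (exp (h/2) + exp (-h/2)))
        (\<lambda>i. fconst (1 / (exp (h/2) - exp (-h/2))) *
             (if i \<noteq> n then fgen (CQ i) * fgen (CQi (i+1)) - fgen (CQi i) * fgen (CQ (i+1))
              else fgen (CQ i) * fgen (CQ (i+1)) - fgen (CQi i) * fgen (CQi (i+1))))
        (\<lambda>i. fgen (CH i)) (\<lambda>i. fgen (CE i)) (\<lambda>i. fgen (CF i))" for g
    unfolding U_ideal_c_def by (rule subsetD[OF genideal_incl UnI1[OF that]])
  have q: "fgen g \<in> ?I" if "fgen g \<in> q_rels n m (exp (h/2))" for g
    unfolding U_ideal_c_def by (rule subsetD[OF genideal_incl UnI2[OF that]])
  show ?thesis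
  proof (induction x rule: free_alg_induct)
    case (gen g)
    show ?case
    proof (cases g)
      case (CH i)
      then show ?thesis using \<pi> out[OF gl[OF gl_rels_out(1)], of i]
        by (cases "i \<in> {1..n+m}") (auto simp: S_c_simps gen_c_def is_pi_c_def Let_def)
    next
      case (CE i)
      then show ?thesis using \<pi> out[OF gl[OF gl_rels_out(2)], of i]
        by (cases "i \<in> {1..<n+m}") (auto simp: S_c_simps gen_c_def is_pi_c_def Let_def)
    next
      case (CF i)
      then show ?thesis using \<pi> out[OF gl[OF gl_rels_out(3)], of i]
        by (cases "i \<in> {1..<n+m}") (auto simp: S_c_simps gen_c_def is_pi_c_def Let_def)
    next
      case (CQ i)
      then show ?thesis using \<pi> out[OF q[OF q_rels_out(1)], of i]
        by (cases "i \<in> {1..n+m}") (auto simp: S_c_simps gen_c_def is_pi_c_def Let_def)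
    next
      case (CQi i)
      then show ?thesis using \<pi> out[OF q[OF q_rels_out(2)], of i]
        by (cases "i \<in> {1..n+m}") (auto simp: S_c_simps gen_c_def is_pi_c_def Let_def)
    qed
  qed (simp_all add: const S_c_simps s(3,4))
qed

end

section \<open>The homomorphism for formal q\<close>

lemma oscillators_h:
  assumes n: "n \<ge> 1" and st: "is_roots_h s t"
  shows "oscillators fps_const (\<lambda>x. fps_exp (x/2)) qnum_h (fps_exp (1/2) + fps_exp (-1/2)) s t n m
    (wfn_h n m) (wop_h n m)"
proof (intro oscillators.intro q_numbers_h[OF st] oscillators_axioms.intro n)
  show "wfn_h n m (\<lambda>x. \<phi> x + \<psi> x) = wfn_h n m \<phi> + wfn_h n m \<psi>" for \<phi> \<psi>
    unfolding wfn_h_def emb_add[symmetric] emb_W_h_eq_iff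
    by (simp add: fn_h_nth emb_gen emb_add wfn_add)
  show "wfn_h n m \<phi> * wfn_h n m \<psi> = wfn_h n m (\<lambda>x. \<phi> x * \<psi> x)" for \<phi> \<psi>
    unfolding wfn_h_def emb_mult[symmetric] emb_W_h_eq_iff
    by (simp add: fps_mult_nth fn_h_nth emb_sum emb_mult emb_gen wfn_sum wfn_mult)
  show "wop_h n m True i * wop_h n m False i = wfn_h n m (\<lambda>x. fps_const (x i))" if "i \<in> {1..<n+m}" for i
    unfolding wfn_h_def wop_h_def emb_mult[symmetric] emb_W_h_eq_iff
    using that by (simp add: fgen_h_mult_nth fn_h_nth emb_gen emb_mult emb_zero fgen_h_def wop_num wfn_zero)
  show "wop_h n m False i * wop_h n m True i =
      wfn_h n m (\<lambda>x. if n \<le> i then 1 - fps_const (x i) else fps_const (x i + 1))" if "i \<in> {1..<n+m}" for i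
    unfolding wfn_h_def wop_h_def emb_mult[symmetric] emb_W_h_eq_iff
    using that wop_num'[of i n m]
    by (cases "n \<le> i") (simp_all add: fgen_h_mult_nth fn_h_nth emb_gen emb_mult emb_zero fgen_h_def wfn_zero)
  show "wop_h n m u i * wfn_h n m \<phi> = wfn_h n m (\<lambda>x. \<phi> (x(i := if u then x i - 1 else x i + 1))) * wop_h n m u i"
    if "i \<in> {1..<n+m}" for i u \<phi>
    unfolding wfn_h_def wop_h_def emb_mult[symmetric] emb_W_h_eq_iff
    by (simp only: fgen_h_mult_nth fn_h_nth emb_fgen emb_mult wop_fn[OF that]) simp
  show "wfn_h n m (\<lambda>_. 1) * wop_h n m u i = wop_h n m u i" for u i
    by (simp add: wfn_h_const fconst_h_simps wop_h_def flip: emb_mult)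
  show "wop_h n m u i * wop_h n m v j =
      (if n \<le> i \<and> n \<le> j then - (wop_h n m v j * wop_h n m u i) else wop_h n m v j * wop_h n m u i)"
    if "i \<in> {1..<n+m}" "j \<in> {1..<n+m}" "i \<noteq> j" for i j u v
  proof -
    define x y :: "wgen free_alg" where "x = fgen (if u then Cr i else An i)" and "y = fgen (if v then Cr j else An j)"
    have w: "emb (W_ideal_c n m) x * emb (W_ideal_c n m) y = (if n \<le> i \<and> n \<le> j
        then - (emb (W_ideal_c n m) y * emb (W_ideal_c n m) x) else emb (W_ideal_c n m) y * emb (W_ideal_c n m) x)"
      using wop_wop[OF that(1,2) disjI1[OF that(3)], of u v] by (simp only: wop_def x_def y_def)
    have "emb (W_ideal_h n m) (fps_const (x * y)) =
      emb (W_ideal_h n m) (fps_const (if n \<le> i \<and> n \<le> j then - (y * x) else y * x))"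
      unfolding emb_W_h_eq_iff using w by (cases "n \<le> i"; cases "n \<le> j") (simp_all add: emb_mult emb_minus)
    then have e: "emb (W_ideal_h n m) (fps_const x * fps_const y) = emb (W_ideal_h n m)
        (if n \<le> i \<and> n \<le> j then - (fps_const y * fps_const x) else fps_const y * fps_const x)"
      by (cases "n \<le> i"; cases "n \<le> j") simp_all
    have "wop_h n m u i = emb (W_ideal_h n m) (fps_const x)" "wop_h n m v j = emb (W_ideal_h n m) (fps_const y)"
      by (simp_all only: wop_h_def fgen_h_def x_def y_def)
    then show ?thesis
      using e by (simp only: emb_mult emb_minus if_distrib[of "emb _"])
  qed
  show "wop_h n m u i * wop_h n m u i = 0" if "i \<in> {1..<n+m}" "n \<le> i" for i u
  proof -
    have "emb (W_ideal_h n m) (fgen_h (if u then Cr i else An i) * fgen_h (if u then Cr i else An i)) = emb (W_ideal_h n m) 0"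
      unfolding emb_W_h_eq_iff using wop_sq[OF that, of u]
      by (cases u) (simp_all add: fgen_h_def wop_def emb_mult emb_zero)
    then show ?thesis by (simp add: wop_h_def emb_mult emb_zero)
  qed
qed

lemma homog_h_mult': "x \<in> homog_h deg d \<Longrightarrow> y \<in> homog_h deg e \<Longrightarrow> d' = (d \<noteq> e) \<Longrightarrow> x * y \<in> homog_h deg d'"
  by (simp only: homog_h_mult)

lemma homog_h_fgen: "fgen_h g \<in> homog_h deg (deg g)"
  unfolding fgen_h_def by (intro homog_h_const homog_fgen)

lemma gen_h_graded: assumes n: "n \<ge> 1" shows "gen_h n m s t p g \<in> homog_h (wdeg n) (udeg n g)"
proof -
  have Fn: "fn_h \<phi> \<in> homog_h (wdeg n) False" for \<phi>
    using homog_fgen'[of "wdeg n" "Fn _" False] by (simp add: homog_h_def fn_h_nth)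
  have N: "fgen_h (Cr i) * fgen_h (An i) \<in> homog_h (wdeg n) False" for i
    by (rule homog_h_mult'[OF homog_h_fgen homog_h_fgen]) simp
  have H: "pi_h n m (\<lambda>i. fgen_h (Cr i)) (\<lambda>i. fgen_h (An i)) (fconst_h c) i \<in> homog_h (wdeg n) False" for i c
  proof -
    have "fconst_h c - (\<Sum>j\<in>{1..<n+m}. fgen_h (Cr j) * fgen_h (An j)) \<in> homog_h (wdeg n) False"
      by (intro homog_h_diff homog_h_fconst homog_h_sum N)
    then show ?thesis by (simp add: pi_h_def N)
  qed
  have 0: "\<not> theta n 0" using n by (simp add: theta_def)
  note 1 = homog_h_mult'[OF homog_h_mult'[OF Fn Fn refl] homog_h_fgen]
    and 2 = homog_h_mult'[OF homog_h_mult'[OF homog_h_mult'[OF Fn Fn refl] homog_h_fgen refl] homog_h_fgen]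
  have E: "pi_e n m s t p fn_h (\<lambda>i. fgen_h (Cr i)) (\<lambda>i. fgen_h (An i)) i
      \<in> homog_h (wdeg n) (theta n (i - 1) \<noteq> theta n i)" for i
  proof (cases "i = 1")
    case True
    show ?thesis unfolding pi_e_def if_P[OF True] using True 0 by (intro 1) simp
  next
    case False
    show ?thesis unfolding pi_e_def if_not_P[OF False] by (intro 2) simp
  qed
  have F: "pi_f n m s t p fn_h (\<lambda>i. fgen_h (Cr i)) (\<lambda>i. fgen_h (An i)) i
      \<in> homog_h (wdeg n) (theta n (i - 1) \<noteq> theta n i)" for i
  proof (cases "i = 1")
    case True
    show ?thesis unfolding pi_f_def if_P[OF True] using True 0 by (intro 1) simp
  next
    case False
    show ?thesis unfolding pi_f_def if_not_P[OF False] by (intro 2) auto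
  qed
  show ?thesis
    using H E F by (cases g) (auto simp: gen_h_def Let_def homog_h_zero)
qed

text \<open>
  Each coefficient of \<open>[A]\<close> is a polynomial in \<open>A\<close>, and polynomials in a function of the number operators
  are computed pointwise.
\<close>

lemma emb_qbr_free:
  assumes A: "emb (W_ideal_c n m) A = wfn n m \<phi>"
  shows "emb (W_ideal_h n m) (qbr_free A) = wfn_h n m (\<lambda>x. qnum_h (\<phi> x))"
proof -
  let ?d = "inverse (fps_shift 1 (fps_exp (1/2) - fps_exp (-1/2))) :: complex fps"
  have pow: "emb (W_ideal_c n m) (B ^ k) = wfn n m (\<lambda>x. \<psi> x ^ k)"
    if "emb (W_ideal_c n m) B = wfn n m \<psi>" for B \<psi> k
    using that by (induction k) (simp_all add: wfn_one emb_mult wfn_mult)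
  have mA: "emb (W_ideal_c n m) (- A) = wfn n m (\<lambda>x. - \<phi> x)"
    using A wfn_diff[of n m "\<lambda>_. 0" \<phi>] by (simp add: emb_minus wfn_zero)
  have 1: "emb (W_ideal_c n m) (fps_shift 1 (qpow_free A - qpow_free (- A)) $ k) =
      wfn n m (\<lambda>x. fps_shift 1 (fps_exp (\<phi> x/2) - fps_exp (- \<phi> x/2)) $ k)" for k
  proof -
    have "emb (W_ideal_c n m) (fps_shift 1 (qpow_free A - qpow_free (- A)) $ k) =
        wfn n m (\<lambda>x. 1 / (2 ^ (k+1) * fact (k+1)) * \<phi> x ^ (k+1) - 1 / (2 ^ (k+1) * fact (k+1)) * (- \<phi> x) ^ (k+1))"
      unfolding fps_shift_nth fps_sub_nth qpow_free_def fps_nth_Abs_fps emb_diff emb_mult emb_gen pow[OF A] pow[OF mA]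
        wfn_mult wfn_diff ..
    also have "(\<lambda>x. 1 / (2 ^ (k+1) * fact (k+1)) * \<phi> x ^ (k+1) - 1 / (2 ^ (k+1) * fact (k+1)) * (- \<phi> x) ^ (k+1)) =
        (\<lambda>x. fps_shift 1 (fps_exp (\<phi> x/2) - fps_exp (- \<phi> x/2)) $ k)"
      unfolding fps_shift_nth fps_sub_nth fps_exp_nth power_divide by (simp add: algebra_simps)
    finally show ?thesis .
  qed
  show ?thesis
    unfolding wfn_h_def emb_W_h_eq_iff
    by (simp add: qbr_free_def fps_mult_nth emb_sum emb_mult 1[unfolded One_nat_def] fn_h_nth emb_gen qnum_h_eq wfn_sum
        fconst_h_def wfn_mult del: fps_shift_nth)
qed

lemma two_sided_U_h: "two_sided (U_ideal_h n m)"
  unfolding U_ideal_h_def by (rule two_sided_top_ideal)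

context
  fixes n m :: nat and p :: complex and s t :: "complex \<Rightarrow> complex fps"
begin

abbreviation (input) "\<kappa>_h \<equiv> (\<lambda>c. fps_const (fconst c)) :: complex \<Rightarrow> wgen free_alg fps"
abbreviation (input) "S_h \<equiv> subst \<kappa>_h (gen_h n m s t p)"
abbreviation (input) "\<Phi>_h x \<equiv> emb (W_ideal_h n m) (ext S_h x)"

lemma kappa_h: "ring_map \<kappa>_h" "\<kappa>_h c * y = y * \<kappa>_h c"
  using fconst_h_central[of "fps_const c" y]
  by (simp_all add: ring_map_comp[OF ring_map_fps_const ring_map_fconst] fconst_h_const)

lemmas S_h_ring_map = ring_map_subst[OF kappa_h, of "gen_h n m s t p"]
lemmas T_h_ring_map = ring_map_ext[OF S_h_ring_map]
lemmas S_h_simps = ring_map_simps[OF S_h_ring_map] subst_fconst[OF kappa_h] subst_fgen[OF kappa_h]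
lemmas T_h_simps = ring_map_simps[OF T_h_ring_map]

lemma T_h_gen: "ext S_h (fgen_h a) = gen_h n m s t p a"
  by (simp add: fgen_h_def ext_const[OF S_h_ring_map] S_h_simps)

lemma T_h_fconst: "ext S_h (fconst_h c) = fconst_h c"
proof (rule fps_ext)
  fix k
  have "ext S_h (fconst_h c) $ k = (\<Sum>j=0..k. if j = k then fconst (c $ k) else 0)"
    unfolding ext_def fps_nth_Abs_fps by (rule sum.cong) (auto simp: fconst_h_def S_h_simps)
  then show "ext S_h (fconst_h c) $ k = fconst_h c $ k" by (simp add: fconst_h_def)
qed

lemma T_h_qpow:
  assumes A: "S_h x = fps_const A" shows "ext S_h (qpow_free x) = qpow_free A"
proof (rule fps_ext)
  fix k
  have "S_h (fconst c * x ^ j) = fps_const (fconst c * A ^ j)" for c j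
    by (simp only: S_h_simps(3,7,9) A ring_map_simps(7)[OF ring_map_fps_const, symmetric] fps_const_mult)
  then have "ext S_h (qpow_free x) $ k = (\<Sum>j=0..k. if j = k then fconst (1 / (2 ^ k * fact k)) * A ^ k else 0)"
    unfolding ext_def fps_nth_Abs_fps qpow_free_def by (intro sum.cong) auto
  then show "ext S_h (qpow_free x) $ k = qpow_free A $ k" by (simp add: qpow_free_def)
qed

lemma T_h_qbr:
  assumes A: "S_h x = fps_const A" shows "ext S_h (qbr_free x) = qbr_free A"
proof -
  have mA: "S_h (- x) = fps_const (- A)" by (simp add: S_h_simps A)
  let ?y = "qpow_free x - qpow_free (- x)"
  have y: "?y = fps_X * fps_shift 1 ?y"
    by (rule fps_ext) (auto simp: qpow_free_def fps_X_mult_nth)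
  have "fps_shift 1 (ext S_h ?y) = fps_shift 1 (fps_X * ext S_h (fps_shift 1 ?y))"
    by (subst y) (simp only: ext_X[OF S_h_ring_map])
  also have "\<dots> = ext S_h (fps_shift 1 ?y)" by (rule fps_ext) (simp add: fps_X_mult_nth)
  finally have "ext S_h (fps_shift 1 ?y) = fps_shift 1 (qpow_free A - qpow_free (- A))"
    by (simp only: T_h_simps(6) T_h_qpow[OF A] T_h_qpow[OF mA])
  then show ?thesis by (simp only: qbr_free_def T_h_simps(3) T_h_fconst)
qed

definition hA :: "nat \<Rightarrow> wgen free_alg" where
  "hA i = (if i \<in> {1..n+m} then pi_h n m (\<lambda>i. fgen (Cr i)) (\<lambda>i. fgen (An i)) (fconst p) i else 0)"

lemma gen_h_GH: "gen_h n m s t p (GH i) = fps_const (hA i)"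
  by (simp add: gen_h_def hA_def pi_h_def fgen_h_def fconst_h_const ring_map_simps(8)[OF ring_map_fps_const]
      flip: fps_const_mult fps_const_sub)

context
  assumes n: "n \<ge> 1" and st: "is_roots_h s t"
begin

interpretation oscillators fps_const "\<lambda>x. fps_exp (x/2)" qnum_h "fps_exp (1/2) + fps_exp (-1/2)" s t n m p
    "wfn_h n m" "wop_h n m"
  by (rule oscillators_h[OF n st])

lemma emb_hA: "i \<in> {1..n+m} \<Longrightarrow> emb (W_ideal_c n m) (hA i) = wfn n m (Hn i)"
proof -
  assume i: "i \<in> {1..n+m}"
  have "wfn n m (\<lambda>x. p - tot n m x) = wfn n m (\<lambda>_. p) - (\<Sum>j\<in>{1..<n+m}. wop n m True j * wop n m False j)"
    unfolding tot_def by (simp add: wfn_diff wfn_sum wop_num)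
  moreover have "i \<noteq> 1 \<Longrightarrow> wop n m True (i - 1) * wop n m False (i - 1) = wfn n m (\<lambda>x. x (i - 1))"
    using i by (intro wop_num) auto
  ultimately show ?thesis
    using i by (auto simp: hA_def pi_h_def emb_diff emb_sum emb_mult emb_gen wop_num Hn_def[abs_def])
qed

lemma emb_h_gen: "emb (W_ideal_h n m) (fgen_h (Cr i)) = wop_h n m True i"
  "emb (W_ideal_h n m) (fgen_h (An i)) = wop_h n m False i"
  "emb (W_ideal_h n m) (fn_h \<phi>) = wfn_h n m \<phi>"
  "emb (W_ideal_h n m) (fconst_h c) = wfn_h n m (\<lambda>_. c)"
  by (simp_all add: wop_h_def wfn_h_def[symmetric] wfn_h_const)

lemma Phi_h_gen:
  "\<Phi>_h (fgen_h (GH i)) = (if i \<in> {1..n+m} then wfn_h n m (\<lambda>x. fps_const (Hn i x)) else 0)"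
  "\<Phi>_h (fgen_h (GE i)) = (if i \<in> {1..<n+m} then E i else 0)"
  "\<Phi>_h (fgen_h (GF i)) = (if i \<in> {1..<n+m} then F i else 0)"
proof -
  have "emb (W_ideal_h n m) (fps_const (hA i)) = wfn_h n m (\<lambda>x. fps_const (Hn i x))" if "i \<in> {1..n+m}"
    unfolding wfn_h_def emb_W_h_eq_iff using emb_hA[OF that] by (simp add: fn_h_nth emb_gen emb_zero wfn_zero)
  then show "\<Phi>_h (fgen_h (GH i)) = (if i \<in> {1..n+m} then wfn_h n m (\<lambda>x. fps_const (Hn i x)) else 0)"
    by (auto simp: T_h_gen gen_h_GH hA_def emb_zero)
  show "\<Phi>_h (fgen_h (GE i)) = (if i \<in> {1..<n+m} then E i else 0)"
    using E_F_1_expand(1) E_expand[of i]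
    by (auto simp: T_h_gen gen_h_def emb_zero pi_e_def emb_mult emb_h_gen)
  show "\<Phi>_h (fgen_h (GF i)) = (if i \<in> {1..<n+m} then F i else 0)"
    using E_F_1_expand(2) F_expand[of i]
    by (auto simp: T_h_gen gen_h_def emb_zero pi_f_def emb_mult emb_h_gen)
qed

text \<open>
  The ideal of relations of the oscillator algebra is described coefficientwise, hence its preimage is
  closed and contains \<open>x\<close> whenever it contains \<open>h x\<close>.
\<close>

lemma U_ideal_h_image: "x \<in> U_ideal_h n m \<Longrightarrow> ext S_h x \<in> W_ideal_h n m"
proof -
  let ?b = "\<lambda>i. if i \<noteq> n then qbr_free (fgen (GH i) - fgen (GH (i+1)))
             else qbr_free (fgen (GH i) + fgen (GH (i+1)))"
  let ?R = "gl_rels n m (fconst_h (fps_exp (1/2) + fps_exp (-1/2))) ?b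
        (\<lambda>i. fgen_h (GH i)) (\<lambda>i. fgen_h (GE i)) (\<lambda>i. fgen_h (GF i))"
  have gl: "\<Phi>_h r = 0" if "r \<in> ?R" for r
  proof (rule gl_rels_vanish[OF _ _ _ _ _ _ _ that, of \<Phi>_h])
    fix i assume i: "i \<in> {1..<n+m}"
    then have i': "i \<in> {1..n+m}" "i + 1 \<in> {1..n+m}" by auto
    have A: "S_h (fgen (GH i) - fgen (GH (i+1))) = fps_const (hA i - hA (i+1))"
      "S_h (fgen (GH i) + fgen (GH (i+1))) = fps_const (hA i + hA (i+1))"
      by (simp_all add: S_h_simps gen_h_GH)
    have "emb (W_ideal_c n m) (hA i - hA (i+1)) = wfn n m (\<lambda>x. Hn i x - Hn (i+1) x)"
      "emb (W_ideal_c n m) (hA i + hA (i+1)) = wfn n m (\<lambda>x. Hn i x + Hn (i+1) x)"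
      by (simp_all only: emb_diff emb_add emb_hA[OF i'(1)] emb_hA[OF i'(2)] wfn_add wfn_diff)
    from this[THEN emb_qbr_free] T_h_qbr[OF A(1)] T_h_qbr[OF A(2)]
    show "\<Phi>_h (?b i) = wfn_h n m (\<lambda>x. qnum_h (if i \<noteq> n then Hn i x - Hn (i + 1) x else Hn i x + Hn (i + 1) x))"
      by (cases "i = n"; simp only: simp_thms if_True if_False)
  qed (simp_all only: Phi_h_gen T_h_simps(2,3) T_h_fconst emb_add emb_mult emb_h_gen)
  have vim: "ext S_h -` W_ideal_h n m = {x. \<forall>k. ext S_h x $ k \<in> W_ideal_c n m}"
    by (auto simp: mem_W_ideal_h)
  have "U_ideal_h n m \<subseteq> ext S_h -` W_ideal_h n m"
    unfolding U_ideal_h_def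
  proof (rule top_ideal_minimal)
    show "two_sided (ext S_h -` W_ideal_h n m)"
      by (rule two_sided_vimage[OF T_h_ring_map two_sided_W_h])
    show "?R \<subseteq> ext S_h -` W_ideal_h n m"
      using gl by (auto simp: emb_eq_0_iff[OF two_sided_W_h])
    show "closed (ext S_h -` W_ideal_h n m)"
      unfolding vim
    proof (rule closed_coefficientwise)
      fix k and x y :: "ugen free_alg fps" assume "\<And>j. j \<le> k \<Longrightarrow> x $ j = y $ j"
      then have "ext S_h x $ k = ext S_h y $ k" by (rule ext_cong)
      then show "ext S_h x $ k \<in> W_ideal_c n m \<longleftrightarrow> ext S_h y $ k \<in> W_ideal_c n m" by simp
    qed
    fix x assume "fps_X * x \<in> ext S_h -` W_ideal_h n m"
    then have "\<forall>k. (fps_X * ext S_h x) $ k \<in> W_ideal_c n m"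
      by (simp add: mem_W_ideal_h ext_X[OF S_h_ring_map])
    then have "\<forall>k. (fps_X * ext S_h x) $ Suc k \<in> W_ideal_c n m" by blast
    then show "x \<in> ext S_h -` W_ideal_h n m" by (simp add: mem_W_ideal_h fps_X_mult_nth)
  qed
  then show "x \<in> U_ideal_h n m \<Longrightarrow> ext S_h x \<in> W_ideal_h n m" by auto
qed

lemma pi_h_exists: "\<exists>\<pi>. is_pi_h n m s t p \<pi>"
proof -
  obtain \<pi> where \<pi>: "\<pi> \<in> alg_hom (U_alg_h n m) (W_alg_h n m)"
    and S: "\<And>x. \<pi> (cls (U_ideal_h n m) x) = cls (W_ideal_h n m) (ext S_h x)"
    using quot_alg_hom_exists[OF T_h_ring_map two_sided_U_h[of n m] two_sided_W_h U_ideal_h_image, where k = fconst_h and k' = fconst_h]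
    unfolding U_alg_h_def W_alg_h_def by (auto simp: T_h_fconst)
  have "\<pi> ` U_part_h n m d \<subseteq> W_part_h n m d" for d
  proof
    fix y assume "y \<in> \<pi> ` U_part_h n m d"
    then obtain x where x: "x \<in> homog_h (udeg n) d" and y: "y = cls (W_ideal_h n m) (ext S_h x)"
      by (auto simp: U_part_h_def S)
    have "S_h a \<in> homog_h (wdeg n) d" if "a \<in> homog (udeg n) d" for a
      by (rule subst_graded[OF kappa_h homog_h_zero homog_h_add homog_h_mult homog_h_const[OF homog_fconst]
            gen_h_graded[OF n] that])
    then have "ext S_h x \<in> homog_h (wdeg n) d"
      using x by (auto simp: homog_h_def ext_def intro!: homog_sum)
    then show "y \<in> W_part_h n m d" by (simp add: y W_part_h_def)
  qed
  with \<pi> show ?thesis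
    by (intro exI[of _ \<pi>]) (auto simp: is_pi_h_def Let_def S T_h_gen gen_h_def)
qed

text \<open>
  An algebra homomorphism is automatically continuous, since it maps multiples of \<open>h\<^sup>k\<close> to
  multiples of \<open>h\<^sup>k\<close>.
\<close>

lemma pi_h_determined:
  assumes \<pi>: "is_pi_h n m s t p \<pi>"
  shows "\<pi> (cls (U_ideal_h n m) x) = cls (W_ideal_h n m) (ext S_h x)"
proof -
  let ?I = "U_ideal_h n m" and ?J = "W_ideal_h n m"
  have hom: "\<pi> \<in> alg_hom (quot_alg (\<lambda>c x. fconst_h c * x) ?I) (quot_alg (\<lambda>c x. fconst_h c * x) ?J)"
    using \<pi> by (simp add: is_pi_h_def Let_def U_alg_h_def W_alg_h_def)
  note q = alg_hom_quot_simps[OF hom two_sided_U_h two_sided_W_h]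
  have scal: "\<pi> (cls ?I (fconst_h c)) = cls ?J (fconst_h c)" for c
    using q(5)[OF q(2), of c] by simp
  have out: "\<pi> (cls ?I x) = cls ?J 0" if "x \<in> ?I" for x
  proof -
    have "cls ?I x = cls ?I (fconst_h 0)"
      using that by (simp add: cls_eq_iff[OF two_sided_U_h] fconst_h_simps)
    then show ?thesis using scal[of 0] by (simp add: fconst_h_simps)
  qed
  have gl: "x \<in> ?I" if "x \<in> gl_rels n m (fconst_h (fps_exp (1/2) + fps_exp (-1/2)))
        (\<lambda>i. if i \<noteq> n then qbr_free (fgen (GH i) - fgen (GH (i+1)))
             else qbr_free (fgen (GH i) + fgen (GH (i+1))))
        (\<lambda>i. fgen_h (GH i)) (\<lambda>i. fgen_h (GE i)) (\<lambda>i. fgen_h (GF i))" for x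
    unfolding U_ideal_h_def by (rule subsetD[OF top_ideal_incl that])
  have free: "\<pi> (cls ?I (fps_const a)) = cls ?J (S_h a)" for a
  proof (induction a rule: free_alg_induct)
    case (gen g)
    show ?case
    proof (cases g)
      case (GH i)
      then show ?thesis using \<pi> out[OF gl[OF gl_rels_out(1)], of i]
        by (cases "i \<in> {1..n+m}") (auto simp: S_h_simps gen_h_def is_pi_h_def Let_def fgen_h_def)
    next
      case (GE i)
      then show ?thesis using \<pi> out[OF gl[OF gl_rels_out(2)], of i]
        by (cases "i \<in> {1..<n+m}") (auto simp: S_h_simps gen_h_def is_pi_h_def Let_def fgen_h_def)
    next
      case (GF i)
      then show ?thesis using \<pi> out[OF gl[OF gl_rels_out(3)], of i]
        by (cases "i \<in> {1..<n+m}") (auto simp: S_h_simps gen_h_def is_pi_h_def Let_def fgen_h_def)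
    qed
  next
    case (const c)
    then show ?case using scal[of "fps_const c"] by (simp add: fconst_h_const S_h_simps)
  next
    case (add a b)
    then show ?case using q(3)[OF add] by (simp add: S_h_simps)
  next
    case (mult a b)
    then show ?case using q(4)[OF mult] by (simp add: S_h_simps)
  qed
  have X: "fconst_h (fps_X ^ j) = fps_X ^ j" for j
    by (simp add: fconst_h_simps fconst_h_X)
  obtain z where z: "\<pi> (cls ?I x) = cls ?J z" using q(1) by blast
  have "(z - ext S_h x) $ k \<in> W_ideal_c n m" for k
  proof -
    \<comment> \<open>up to a multiple of \<open>h\<^sup>k\<^sup>+\<^sup>1\<close>, \<open>x\<close> is a polynomial in \<open>h\<close> with coefficients in the free algebra\<close>
    obtain y where y: "x = (\<Sum>j<Suc k. fps_X ^ j * fps_const (x $ j)) + fps_X ^ Suc k * y"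
      using fps_split_at by blast
    obtain z' where z': "\<pi> (cls ?I y) = cls ?J z'" using q(1) by blast
    let ?x = "\<Sum>j<Suc k. fps_X ^ j * fps_const (x $ j)" and ?x' = "\<Sum>j<Suc k. fps_X ^ j * S_h (x $ j)"
    have "\<pi> (cls ?I (\<Sum>j<l. fps_X ^ j * fps_const (x $ j))) = cls ?J (\<Sum>j<l. fps_X ^ j * S_h (x $ j))" for l
    proof (induction l)
      case 0
      then show ?case using scal[of 0] by (simp add: fconst_h_simps)
    next
      case (Suc l)
      then show ?case using q(3)[OF Suc q(5)[OF free, of "fps_X ^ l"]] by (simp add: X)
    qed
    from q(3)[OF this q(5)[OF z', of "fps_X ^ Suc k"], of "Suc k"]
    have "\<pi> (cls ?I x) = cls ?J (?x' + fps_X ^ Suc k * z')" unfolding X using y by metis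
    then have "z - (?x' + fps_X ^ Suc k * z') \<in> ?J" using z by (simp only: cls_eq_iff[OF two_sided_W_h])
    moreover have "ext S_h x = ?x' + fps_X ^ Suc k * ext S_h y"
    proof -
      have "ext S_h (fps_X ^ j * u) = fps_X ^ j * ext S_h u" for j u
        by (metis T_h_fconst T_h_simps(3) X)
      then show ?thesis
        by (subst y) (simp only: T_h_simps(2,8) ext_const[OF S_h_ring_map])
    qed
    ultimately have "(z - ext S_h x + fps_X ^ Suc k * (ext S_h y - z')) $ k \<in> W_ideal_c n m"
      by (simp add: mem_W_ideal_h algebra_simps)
    then show ?thesis by (simp add: fps_X_power_mult_nth del: power_Suc)
  qed
  then show ?thesis using z by (simp add: cls_eq_iff[OF two_sided_W_h] mem_W_ideal_h)
qed

end

end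

section \<open>The Fock representation of the oscillator algebra\<close>

lemma fscale_ket: "fscale c (ket l) = Poly_Mapping.single l c"
  by (rule poly_mapping_eqI) (simp add: ket_def lookup_single when_def)

lemma act_gen_add: "act_gen n m g (v + w) = act_gen n m g v + act_gen n m g w"
  unfolding act_gen_def by (rule keys_sum_add) (simp_all add: fock.scale_left_distrib)

lemma act_gen_scale: "act_gen n m g (fscale c v) = fscale c (act_gen n m g v)"
proof (induction v rule: poly_mapping_single_induct)
  case (1 l d)
  then show ?case by (simp add: act_gen_scale_ket flip: fscale_ket)
next
  case (2 v w)
  then show ?case by (simp add: fock.scale_right_distrib act_gen_add)
qed

lemma act_gen_zero: "act_gen n m g 0 = 0"
  using act_gen_scale[of n m g 0 0] by simp

lemma act_gen_ket: "act_gen n m g (ket l) = act_ket n m g l"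
  using act_gen_scale_ket[of n m g 1 l] by simp

lemma foldr_act_add: "foldr (act_gen n m) w (v + v') = foldr (act_gen n m) w v + foldr (act_gen n m) w v'"
  by (induction w) (simp_all add: act_gen_add)

lemma foldr_act_scale: "foldr (act_gen n m) w (fscale c v) = fscale c (foldr (act_gen n m) w v)"
  by (induction w) (simp_all add: act_gen_scale)

lemma act_c_add_left: "act_c n m (a + b) v = act_c n m a v + act_c n m b v"
  unfolding act_c_def by (rule keys_sum_add) (simp_all add: fock.scale_left_distrib)

lemma act_c_single: "act_c n m (Poly_Mapping.single w c) v = fscale c (foldr (act_gen n m) w v)"
  by (simp add: act_c_def)

lemma act_c_add_right: "act_c n m a (v + v') = act_c n m a v + act_c n m a v'"
  by (simp add: act_c_def foldr_act_add fock.scale_right_distrib sum.distrib)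

lemma act_c_scale: "act_c n m a (fscale c v) = fscale c (act_c n m a v)"
  by (simp add: act_c_def foldr_act_scale fock.scale_sum_right mult.commute)

lemma act_c_mult: "act_c n m (a * b) v = act_c n m a (act_c n m b v)"
proof (induction a rule: poly_mapping_single_induct)
  case (1 u c)
  show ?case
  proof (induction b rule: poly_mapping_single_induct)
    case (1 w d)
    then show ?case
      by (simp add: mult_single plus_list_def act_c_single foldr_act_scale)
  qed (simp add: distrib_left act_c_add_left act_c_add_right)
qed (simp add: distrib_right act_c_add_left)

lemma act_c_fconst: "act_c n m (fconst c) v = fscale c v"
  by (simp add: fconst_def act_c_single)

lemma act_c_fgen: "act_c n m (fgen g) v = act_gen n m g v"
  by (simp add: fgen_def act_c_single)

lemma act_c_zero: "act_c n m 0 v = 0" "act_c n m a 0 = 0"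
  using act_c_add_left[of n m 0 0 v] act_c_add_right[of n m a 0 0] by simp_all

lemma act_c_diff: "act_c n m (a - b) v = act_c n m a v - act_c n m b v"
  using act_c_add_left[of n m "a - b" b v] by (simp add: algebra_simps)

lemma act_c_sum_left: "act_c n m (sum a S) v = (\<Sum>i\<in>S. act_c n m (a i) v)"
  by (induction S rule: infinite_finite_induct) (simp_all add: act_c_zero act_c_add_left)

lemma act_c_sum_right: "act_c n m a (sum v S) = (\<Sum>i\<in>S. act_c n m a (v i))"
  by (induction S rule: infinite_finite_induct) (simp_all add: act_c_zero act_c_add_right)

lemma act_h_add_left: "act_h n m (a + b) v = act_h n m a v + act_h n m b v"
  by (simp add: act_h_def fps_eq_iff act_c_add_left sum.distrib)

lemma act_h_add_right: "act_h n m a (v + w) = act_h n m a v + act_h n m a w"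
  by (simp add: act_h_def fps_eq_iff act_c_add_right sum.distrib)

lemma act_h_mult: "act_h n m (a * b) v = act_h n m a (act_h n m b v)"
proof (rule fps_ext)
  fix k
  have "act_h n m (a * b) v $ k =
      (\<Sum>j=0..k. \<Sum>i=0..j. act_c n m (a $ i * b $ (j - i)) (v $ (k - j)))"
    by (simp add: act_h_def fps_mult_nth act_c_sum_left)
  also have "\<dots> = (\<Sum>j=0..k. \<Sum>i=0..k - j. act_c n m (a $ j * b $ i) (v $ (k - j - i)))"
    using fps_mult_assoc_lemma[where f = "\<lambda>i j d. act_c n m (a $ i * b $ j) (v $ d)" and k = k and n = k] by simp
  also have "\<dots> = act_h n m a (act_h n m b v) $ k"
    by (simp add: act_h_def act_c_sum_right act_c_mult)
  finally show "act_h n m (a * b) v $ k = act_h n m a (act_h n m b v) $ k" .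
qed

lemma act_h_fconst: "act_h n m (fconst_h c) v = fscale_h c v"
  by (simp add: act_h_def fscale_h_def fconst_h_def act_c_fconst)

lemma act_h_scale: "act_h n m a (fscale_h c v) = fscale_h c (act_h n m a v)"
  by (metis act_h_fconst act_h_mult fconst_h_central)

lemma act_h_const: "act_h n m a (fps_const v) $ k = act_c n m (a $ k) v"
proof -
  have "act_h n m a (fps_const v) $ k = (\<Sum>i=0..k. if i = k then act_c n m (a $ k) v else 0)"
    unfolding act_h_def fps_nth_Abs_fps by (rule sum.cong) (auto simp: act_c_zero)
  then show ?thesis by simp
qed

text \<open>
  On an admissible basis vector a creation (\<open>u\<close>) or annihilation operator (\<open>\<not> u\<close>) produces the
  multiple \<open>amp\<close> of the basis vector \<open>tgt\<close>.
\<close>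

definition amp :: "nat \<Rightarrow> bool \<Rightarrow> nat \<Rightarrow> (nat \<Rightarrow> nat) \<Rightarrow> complex" where
  "amp n u i l =
     (if i < n then of_real (sqrt (real (if u then l i + 1 else l i)))
      else if l i = (if u then 0 else 1) then fsign n i l else 0)"

definition tgt :: "bool \<Rightarrow> nat \<Rightarrow> (nat \<Rightarrow> nat) \<Rightarrow> nat \<Rightarrow> nat" where
  "tgt u i l = l(i := if u then l i + 1 else l i - 1)"

lemma act_op:
  assumes "l \<in> occ n m" "i \<in> {1..<n+m}"
  shows "act_gen n m (if u then Cr i else An i) (ket l) = fscale (amp n u i l) (ket (tgt u i l))"
proof -
  have "n \<le> i \<Longrightarrow> l i = 0 \<or> l i = 1" using assms by (force simp: occ_def)
  then show ?thesis using assms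
    by (cases u; cases "i < n") (auto simp: act_gen_ket amp_def tgt_def)
qed

lemma tgt_occ: "l \<in> occ n m \<Longrightarrow> i \<in> {1..<n+m} \<Longrightarrow> amp n u i l \<noteq> 0 \<Longrightarrow> tgt u i l \<in> occ n m"
  by (auto simp: occ_def tgt_def amp_def split: if_splits)

lemma fsign_sq: "fsign n i l * fsign n i l = 1"
  by (simp add: fsign_def flip: power_mult_distrib)

lemma amp_tgt:
  assumes "amp n u i l \<noteq> 0"
  shows "tgt (\<not> u) i (tgt u i l) = l" "amp n (\<not> u) i (tgt u i l) = amp n u i l"
proof -
  have fs: "fsign n i (l(i := x)) = fsign n i l" for x by (simp add: fsign_def)
  have "\<not> u \<Longrightarrow> l i \<ge> 1" using assms by (auto simp: amp_def split: if_splits)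
  then show "tgt (\<not> u) i (tgt u i l) = l" by (auto simp: tgt_def fun_eq_iff)
  show "amp n (\<not> u) i (tgt u i l) = amp n u i l"
    using assms \<open>\<not> u \<Longrightarrow> l i \<ge> 1\<close> by (cases u) (auto simp: amp_def tgt_def fs split: if_splits)
qed

text \<open>
  A Fermi operator at site \<open>j\<close> changes the sign with which the operators at later Fermi sites act.
\<close>

lemma amp_other:
  assumes "i \<noteq> j" "amp n v j l \<noteq> 0"
  shows "amp n u i (tgt v j l) = (if n \<le> j \<and> j < i then - amp n u i l else amp n u i l)"
proof (cases "n \<le> j \<and> j < i")
  case True
  then have "l j = (if v then 0 else 1)" using assms by (auto simp: amp_def split: if_splits)
  moreover have "(\<Sum>k\<in>{n..<i}. (tgt v j l) k) = (tgt v j l) j + (\<Sum>k\<in>{n..<i} - {j}. l k)"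
    "(\<Sum>k\<in>{n..<i}. l k) = l j + (\<Sum>k\<in>{n..<i} - {j}. l k)"
    using True by (simp_all add: sum.remove[of _ j] tgt_def)
  ultimately have "fsign n i (tgt v j l) = - fsign n i l"
    by (cases v) (simp_all add: fsign_def tgt_def)
  then show ?thesis using True assms by (simp add: amp_def tgt_def)
next
  case False
  then have "fsign n i (tgt v j l) = fsign n i l"
    unfolding fsign_def tgt_def by (intro arg_cong[where f = "(^) _"] sum.cong) auto
  then show ?thesis unfolding if_not_P[OF False] using assms by (simp add: amp_def tgt_def)
qed

lemma act_op_op:
  assumes "l \<in> occ n m" "i \<in> {1..<n+m}" "j \<in> {1..<n+m}"
  shows "act_gen n m (if u then Cr i else An i) (act_gen n m (if v then Cr j else An j) (ket l)) =
    fscale (amp n v j l * amp n u i (tgt v j l)) (ket (tgt u i (tgt v j l)))"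
  using assms tgt_occ[of l n m j v] act_op[of "tgt v j l" n m i u]
  by (cases "amp n v j l = 0") (simp_all only: act_op act_gen_scale fock.scale_scale fock.scale_zero_left mult_zero_left
      fock.scale_zero_right simp_thms act_gen_zero)

lemma act_supercomm:
  "act_c n m (supercomm n x y) v = act_gen n m x (act_gen n m y v) -
    (if wdeg n x \<and> wdeg n y then - act_gen n m y (act_gen n m x v) else act_gen n m y (act_gen n m x v))"
proof -
  have "act_c n m (- a) v = - act_c n m a v" for a using act_c_diff[of n m 0 a v] by (simp add: act_c_zero)
  then show ?thesis
    by (cases "wdeg n x"; cases "wdeg n y") (simp_all add: supercomm_def act_c_diff act_c_mult act_c_fgen act_c_add_left)
qed

lemma wdeg_op: "wdeg n (if u then Cr i else An i) \<longleftrightarrow> n \<le> i"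
  by (simp add: theta_def)

lemma supercomm_kills:
  assumes l: "l \<in> occ n m" and ij: "i \<in> {1..<n+m}" "j \<in> {1..<n+m}" "i \<noteq> j \<or> u = v"
  shows "act_c n m (supercomm n (if u then Cr i else An i) (if v then Cr j else An j)) (ket l) = 0"
proof -
  have c: "amp n v j l * amp n u i (tgt v j l) =
      (if n \<le> i \<and> n \<le> j then - (amp n u i l * amp n v j (tgt u i l)) else amp n u i l * amp n v j (tgt u i l))"
    if ne: "i \<noteq> j"
    using amp_other[OF ne, of n v l u] amp_other[OF ne[symmetric], of n u l v] ne
    by (cases "amp n v j l = 0"; cases "amp n u i l = 0") auto
  have "tgt u i (tgt v j l) = tgt v j (tgt u i l)" if "i \<noteq> j" using that by (auto simp: tgt_def)
  moreover have "amp n u i l * amp n u i (tgt u i l) = 0" if "n \<le> i" using that by (auto simp: amp_def tgt_def)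
  ultimately show ?thesis
    using ij c unfolding act_supercomm act_op_op[OF l ij(1,2)] act_op_op[OF l ij(2,1)] wdeg_op
    by (cases "i = j") (auto simp: fock.scale_minus_left)
qed

abbreviation FS :: "nat \<Rightarrow> nat \<Rightarrow> fock set" where
  "FS n m \<equiv> fock.span (ket ` occ n m)"

lemma span_act_c:
  assumes "\<And>l. l \<in> A \<Longrightarrow> act_c n m a (ket l) \<in> M" "fock.subspace M" "v \<in> fock.span (ket ` A)"
  shows "act_c n m a v \<in> M"
  using assms(3)
proof (induction rule: fock.span_induct_alt)
  case base
  then show ?case using assms(2) by (simp add: act_c_zero fock.subspace_0)
next
  case (step c x y)
  then show ?case using assms(1,2)
    by (auto simp: act_c_add_right act_c_scale intro!: fock.subspace_add fock.subspace_scale)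
qed

lemma FS_invariant_gen: "v \<in> FS n m \<Longrightarrow> act_gen n m g v \<in> FS n m"
proof -
  assume v: "v \<in> FS n m"
  have op: "act_gen n m (if u then Cr i else An i) (ket l) \<in> FS n m" if l: "l \<in> occ n m" for u i l
  proof (cases "i \<in> {1..<n+m}")
    case True
    then show ?thesis
      unfolding act_op[OF l True] using tgt_occ[OF l True, of u]
      by (cases "amp n u i l = 0") (simp_all add: fock.span_zero fock.span_scale fock.span_base)
  qed (cases u; auto simp: act_gen_ket fock.span_zero)
  have "act_gen n m g (ket l) \<in> FS n m" if l: "l \<in> occ n m" for l
    using op[OF l, of True] op[OF l, of False] l
    by (cases g) (simp_all add: act_gen_ket fock.span_scale fock.span_base)
  then show ?thesis
    using span_act_c[of "occ n m" n m "fgen g" "FS n m" v] v by (simp add: act_c_fgen)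
qed

lemma FS_invariant: "v \<in> FS n m \<Longrightarrow> act_c n m a v \<in> FS n m"
proof (induction a arbitrary: v rule: free_alg_induct)
  case (const c)
  then show ?case by (simp add: act_c_fconst fock.span_scale)
qed (simp_all add: act_c_fgen FS_invariant_gen act_c_add_left fock.span_add act_c_mult)

lemma act_Fn: "act_gen n m (Fn \<phi>) (ket l) = fscale (\<phi> (\<lambda>i. of_nat (l i))) (ket l)"
  by (simp add: act_gen_ket)

lemma W_rels_kill: assumes l: "l \<in> occ n m" and r: "r \<in> W_rels n m" shows "act_c n m r (ket l) = 0"
proof -
  note act = act_c_diff act_c_mult act_c_fgen act_c_add_left act_c_fconst act_Fn act_gen_scale
  have out: "l i = 0" if "i \<notin> {1..<n+m}" for i using that l by (simp add: occ_def)
  have sq: "complex_of_real (sqrt (real k)) * complex_of_real (sqrt (real k)) = of_nat k" for k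
    unfolding of_real_mult[symmetric] by simp
  have le: "n \<le> i \<Longrightarrow> l i = 0 \<or> l i = 1" for i using l by (force simp: occ_def)
  have amp_back: "amp n u i l * amp n (\<not> u) i (tgt u i l) = (if i < n then of_nat (if u then l i + 1 else l i)
      else if l i = (if u then 0 else 1) then 1 else 0)" for u i
  proof -
    have "amp n u i l * amp n (\<not> u) i (tgt u i l) = amp n u i l * amp n u i l"
      using amp_tgt(2)[of n u i l] by (cases "amp n u i l = 0") simp_all
    also have "\<dots> = (if i < n then of_nat (if u then l i + 1 else l i)
      else if l i = (if u then 0 else 1) then 1 else 0)"
    proof (cases "i < n")
      case True
      then show ?thesis using sq[of "if u then l i + 1 else l i"] by (simp only: amp_def if_True)
    next
      case False
      then show ?thesis by (simp add: amp_def fsign_sq)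
    qed
    finally show ?thesis .
  qed
  have amp_tgt_back: "fscale (amp n u i l * amp n (\<not> u) i (tgt u i l)) (ket (tgt (\<not> u) i (tgt u i l))) =
      fscale (amp n u i l * amp n (\<not> u) i (tgt u i l)) (ket l)" for u i
    using amp_tgt(1)[of n u i l] by (cases "amp n u i l = 0") simp_all
  have N: "act_gen n m (Cr i) (act_gen n m (An i) (ket l)) = fscale (of_nat (l i)) (ket l)"
    and N': "act_gen n m (An i) (act_gen n m (Cr i) (ket l)) =
      fscale (if i < n then of_nat (l i) + 1 else 1 - of_nat (l i)) (ket l)" if i: "i \<in> {1..<n+m}" for i
  proof -
    have "act_gen n m (if \<not> u then Cr i else An i) (act_gen n m (if u then Cr i else An i) (ket l)) =
        fscale (if i < n then of_nat (if u then l i + 1 else l i) else if l i = (if u then 0 else 1) then 1 else 0) (ket l)" for u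
      using amp_tgt_back[of u i] unfolding act_op_op[OF l i i] amp_back .
    from this[of False] this[of True]
    show "act_gen n m (Cr i) (act_gen n m (An i) (ket l)) = fscale (of_nat (l i)) (ket l)"
      "act_gen n m (An i) (act_gen n m (Cr i) (ket l)) =
        fscale (if i < n then of_nat (l i) + 1 else 1 - of_nat (l i)) (ket l)"
      using le[of i] by (auto simp: add.commute not_less)
  qed
  have shift: "act_gen n m (Fn \<phi>) (act_gen n m (if u then Cr i else An i) (ket l)) =
      act_gen n m (if u then Cr i else An i) (act_gen n m (Fn (\<lambda>x. \<phi> (x(i := if u then x i + 1 else x i - 1)))) (ket l))"
    if i: "i \<in> {1..<n+m}" for \<phi> u i
  proof -
    have "(\<lambda>j. of_nat (tgt u i l j)) = (\<lambda>j. of_nat (l j) :: complex)(i := if u then of_nat (l i) + 1 else of_nat (l i) - 1)"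
      if "amp n u i l \<noteq> 0"
    proof -
      have "\<not> u \<Longrightarrow> l i \<ge> 1" using that by (auto simp: amp_def split: if_splits)
      then show ?thesis by (auto simp: tgt_def fun_eq_iff of_nat_diff)
    qed
    then show ?thesis
      by (cases "amp n u i l = 0") (simp_all only: act_op[OF l i] act_Fn act_gen_scale fock.scale_zero_left
          fock.scale_zero_right fock.scale_scale mult.commute simp_thms act_gen_zero)
  qed
  show ?thesis
    using r unfolding W_rels_def
  proof (elim UnE)
    assume "r \<in> {supercomm n (An i) (Cr j) - of_bool (i = j) | i j. i \<in> {1..<n+m} \<and> j \<in> {1..<n+m}}"
    then obtain i j where ij: "i \<in> {1..<n+m}" "j \<in> {1..<n+m}" and r: "r = supercomm n (An i) (Cr j) - of_bool (i = j)" by blast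
    show ?thesis
    proof (cases "i = j")
      case True
      have "act_c n m 1 v = v" for v using act_c_fconst[of n m 1 v] by (simp add: fconst_simps)
      then show ?thesis using True N[OF ij(1)] N'[OF ij(1)]
        unfolding r act_c_diff act_supercomm
        by (simp add: theta_def fock.scale_left_distrib fock.scale_left_diff_distrib)
    next
      case False
      then show ?thesis using supercomm_kills[OF l ij, of False True] by (simp add: r)
    qed
  next
    assume "r \<in> {supercomm n (Cr i) (Cr j) | i j. i \<in> {1..<n+m} \<and> j \<in> {1..<n+m}}"
    then show ?thesis using supercomm_kills[OF l, of _ _ True True] by auto
  next
    assume "r \<in> {supercomm n (An i) (An j) | i j. i \<in> {1..<n+m} \<and> j \<in> {1..<n+m}}"
    then show ?thesis using supercomm_kills[OF l, of _ _ False False] by auto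
  next
    assume "r \<in> {fgen (Fn \<phi>) - fgen (Fn \<psi>) | \<phi> \<psi>. \<forall>x. (\<forall>i. i \<notin> {1..<n+m} \<longrightarrow> x i = 0) \<longrightarrow> \<phi> x = \<psi> x}"
    then obtain \<phi> \<psi> where "\<forall>x. (\<forall>i. i \<notin> {1..<n+m} \<longrightarrow> x i = 0) \<longrightarrow> \<phi> x = \<psi> x" and r: "r = fgen (Fn \<phi>) - fgen (Fn \<psi>)" by blast
    then have "\<phi> (\<lambda>i. of_nat (l i)) = \<psi> (\<lambda>i. of_nat (l i))" using out by simp
    then show ?thesis by (simp add: r act)
  next
    assume "r \<in> {fgen (Fn \<phi>) * fgen (Cr i) - fgen (Cr i) * fgen (Fn (\<lambda>x. \<phi> (x(i := x i + 1)))) | \<phi> i. i \<in> {1..<n+m}}"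
    then obtain \<phi> i where i: "i \<in> {1..<n+m}"
      and r: "r = fgen (Fn \<phi>) * fgen (Cr i) - fgen (Cr i) * fgen (Fn (\<lambda>x. \<phi> (x(i := x i + 1))))" by blast
    show ?thesis using shift[OF i, of \<phi> True] unfolding r act_c_diff act_c_mult act_c_fgen by (simp only: if_True diff_self)
  next
    assume "r \<in> {fgen (Fn \<phi>) * fgen (An i) - fgen (An i) * fgen (Fn (\<lambda>x. \<phi> (x(i := x i - 1)))) | \<phi> i. i \<in> {1..<n+m}}"
    then obtain \<phi> i where i: "i \<in> {1..<n+m}"
      and r: "r = fgen (Fn \<phi>) * fgen (An i) - fgen (An i) * fgen (Fn (\<lambda>x. \<phi> (x(i := x i - 1))))" by blast
    show ?thesis using shift[OF i, of \<phi> False] unfolding r act_c_diff act_c_mult act_c_fgen by (simp only: if_False diff_self)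
  next
    assume "r \<in> {fgen (Cr i) | i. i \<notin> {1..<n+m}}"
    then show ?thesis by (auto simp: act_c_fgen act_gen_ket)
  next
    assume "r \<in> {fgen (An i) | i. i \<notin> {1..<n+m}}"
    then show ?thesis by (auto simp: act_c_fgen act_gen_ket)
  qed (auto simp: act N fock.scale_left_distrib mult.commute)
qed

text \<open>
  The annihilator of the admissible part of the Fock space is an ideal, because this part is invariant.
  So the oscillator algebra acts on it.
\<close>

lemma W_ideal_kills: assumes a: "a \<in> W_ideal_c n m" and v: "v \<in> FS n m" shows "act_c n m a v = 0"
proof -
  let ?K = "{a. \<forall>v\<in>FS n m. act_c n m a v = 0}"
  have "two_sided ?K"
    unfolding two_sided_def by (auto simp: act_c_zero act_c_diff act_c_mult FS_invariant)
  moreover have "W_rels n m \<subseteq> ?K"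
    using span_act_c[of "occ n m" n m _ "{0}"] W_rels_kill by auto
  ultimately have "W_ideal_c n m \<subseteq> ?K"
    unfolding W_ideal_c_def by (rule genideal_minimal')
  then show ?thesis using a v by auto
qed

lemma Fock_act_c_cls:
  assumes v: "v \<in> FS n m" shows "Fock_act_c n m (cls (W_ideal_c n m) a) v = act_c n m a v"
proof -
  have *: "act_c n m b v = act_c n m a v" if "b \<in> cls (W_ideal_c n m) a" for b
    using that W_ideal_kills[OF _ v, of "b - a"] by (simp add: mem_cls_iff[OF two_sided_W_c] act_c_diff)
  have "a \<in> cls (W_ideal_c n m) a"
    by (simp add: mem_cls_iff[OF two_sided_W_c] two_sided_zero[OF two_sided_W_c])
  then have "(\<lambda>b. act_c n m b v) ` cls (W_ideal_c n m) a = {act_c n m a v}"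
    using * by (intro subset_antisym subsetI) (blast intro: rev_image_eqI)+
  then show ?thesis by (simp add: Fock_act_c_def)
qed

lemma Fock_act_h_cls:
  assumes v: "\<And>k. v $ k \<in> FS n m" shows "Fock_act_h n m (cls (W_ideal_h n m) a) v = act_h n m a v"
proof -
  have *: "act_h n m b v = act_h n m a v" if "b \<in> cls (W_ideal_h n m) a" for b
  proof -
    have "act_c n m (b $ i) (v $ j) = act_c n m (a $ i) (v $ j)" for i j
      using that W_ideal_kills[OF _ v, of "b $ i - a $ i"]
      by (simp add: mem_cls_iff[OF two_sided_W_h] mem_W_ideal_h act_c_diff)
    then show ?thesis by (simp add: act_h_def)
  qed
  have "a \<in> cls (W_ideal_h n m) a"
    by (simp add: mem_cls_iff[OF two_sided_W_h] two_sided_zero[OF two_sided_W_h])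
  then have "(\<lambda>b. act_h n m b v) ` cls (W_ideal_h n m) a = {act_h n m a v}"
    using * by (intro subset_antisym subsetI) (blast intro: rev_image_eqI)+
  then show ?thesis by (simp add: Fock_act_h_def)
qed

section \<open>Matrix elements\<close>

definition qtys :: "nat \<Rightarrow> nat \<Rightarrow> (nat \<Rightarrow> nat) \<Rightarrow> nat" where
  "qtys n m l = (\<Sum>i\<in>{1..<n+m}. l i)"

text \<open>The indices of the basis vectors of \<open>F\<^sub>0\<close>.\<close>

definition low :: "nat \<Rightarrow> nat \<Rightarrow> nat \<Rightarrow> (nat \<Rightarrow> nat) set" where
  "low n m p = {l \<in> occ n m. qtys n m l \<le> p}"

lemma occ_zero: "l \<in> occ n m \<Longrightarrow> i \<notin> {1..<n+m} \<Longrightarrow> l i = 0"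
  by (simp add: occ_def)

lemma finite_low: "finite (low n m p)"
proof -
  have "low n m p \<subseteq> {l. \<forall>i. (i \<in> {1..<n+m} \<longrightarrow> l i \<in> {..p}) \<and> (i \<notin> {1..<n+m} \<longrightarrow> l i = 0)}"
  proof
    fix l assume l: "l \<in> low n m p"
    have "l i \<le> qtys n m l" if "i \<in> {1..<n+m}" for i
      unfolding qtys_def using that by (intro member_le_sum) auto
    then show "l \<in> {l. \<forall>i. (i \<in> {1..<n+m} \<longrightarrow> l i \<in> {..p}) \<and> (i \<notin> {1..<n+m} \<longrightarrow> l i = 0)}"
      using l by (force simp: low_def occ_def)
  qed
  then show ?thesis by (rule finite_subset) (intro finite_set_of_finite_funs; simp)
qed

lemma weighted_sum_upd:
  "i \<in> {1..<n+m::nat} \<Longrightarrow> (\<Sum>j\<in>{1..<n+m}. f j * (l(i := a)) j) + f i * l i = (\<Sum>j\<in>{1..<n+m}. f j * l j) + f i * (a::nat)"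
proof -
  assume i: "i \<in> {1..<n+m}"
  have *: "(\<Sum>j\<in>{1..<n+m}. f j * k j) = f i * k i + (\<Sum>j\<in>{1..<n+m} - {i}. f j * k j)" for k
    using i by (intro sum.remove) auto
  have "(\<Sum>j\<in>{1..<n+m} - {i}. f j * (l(i := a)) j) = (\<Sum>j\<in>{1..<n+m} - {i}. f j * l j)"
    by (rule sum.cong) auto
  then show ?thesis by (simp only: *) simp
qed

lemma qtys_upd: "i \<in> {1..<n+m} \<Longrightarrow> qtys n m (l(i := a)) + l i = qtys n m l + a"
  using weighted_sum_upd[of i n m "\<lambda>_. 1" l a] by (simp add: qtys_def)

lemma tot_of_nat: "tot n m (\<lambda>i. of_nat (l i)) = of_nat (qtys n m l)"
  by (simp add: tot_def qtys_def)

text \<open>The sum of all \<open>h\<^sub>i\<close> is mapped to the constant \<open>p\<close>.\<close>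

lemma sum_pi_h:
  assumes "n + m \<ge> 1" shows "(\<Sum>i\<in>{1..n+m}. pi_h n m cr an P i) = P"
proof -
  have "(\<Sum>i\<in>{1..n+m}. pi_h n m cr an P i) = pi_h n m cr an P 1 + (\<Sum>i\<in>{Suc 1..n+m}. pi_h n m cr an P i)"
    using assms by (simp add: sum.atLeast_Suc_atMost)
  also have "(\<Sum>i\<in>{Suc 1..n+m}. pi_h n m cr an P i) = (\<Sum>j\<in>{1..<n+m}. cr j * an j)"
    by (rule sum.reindex_bij_witness[of _ Suc "\<lambda>i. i - 1"]) (auto simp: pi_h_def)
  finally show ?thesis by (simp add: pi_h_def)
qed

text \<open>
  Up to a scalar, \<open>e\<^sub>i\<close> and \<open>f\<^sub>i\<close> map \<open>|l)\<close> to the basis vectors with indices \<open>et i l\<close> and \<open>ft i l\<close>. The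
  scalars contain the factors \<open>eamp\<close> and \<open>famp\<close>, which come from the operators \<open>A\<^sub>i\<^sup>\<plusminus>\<close>.
\<close>

definition et :: "nat \<Rightarrow> (nat \<Rightarrow> nat) \<Rightarrow> nat \<Rightarrow> nat" where
  "et i l = (if i = 1 then tgt False 1 l else tgt True (i - 1) (tgt False i l))"

definition ft :: "nat \<Rightarrow> (nat \<Rightarrow> nat) \<Rightarrow> nat \<Rightarrow> nat" where
  "ft i l = (if i = 1 then tgt True 1 l else tgt True i (tgt False (i - 1) l))"

definition eamp :: "nat \<Rightarrow> nat \<Rightarrow> (nat \<Rightarrow> nat) \<Rightarrow> complex" where
  "eamp n i l = (if i = 1 then amp n False 1 l else amp n False i l * amp n True (i - 1) (tgt False i l))"

definition famp :: "nat \<Rightarrow> nat \<Rightarrow> (nat \<Rightarrow> nat) \<Rightarrow> complex" where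
  "famp n i l = (if i = 1 then amp n True 1 l else amp n False (i - 1) l * amp n True i (tgt False (i - 1) l))"

lemma amp_False_pos: "amp n False i l \<noteq> 0 \<Longrightarrow> l i \<ge> 1"
  by (auto simp: amp_def split: if_splits)

lemma et_ft:
  assumes "eamp n i l \<noteq> 0" shows "ft i (et i l) = l" "famp n i (et i l) = eamp n i l"
proof -
  have a: "amp n False i l \<noteq> 0" "i \<noteq> 1 \<Longrightarrow> amp n True (i - 1) (tgt False i l) \<noteq> 0"
    using assms by (auto simp: eamp_def split: if_splits)
  show "ft i (et i l) = l" "famp n i (et i l) = eamp n i l"
    using amp_tgt[OF a(1)] amp_tgt[OF a(2)]
    by (cases "i = 1"; simp add: ft_def et_def famp_def eamp_def)+
qed

lemma ft_et:
  assumes "famp n i l \<noteq> 0" shows "et i (ft i l) = l" "eamp n i (ft i l) = famp n i l"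
proof -
  have a: "i = 1 \<Longrightarrow> amp n True i l \<noteq> 0" "i \<noteq> 1 \<Longrightarrow> amp n False (i - 1) l \<noteq> 0"
    "i \<noteq> 1 \<Longrightarrow> amp n True i (tgt False (i - 1) l) \<noteq> 0"
    using assms by (auto simp: famp_def split: if_splits)
  show "et i (ft i l) = l" "eamp n i (ft i l) = famp n i l"
    using amp_tgt[OF a(1)] amp_tgt[OF a(2)] amp_tgt[OF a(3)]
    by (cases "i = 1"; simp add: ft_def et_def famp_def eamp_def)+
qed

lemma et_occ:
  assumes "l \<in> occ n m" "i \<in> {1..<n+m}" "eamp n i l \<noteq> 0" shows "et i l \<in> occ n m"
proof -
  have "i \<noteq> 1 \<Longrightarrow> i - 1 \<in> {1..<n+m}" using assms(2) by auto
  then show ?thesis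
    using assms tgt_occ[of l n m i False] tgt_occ[of "tgt False i l" n m "i - 1" True]
    by (cases "i = 1") (auto simp: et_def eamp_def)
qed

lemma ft_occ:
  assumes "l \<in> occ n m" "i \<in> {1..<n+m}" "famp n i l \<noteq> 0" shows "ft i l \<in> occ n m"
proof -
  have "i \<noteq> 1 \<Longrightarrow> i - 1 \<in> {1..<n+m}" using assms(2) by auto
  then show ?thesis
    using assms tgt_occ[of l n m i True] tgt_occ[of l n m "i - 1" False] tgt_occ[of "tgt False (i - 1) l" n m i True]
    by (cases "i = 1") (auto simp: ft_def famp_def)
qed

lemma et_values:
  assumes "eamp n i l \<noteq> 0" "i \<ge> 1"
  shows "of_nat (et i l i) + 1 = (of_nat (l i) :: complex)" "i \<noteq> 1 \<Longrightarrow> et i l (i - 1) = l (i - 1) + 1"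
proof -
  have "amp n False i l \<noteq> 0" using assms by (auto simp: eamp_def split: if_splits)
  from amp_False_pos[OF this] have "l i \<ge> 1" .
  then show "of_nat (et i l i) + 1 = (of_nat (l i) :: complex)"
    using assms(2) by (auto simp: et_def tgt_def of_nat_diff)
  show "i \<noteq> 1 \<Longrightarrow> et i l (i - 1) = l (i - 1) + 1" using assms(2) by (auto simp: et_def tgt_def)
qed

text \<open>
  Moving a quantum to the left decreases the sum of the positions of all quanta, which serves as the
  measure for descending to the vacuum.
\<close>

lemma et_sum:
  assumes "eamp n i l \<noteq> 0" "i \<in> {1..<n+m}"
  shows "qtys n m (et i l) + of_bool (i = 1) = qtys n m l"
    "(\<Sum>j\<in>{1..<n+m}. j * et i l j) < (\<Sum>j\<in>{1..<n+m}. j * l j)"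
proof -
  have "amp n False i l \<noteq> 0" using assms by (auto simp: eamp_def split: if_splits)
  from amp_False_pos[OF this] have l: "l i \<ge> 1" .
  have i1: "i \<noteq> 1 \<Longrightarrow> i - 1 \<in> {1..<n+m}" using assms(2) by auto
  note q1 = qtys_upd[OF assms(2), of l "l i - 1"] weighted_sum_upd[OF assms(2), of "\<lambda>j. j" l "l i - 1"]
  note q2 = qtys_upd[OF i1, of "l(i := l i - 1)" "l (i - 1) + 1"]
    weighted_sum_upd[OF i1, of "\<lambda>j. j" "l(i := l i - 1)" "l (i - 1) + 1"]
  have et: "et i l = (if i = 1 then l(i := l i - 1) else l(i := l i - 1, i - 1 := l (i - 1) + 1))"
    using assms(2) by (auto simp: et_def tgt_def)
  have w: "i * (l i - 1) + i = i * l i" using l by (metis add_mult_distrib2 le_add_diff_inverse2 mult.right_neutral)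
  have w2: "(i - 1) * (l (i - 1) + 1) = (i - 1) * l (i - 1) + (i - 1)" by simp
  show "qtys n m (et i l) + of_bool (i = 1) = qtys n m l"
  proof (cases "i = 1")
    case True
    then show ?thesis using q1(1) l unfolding et by simp
  next
    case False
    then have "(l(i := l i - 1)) (i - 1) = l (i - 1)" using assms(2) by auto
    moreover have "qtys n m (l(i := l i - 1)) + 1 = qtys n m l" using q1(1) l by linarith
    ultimately show ?thesis using q2(1)[OF False] False unfolding et by simp
  qed
  show "(\<Sum>j\<in>{1..<n+m}. j * et i l j) < (\<Sum>j\<in>{1..<n+m}. j * l j)"
  proof (cases "i = 1")
    case True
    then show ?thesis using q1(2) w unfolding et by simp
  next
    case False
    then have same: "(l(i := l i - 1)) (i - 1) = l (i - 1)" and i: "i > 1" using assms(2) by auto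
    have "(\<Sum>j\<in>{1..<n+m}. j * (l(i := l i - 1)) j) + i = (\<Sum>j\<in>{1..<n+m}. j * l j)"
      using q1(2) w by linarith
    moreover have "(\<Sum>j\<in>{1..<n+m}. j * et i l j) = (\<Sum>j\<in>{1..<n+m}. j * (l(i := l i - 1)) j) + (i - 1)"
      using q2(2)[OF False, unfolded same] w2 unfolding et if_not_P[OF False] by linarith
    ultimately show ?thesis using i by linarith
  qed
qed

text \<open>
  If \<open>i\<close> is the first occupied site, the site \<open>i - 1\<close> is empty, and even a Fermi site can receive a
  quantum.
\<close>

lemma eamp_nonzero:
  assumes "i \<in> {1..<n+m}" "l i \<noteq> 0" "\<And>j. j < i \<Longrightarrow> l j = 0" "l \<in> occ n m"
  shows "eamp n i l \<noteq> 0"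
proof -
  have fs: "fsign n j k \<noteq> 0" for j k by (simp add: fsign_def)
  have "n \<le> i \<Longrightarrow> l i = 1" using assms(2,4) by (force simp: occ_def)
  then have 1: "amp n False i l \<noteq> 0" using assms(2) by (auto simp: amp_def fs)
  have "amp n True (i - 1) (tgt False i l) \<noteq> 0" if "i \<noteq> 1"
  proof -
    have "l (i - 1) = 0" "i - 1 \<noteq> i" using assms that by auto
    then have "tgt False i l (i - 1) = 0" by (simp add: tgt_def)
    then show ?thesis by (simp add: amp_def fs)
  qed
  then show ?thesis using 1 by (cases "i = 1") (simp_all add: eamp_def)
qed

text \<open>
  What the Fock spaces over the complex numbers and over the power series have in common: basis vectors
  \<open>kt l\<close>, coordinates \<open>crd l\<close>, and the subspace \<open>F0\<close> with the basis \<open>kt l\<close> for \<open>l\<close> with at most \<open>p\<close> quanta.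
\<close>

locale fock_action = q_numbers \<iota> Q br qs s t + Modules.module sc
  for \<iota> :: "complex \<Rightarrow> 'k::idom" and Q br qs s t and sc :: "'k \<Rightarrow> 'v \<Rightarrow> 'v::ab_group_add" +
  fixes n m p :: nat and act :: "'b::ring_1 \<Rightarrow> 'v \<Rightarrow> 'v" and kt :: "(nat \<Rightarrow> nat) \<Rightarrow> 'v"
    and crd :: "(nat \<Rightarrow> nat) \<Rightarrow> 'v \<Rightarrow> 'k" and fn :: "((nat \<Rightarrow> complex) \<Rightarrow> 'k) \<Rightarrow> 'b"
    and op :: "bool \<Rightarrow> nat \<Rightarrow> 'b" and P :: 'b and F0 :: "'v set"
  assumes n: "n \<ge> 1" and br_nonzero: "k \<ge> 1 \<Longrightarrow> br (of_nat k) \<noteq> 0"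
    and act_add: "act a (v + w) = act a v + act a w"
    and act_add_left: "act (a + b) v = act a v + act b v"
    and act_mult: "act (a * b) v = act a (act b v)"
    and act_scale: "act a (sc c v) = sc c (act a v)"
    and act_P: "act P v = sc (\<iota> (of_nat p)) v"
    and act_fn: "act (fn \<phi>) (kt l) = sc (\<phi> (\<lambda>i. of_nat (l i))) (kt l)"
    and act_op: "l \<in> occ n m \<Longrightarrow> i \<in> {1..<n+m} \<Longrightarrow> act (op u i) (kt l) = sc (\<iota> (amp n u i l)) (kt (tgt u i l))"
    and crd_add: "crd l (v + w) = crd l v + crd l w"
    and crd_scale: "crd l (sc c v) = c * crd l v"
    and crd_kt: "crd l (kt l') = of_bool (l = l')"
    and F0_subspace: "subspace F0"
    and F0_kt: "l \<in> low n m p \<Longrightarrow> kt l \<in> F0"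
    and F0_expand: "v \<in> F0 \<Longrightarrow> v = (\<Sum>l\<in>low n m p. sc (crd l v) (kt l))"
begin

lemma \<iota>_nonzero: "c \<noteq> 0 \<Longrightarrow> \<iota> c \<noteq> 0"
  using ring_map_simps(1,3,4)[OF \<iota>] by (metis mult_zero_left right_inverse zero_neq_one)

lemma t_nonzero: "k \<ge> 1 \<Longrightarrow> t (of_nat k) \<noteq> 0"
  using t_sq[of "of_nat k"] br_nonzero[of k] by auto

lemma s_zero_iff: "s (of_nat k) = 0 \<longleftrightarrow> k = 0"
  using s[of "of_nat k"] br_nonzero[of k] br_simps(1) by (cases "k = 0") auto

lemma ang_nonzero: "k \<ge> 1 \<Longrightarrow> ang n t i (of_nat k) \<noteq> 0"
  by (simp add: ang_def t_nonzero)

text \<open>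
  The factors of the matrix elements that come from the functions of the number operators in \<open>\<pi>(e\<^sub>i)\<close> and
  \<open>\<pi>(f\<^sub>i)\<close>, at the basis vector \<open>|k)\<close> which the creation and annihilation operators produce.
\<close>

definition wt :: "nat \<Rightarrow> (nat \<Rightarrow> nat) \<Rightarrow> 'k" where
  "wt i k = (if i = 1 then s (of_nat p - of_nat (qtys n m k)) * ang n t 1 (of_nat (k 1) + 1)
     else ang n t (i - 1) (of_nat (k (i - 1))) * ang n t i (of_nat (k i) + 1))"

definition wt' :: "nat \<Rightarrow> (nat \<Rightarrow> nat) \<Rightarrow> 'k" where
  "wt' i k = (if i = 1 then s (of_nat p - of_nat (qtys n m k) + 1) * ang n t 1 (of_nat (k 1))
     else ang n t (i - 1) (of_nat (k (i - 1)) + 1) * ang n t i (of_nat (k i)))"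

text \<open>The matrix elements of \<open>e\<^sub>i\<close> and \<open>f\<^sub>i\<close>.\<close>

definition ec :: "nat \<Rightarrow> (nat \<Rightarrow> nat) \<Rightarrow> 'k" where
  "ec i l = wt i (et i l) * \<iota> (eamp n i l)"

definition fc :: "nat \<Rightarrow> (nat \<Rightarrow> nat) \<Rightarrow> 'k" where
  "fc i l = wt' i (ft i l) * \<iota> (famp n i l)"

abbreviation "eop \<equiv> pi_e n m s t (of_nat p) fn (op True) (op False)"
abbreviation "fop \<equiv> pi_f n m s t (of_nat p) fn (op True) (op False)"
abbreviation "hop \<equiv> pi_h n m (op True) (op False) P"

lemma act_zero: "act a 0 = 0" "act 0 v = 0"
  using act_add[of a 0 0] act_add_left[of 0 0 v] by simp_all

lemma act_diff_left: "act (a - b) v = act a v - act b v"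
  using act_add_left[of "a - b" b v] by (simp add: algebra_simps)

lemma act_sum: "act a (sum f A) = (\<Sum>i\<in>A. act a (f i))" "act (sum g A) v = (\<Sum>i\<in>A. act (g i) v)"
  by (induction A rule: infinite_finite_induct) (simp_all add: act_zero act_add act_add_left)

lemma act_op_op:
  assumes "l \<in> occ n m" "i \<in> {1..<n+m}" "j \<in> {1..<n+m}"
  shows "act (op u i) (act (op v j) (kt l)) =
    sc (\<iota> (amp n v j l * amp n u i (tgt v j l))) (kt (tgt u i (tgt v j l)))"
proof (cases "amp n v j l = 0")
  case True
  then show ?thesis using assms by (simp add: act_op ring_map_simps[OF \<iota>] act_zero)
next
  case False
  then show ?thesis using assms tgt_occ[of l n m j v]
    by (simp add: act_op act_scale ring_map_simps[OF \<iota>])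
qed

lemma eop_kt:
  assumes l: "l \<in> occ n m" and i: "i \<in> {1..<n+m}"
  shows "act (eop i) (kt l) = sc (ec i l) (kt (et i l))"
proof (cases "i = 1")
  case True
  then show ?thesis using act_op[OF l i, of False]
    by (simp add: pi_e_def act_mult act_scale act_fn ec_def wt_def et_def eamp_def tot_of_nat mult_ac)
next
  case False
  have "i - 1 \<in> {1..<n+m}" using i False by auto
  from act_op_op[OF l this i, of True False] False show ?thesis
    by (simp add: pi_e_def act_mult act_scale act_fn ec_def wt_def et_def eamp_def mult_ac)
qed

lemma fop_kt:
  assumes l: "l \<in> occ n m" and i: "i \<in> {1..<n+m}"
  shows "act (fop i) (kt l) = sc (fc i l) (kt (ft i l))"
proof (cases "i = 1")
  case True
  then show ?thesis using act_op[OF l i, of True]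
    by (simp add: pi_f_def act_mult act_scale act_fn fc_def wt'_def ft_def famp_def tot_of_nat mult_ac)
next
  case False
  have "i - 1 \<in> {1..<n+m}" using i False by auto
  from act_op_op[OF l i this, of True False] False show ?thesis
    by (simp add: pi_f_def act_mult act_scale act_fn fc_def wt'_def ft_def famp_def mult_ac)
qed

definition hval :: "nat \<Rightarrow> (nat \<Rightarrow> nat) \<Rightarrow> complex" where
  "hval i l = (if i = 1 then of_nat p - of_nat (qtys n m l) else of_nat (l (i - 1)))"

lemma N_kt:
  assumes l: "l \<in> occ n m" and i: "i \<in> {1..<n+m}"
  shows "act (op True i) (act (op False i) (kt l)) = sc (\<iota> (of_nat (l i))) (kt l)"
proof -
  have le: "n \<le> i \<Longrightarrow> l i = 0 \<or> l i = 1" using l by (force simp: occ_def)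
  have sq: "complex_of_real (sqrt (real k)) * complex_of_real (sqrt (real k)) = of_nat k" for k
    unfolding of_real_mult[symmetric] by simp
  show ?thesis
  proof (cases "amp n False i l = 0")
    case True
    then have "l i = 0" using le by (cases "i < n") (auto simp: amp_def fsign_def)
    then show ?thesis using True act_op[OF l i, of False] by (simp add: ring_map_simps[OF \<iota>] act_zero)
  next
    case False
    have "amp n False i l * amp n False i l = of_nat (l i)"
    proof (cases "i < n")
      case True
      then show ?thesis by (simp add: amp_def sq)
    next
      case False
      then show ?thesis using le by (auto simp: amp_def fsign_sq)
    qed
    then show ?thesis using act_op_op[OF l i i, of True False] amp_tgt[OF False] by simp
  qed
qed

lemma hop_kt:
  assumes l: "l \<in> occ n m" and i: "i \<in> {1..n+m}"
  shows "act (hop i) (kt l) = sc (\<iota> (hval i l)) (kt l)"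
proof (cases "i = 1")
  case True
  have "act (hop i) (kt l) = sc (\<iota> (of_nat p)) (kt l) - (\<Sum>j\<in>{1..<n+m}. sc (\<iota> (of_nat (l j))) (kt l))"
    using True N_kt[OF l] by (simp add: pi_h_def act_diff_left act_P act_sum act_mult)
  then show ?thesis
    using True by (simp add: hval_def qtys_def scale_left_diff_distrib scale_sum_left ring_map_simps[OF \<iota>])
next
  case False
  then have "i - 1 \<in> {1..<n+m}" using i by auto
  from N_kt[OF l this] False show ?thesis by (simp add: pi_h_def act_mult hval_def)
qed

text \<open>
  The matrices of \<open>e\<^sub>i\<close> and \<open>f\<^sub>i\<close> are transposed to each other, because \<open>\<pi>(e\<^sub>i)\<close> and \<open>\<pi>(f\<^sub>i)\<close> are formal
  adjoints.
\<close>

lemma ec_fc: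
  assumes i: "i \<in> {1..<n+m}" and nz: "eamp n i l \<noteq> 0"
  shows "fc i (et i l) = ec i l"
proof -
  have "wt' i l = wt i (et i l)"
  proof (cases "i = 1")
    case True
    have "qtys n m (et i l) + 1 = qtys n m l" using et_sum(1)[OF nz i] True by simp
    from arg_cong[OF this, of "of_nat :: nat \<Rightarrow> complex"]
    have "of_nat (qtys n m (et i l)) + 1 = (of_nat (qtys n m l) :: complex)"
      by (simp only: of_nat_add of_nat_1)
    then have eq: "(of_nat p - of_nat (qtys n m l) + 1 :: complex) = of_nat p - of_nat (qtys n m (et i l))"
      by (simp add: algebra_simps)
    show ?thesis unfolding wt_def wt'_def if_P[OF True] eq using et_values(1)[OF nz] True by simp
  next
    case False
    then show ?thesis using i et_values[OF nz] by (simp add: wt_def wt'_def add.commute)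
  qed
  then show ?thesis using et_ft[OF nz] by (simp add: fc_def ec_def)
qed

lemma fc_ec:
  assumes i: "i \<in> {1..<n+m}" and nz: "famp n i l \<noteq> 0"
  shows "ec i (ft i l) = fc i l"
  using ec_fc[OF i, of "ft i l"] ft_et[OF nz] nz by simp

text \<open>\<open>F\<^sub>0\<close> and \<open>F\<^sub>1\<close> are separated because the matrix elements between them contain \<open>sqrt [0]\<close>.\<close>

lemma ec_nonzero:
  assumes l: "l \<in> occ n m" and i: "i \<in> {1..<n+m}" and nz: "ec i l \<noteq> 0"
  shows "et i l \<in> occ n m" "qtys n m (et i l) \<le> p \<longleftrightarrow> qtys n m l \<le> p"
proof -
  have a: "eamp n i l \<noteq> 0" and w: "wt i (et i l) \<noteq> 0" using nz by (auto simp: ec_def ring_map_simps[OF \<iota>])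
  show "et i l \<in> occ n m" by (rule et_occ[OF l i a])
  have "qtys n m (et i l) \<noteq> p" if "i = 1" using w that s_zero_iff[of 0] by (auto simp: wt_def)
  then show "qtys n m (et i l) \<le> p \<longleftrightarrow> qtys n m l \<le> p" using et_sum(1)[OF a i] by (cases "i = 1") auto
qed

lemma fc_nonzero:
  assumes l: "l \<in> occ n m" and i: "i \<in> {1..<n+m}" and nz: "fc i l \<noteq> 0"
  shows "ft i l \<in> occ n m" "qtys n m (ft i l) \<le> p \<longleftrightarrow> qtys n m l \<le> p"
proof -
  have a: "famp n i l \<noteq> 0" using nz by (auto simp: fc_def ring_map_simps[OF \<iota>])
  show o: "ft i l \<in> occ n m" by (rule ft_occ[OF l i a])
  show "qtys n m (ft i l) \<le> p \<longleftrightarrow> qtys n m l \<le> p"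
    using ec_nonzero(2)[OF o i] fc_ec[OF i a] nz ft_et(1)[OF a] by simp
qed

text \<open>
  Moving a quantum from the first occupied site to the left is possible with nonzero coefficient: the
  factors \<open>\<langle>k\<rangle>\<close> occur for \<open>k \<ge> 1\<close> only, and \<open>sqrt [p - N]\<close> only for \<open>N < p\<close>.
\<close>

lemma lowering_step:
  assumes l: "l \<in> low n m p" and ne: "l \<noteq> (\<lambda>_. 0)"
  shows "\<exists>i\<in>{1..<n+m}. et i l \<in> low n m p \<and> eamp n i l \<noteq> 0 \<and> ec i l \<noteq> 0"
proof -
  obtain j where "l j \<noteq> 0" using ne by blast
  define i where "i = (LEAST i. l i \<noteq> 0)"
  have i0: "l i \<noteq> 0" unfolding i_def by (rule LeastI) fact
  have below: "l j = 0" if "j < i" for j using not_less_Least[of j "\<lambda>i. l i \<noteq> 0"] that i_def by blast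
  have o: "l \<in> occ n m" and q: "qtys n m l \<le> p" using l by (auto simp: low_def)
  have i: "i \<in> {1..<n+m}" using occ_zero[OF o, of i] i0 by blast
  have a: "eamp n i l \<noteq> 0" by (rule eamp_nonzero[OF i i0 below o])
  note sum = et_sum(1)[OF a i]
  have "wt i (et i l) \<noteq> 0"
  proof (cases "i = 1")
    case True
    have "(of_nat p - of_nat (qtys n m (et i l)) :: complex) = of_nat (p - qtys n m (et i l))"
      using sum q by (simp add: of_nat_diff)
    moreover have "p - qtys n m (et i l) \<noteq> 0" using sum q True by simp
    ultimately have "s (of_nat p - of_nat (qtys n m (et i l))) \<noteq> 0" by (simp only: s_zero_iff not_False_eq_True)
    moreover have "ang n t 1 (of_nat (et i l 1 + 1)) \<noteq> 0" by (rule ang_nonzero) simp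
    ultimately show ?thesis using True by (simp add: wt_def add.commute)
  next
    case False
    have "ang n t i (of_nat (et i l i + 1)) \<noteq> 0" "ang n t (i - 1) (of_nat (l (i - 1) + 1)) \<noteq> 0"
      by (rule ang_nonzero, simp)+
    then show ?thesis using False i et_values(2)[OF a] by (simp add: wt_def add.commute)
  qed
  then have "ec i l \<noteq> 0" using a by (simp add: ec_def \<iota>_nonzero)
  moreover from ec_nonzero[OF o i this] have "et i l \<in> low n m p" using q by (simp add: low_def)
  ultimately show ?thesis using i a by blast
qed

section \<open>Irreducibility\<close>

context
  fixes L :: "'v set"
  assumes L: "subspace L" "L \<subseteq> F0"
    and e: "\<And>i v. i \<in> {1..<n+m} \<Longrightarrow> v \<in> L \<Longrightarrow> act (eop i) v \<in> L"
    and f: "\<And>i v. i \<in> {1..<n+m} \<Longrightarrow> v \<in> L \<Longrightarrow> act (fop i) v \<in> L"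
    and h: "\<And>i v. i \<in> {1..n+m} \<Longrightarrow> v \<in> L \<Longrightarrow> act (hop i) v \<in> L"
    and saturated: "\<And>c v. c \<noteq> 0 \<Longrightarrow> v \<in> F0 \<Longrightarrow> sc c v \<in> L \<Longrightarrow> v \<in> L"
begin

definition supp :: "'v \<Rightarrow> (nat \<Rightarrow> nat) set" where
  "supp v = {l \<in> low n m p. crd l v \<noteq> 0}"

lemma crd_sum: "crd l (sum g A) = (\<Sum>i\<in>A. crd l (g i))"
proof -
  have "crd l 0 = 0" using crd_scale[of l 0 0] by simp
  then show ?thesis by (induction A rule: infinite_finite_induct) (simp_all add: crd_add)
qed

lemma crd_expand:
  assumes "k \<in> low n m p" shows "crd k (\<Sum>j\<in>low n m p. sc (a j) (kt j)) = a k"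
proof -
  have "crd k (\<Sum>j\<in>low n m p. sc (a j) (kt j)) = (\<Sum>j\<in>low n m p. if k = j then a j else 0)"
    unfolding crd_sum by (rule sum.cong) (auto simp: crd_scale crd_kt)
  then show ?thesis using assms by (simp add: finite_low)
qed

text \<open>
  If a vector of \<open>L\<close> involves two basis vectors, an occupation number separates them and the
  combination of \<open>v\<close> and \<open>N\<^sub>i v\<close> that removes one of them is shorter.
\<close>

lemma some_kt: "v \<in> L \<Longrightarrow> v \<noteq> 0 \<Longrightarrow> \<exists>l\<in>low n m p. kt l \<in> L"
proof (induction "card (supp v)" arbitrary: v rule: less_induct)
  case (less v)
  then have v: "v = (\<Sum>l\<in>low n m p. sc (crd l v) (kt l))" using F0_expand L(2) by blast
  have fin: "finite (supp v)" by (simp add: supp_def finite_low)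
  have "supp v \<noteq> {}"
  proof
    assume "supp v = {}"
    then have "(\<Sum>l\<in>low n m p. sc (crd l v) (kt l)) = 0" by (intro sum.neutral) (auto simp: supp_def)
    then show False using v less.prems by simp
  qed
  then obtain l where l: "l \<in> supp v" by blast
  show ?case
  proof (cases "supp v = {l}")
    case True
    have l_low: "l \<in> low n m p" and c: "crd l v \<noteq> 0" using l by (simp_all add: supp_def)
    have zero: "crd k v = 0" if "k \<in> low n m p - {l}" for k using that True unfolding supp_def by blast
    have "(\<Sum>k\<in>low n m p. sc (crd k v) (kt k)) = (\<Sum>k\<in>{l}. sc (crd k v) (kt k))"
      using l_low by (intro sum.mono_neutral_right) (simp_all add: zero finite_low)
    also have "\<dots> = sc (crd l v) (kt l)" by simp
    finally have "sc (crd l v) (kt l) \<in> L" using v less.prems(1) by (simp only:)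
    then show ?thesis using saturated[OF c F0_kt[OF l_low]] l_low by blast
  next
    case False
    then obtain l' where l': "l' \<in> supp v" "l' \<noteq> l" using l by blast
    then obtain i where i0: "l' i \<noteq> l i" by (meson ext)
    have ol: "l \<in> occ n m" "l' \<in> occ n m" using l l' by (auto simp: supp_def low_def)
    have i: "i \<in> {1..<n+m}" using i0 occ_zero[OF ol(1), of i] occ_zero[OF ol(2), of i] by metis
    then have i1: "i + 1 \<in> {1..n+m}" "i \<noteq> 0" by auto
    define w where "w = act (hop (i + 1)) v - sc (\<iota> (of_nat (l i))) v"
    have "w \<in> L" unfolding w_def using less.prems h[OF i1(1)] L(1) by (intro subspace_diff subspace_scale)
    have "act (hop (i + 1)) v = (\<Sum>k\<in>low n m p. sc (crd k v) (sc (\<iota> (of_nat (k i))) (kt k)))"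
    proof -
      have hk: "act (hop (i + 1)) (kt k) = sc (\<iota> (of_nat (k i))) (kt k)" if "k \<in> low n m p" for k
        using hop_kt[OF _ i1(1), of k] that i1(2) by (simp add: low_def hval_def)
      show ?thesis
        by (subst v, unfold act_sum(1) act_scale) (rule sum.cong[OF refl], simp only: hk)
    qed
    then have crd_h: "crd k (act (hop (i + 1)) v) = \<iota> (of_nat (k i)) * crd k v" if "k \<in> low n m p" for k
      using that by (simp add: crd_expand mult.commute)
    have crd_w: "crd k w = (\<iota> (of_nat (k i)) - \<iota> (of_nat (l i))) * crd k v" if "k \<in> low n m p" for k
    proof -
      have "crd k (w + sc (\<iota> (of_nat (l i))) v) = \<iota> (of_nat (k i)) * crd k v"
        unfolding w_def diff_add_cancel by (rule crd_h[OF that])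
      then show ?thesis by (simp add: crd_add crd_scale algebra_simps)
    qed
    have "supp w \<subset> supp v"
    proof
      show "supp w \<subseteq> supp v" by (auto simp: supp_def crd_w)
      have "l \<notin> supp w" by (auto simp: supp_def crd_w)
      then show "supp w \<noteq> supp v" using l by blast
    qed
    then have "card (supp w) < card (supp v)" by (rule psubset_card_mono[OF fin])
    moreover have "w \<noteq> 0"
    proof
      assume "w = 0"
      then have "crd l' w = 0" using crd_scale[of l' 0 0] by simp
      moreover have "\<iota> (of_nat (l' i) - of_nat (l i)) \<noteq> 0" using i0 by (intro \<iota>_nonzero) simp
      ultimately show False using l' crd_w[of l'] by (auto simp: supp_def ring_map_simps[OF \<iota>])
    qed
    ultimately show ?thesis using less.hyps \<open>w \<in> L\<close> by blast
  qed
qed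

text \<open>
  Since \<open>e\<^sub>i\<close> and \<open>f\<^sub>i\<close> have the same nonzero matrix element between \<open>l\<close> and \<open>et i l\<close>, either of the two
  basis vectors belongs to \<open>L\<close> if the other one does.
\<close>

lemma kt_iff_vacuum: "l \<in> low n m p \<Longrightarrow> kt l \<in> L \<longleftrightarrow> kt (\<lambda>_. 0) \<in> L"
proof (induction "\<Sum>j\<in>{1..<n+m}. j * l j" arbitrary: l rule: less_induct)
  case (less l)
  show ?case
  proof (cases "l = (\<lambda>_. 0)")
    case False
    then obtain i where i: "i \<in> {1..<n+m}" and k: "et i l \<in> low n m p" and a: "eamp n i l \<noteq> 0" and c: "ec i l \<noteq> 0"
      using lowering_step less.prems by blast
    have o: "l \<in> occ n m" "et i l \<in> occ n m" using less.prems k by (auto simp: low_def)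
    have "kt l \<in> L \<longleftrightarrow> kt (et i l) \<in> L"
    proof
      assume "kt l \<in> L"
      from e[OF i this] show "kt (et i l) \<in> L"
        using saturated[OF c F0_kt[OF k]] by (simp add: eop_kt[OF o(1) i])
    next
      assume "kt (et i l) \<in> L"
      from f[OF i this] show "kt l \<in> L"
        using saturated[OF c F0_kt[OF less.prems]] by (simp add: fop_kt[OF o(2) i] ec_fc[OF i a] et_ft(1)[OF a])
    qed
    then show ?thesis using less.hyps[OF et_sum(2)[OF a i] k] by simp
  qed simp
qed

lemma irreducible: "L = {0} \<or> L = F0"
proof (cases "L = {0}")
  case False
  moreover have "0 \<in> L" using L(1) by (rule subspace_0)
  ultimately obtain v where "v \<in> L" "v \<noteq> 0" by blast
  then have kt: "kt l \<in> L" if "l \<in> low n m p" for l using some_kt kt_iff_vacuum that by blast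
  have "v \<in> L" if "v \<in> F0" for v
    by (subst F0_expand[OF that]) (intro subspace_sum[OF L(1)] subspace_scale[OF L(1)] kt)
  then show ?thesis using L(2) by blast
qed simp

end

end

section \<open>The two Fock modules\<close>

lemma mem_span_ket: "v \<in> fock.span (ket ` A) \<longleftrightarrow> Poly_Mapping.keys v \<subseteq> A"
proof
  assume "v \<in> fock.span (ket ` A)"
  then show "Poly_Mapping.keys v \<subseteq> A"
  proof (induction rule: fock.span_induct_alt)
    case (step c x y)
    then show ?case
      using keys_add[of "fscale c x" y] by (auto simp: fscale_ket split: if_splits)
  qed simp
next
  assume "Poly_Mapping.keys v \<subseteq> A"
  then have "(\<Sum>l\<in>Poly_Mapping.keys v. fscale (Poly_Mapping.lookup v l) (ket l)) \<in> fock.span (ket ` A)"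
    by (intro fock.span_sum fock.span_scale fock.span_base) auto
  then show "v \<in> fock.span (ket ` A)" by (simp add: fscale_ket poly_mapping_sum_singles)
qed

lemma ket_expand:
  assumes "v \<in> fock.span (ket ` A)" "finite A"
  shows "v = (\<Sum>l\<in>A. fscale (Poly_Mapping.lookup v l) (ket l))"
proof -
  have "(\<Sum>l\<in>A. fscale (Poly_Mapping.lookup v l) (ket l)) =
      (\<Sum>l\<in>Poly_Mapping.keys v. fscale (Poly_Mapping.lookup v l) (ket l))"
    using assms by (intro sum.mono_neutral_right) (auto simp: mem_span_ket Poly_Mapping.in_keys_iff)
  then show ?thesis by (simp add: fscale_ket poly_mapping_sum_singles)
qed

lemma Fock0_c_eq: "Fock0_c n m p = fock.span (ket ` {l \<in> occ n m. (qtys n m l \<le> p) = True})"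
  and Fock1_c_eq: "Fock1_c n m p = fock.span (ket ` {l \<in> occ n m. (qtys n m l \<le> p) = False})"
  by (simp_all add: Fock0_c_def Fock1_c_def qtys_def not_le)

lemma Fock0_c_low: "Fock0_c n m p = fock.span (ket ` low n m p)"
  by (simp add: Fock0_c_def low_def qtys_def)

lemma Fock_subset_FS: "Fock0_c n m p \<subseteq> FS n m" "Fock1_c n m p \<subseteq> FS n m"
  unfolding Fock0_c_def Fock1_c_def by (rule fock.span_mono; auto)+

lemma fscale_h_const_nth: "fscale_h c (fps_const x) $ k = fscale (c $ k) x"
proof -
  have "fscale_h c (fps_const x) $ k = (\<Sum>i=0..k. if i = k then fscale (c $ k) x else 0)"
    unfolding fscale_h_def fps_nth_Abs_fps by (rule sum.cong) auto
  then show ?thesis by simp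
qed

definition crd_h :: "(nat \<Rightarrow> nat) \<Rightarrow> fock fps \<Rightarrow> complex fps" where
  "crd_h l v = Abs_fps (\<lambda>k. Poly_Mapping.lookup (v $ k) l)"

abbreviation (input) "op_c \<equiv> (\<lambda>u i. fgen (if u then Cr i else An i))"
abbreviation (input) "op_h \<equiv> (\<lambda>u i. fgen_h (if u then Cr i else An i))"

lemma qnum_c_nonzero:
  assumes q: "\<forall>k\<ge>1. exp (h / 2) ^ k \<noteq> 1" and k: "k \<ge> 1" shows "qnum_c h (of_nat k) \<noteq> 0"
proof -
  have ne: "exp (h * of_nat j / 2) \<noteq> exp (- (h * of_nat j / 2))" if j: "j \<ge> 1" for j
  proof
    assume "exp (h * of_nat j / 2) = exp (- (h * of_nat j / 2))"
    then have "exp (h * of_nat j / 2) * exp (h * of_nat j / 2) = 1"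
      by (metis exp_minus_inverse)
    moreover have "exp (h * of_nat j / 2) = exp (h / 2) ^ j"
      by (simp flip: exp_of_nat_mult) (simp add: mult.commute)
    ultimately have "exp (h / 2) ^ (j + j) = 1" by (simp add: power_add)
    then show False using q j by (metis le_add1 le_trans)
  qed
  show ?thesis using ne[of 1] ne[OF k] by (simp add: qnum_c_def)
qed

lemma fock_action_c:
  assumes n: "n \<ge> 1" and q: "\<forall>k\<ge>1. exp (h / 2) ^ k \<noteq> 1" and st: "is_roots_c h s t"
  shows "fock_action (\<lambda>x. x) (\<lambda>x. exp (h * x / 2)) (qnum_c h) (exp (h/2) + exp (-h/2)) s t fscale n m p
    (act_c n m) ket (\<lambda>l v. Poly_Mapping.lookup v l) (\<lambda>\<phi>. fgen (Fn \<phi>)) op_c (fconst (of_nat p)) (Fock0_c n m p)"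
proof (intro fock_action.intro q_numbers_c[OF q st] fock.module_axioms fock_action_axioms.intro n)
  show "act_c n m (fgen (if u then Cr i else An i)) (ket l) = fscale (amp n u i l) (ket (tgt u i l))"
    if "l \<in> occ n m" "i \<in> {1..<n+m}" for u i l
    unfolding act_c_fgen by (rule act_op[OF that])
  show "act_c n m (fgen (Fn \<phi>)) (ket l) = fscale (\<phi> (\<lambda>i. of_nat (l i))) (ket l)" for \<phi> l
    unfolding act_c_fgen by (rule act_Fn)
  show "v = (\<Sum>l\<in>low n m p. fscale (Poly_Mapping.lookup v l) (ket l))" if "v \<in> Fock0_c n m p" for v
    using that finite_low unfolding Fock0_c_low by (rule ket_expand)
  show "ket l \<in> Fock0_c n m p" if "l \<in> low n m p" for l
    using that unfolding Fock0_c_low by (intro fock.span_base imageI)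
  show "fock.subspace (Fock0_c n m p)" unfolding Fock0_c_low by (rule fock.subspace_span)
qed (simp_all add: qnum_c_nonzero[OF q] act_c_add_right act_c_add_left act_c_mult act_c_scale act_c_fconst
    lookup_add fscale_ket lookup_single when_def of_bool_def ket_def)

lemma fock_action_h:
  assumes n: "n \<ge> 1" and st: "is_roots_h s t"
  shows "fock_action fps_const (\<lambda>x. fps_exp (x/2)) qnum_h (fps_exp (1/2) + fps_exp (-1/2)) s t fscale_h n m p
    (act_h n m) (\<lambda>l. fps_const (ket l)) crd_h fn_h op_h (fconst_h (fps_const (of_nat p))) (Fock0_h n m p)"
proof (intro fock_action.intro q_numbers_h[OF st] fock_h.module_axioms fock_action_axioms.intro n)
  show "qnum_h (of_nat k) \<noteq> 0" if "k \<ge> 1" for k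
    using qnum_h_nth_0[of "of_nat k"] that by auto
  show "act_h n m (fn_h \<phi>) (fps_const (ket l)) = fscale_h (\<phi> (\<lambda>i. of_nat (l i))) (fps_const (ket l))" for \<phi> l
    by (rule fps_ext) (simp add: act_h_const fscale_h_const_nth fn_h_nth act_c_fgen act_Fn)
  show "act_h n m (fgen_h (if u then Cr i else An i)) (fps_const (ket l)) =
      fscale_h (fps_const (amp n u i l)) (fps_const (ket (tgt u i l)))"
    if "l \<in> occ n m" "i \<in> {1..<n+m}" for u i l
  proof (rule fps_ext)
    fix k
    show "act_h n m (fgen_h (if u then Cr i else An i)) (fps_const (ket l)) $ k =
      fscale_h (fps_const (amp n u i l)) (fps_const (ket (tgt u i l))) $ k"
      unfolding act_h_const fscale_h_const_nth fgen_h_def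
      by (cases "k = 0") (simp_all only: fps_nth_fps_const simp_thms if_True if_False act_c_fgen act_op[OF that]
          act_c_zero fock.scale_zero_left)
  qed
  show "crd_h l (fscale_h c v) = c * crd_h l v" for l c v
    by (rule fps_ext) (simp add: crd_h_def fscale_h_def lookup_sum fps_mult_nth)
  show "crd_h l (fps_const (ket l')) = of_bool (l = l')" for l l'
    by (rule fps_ext) (auto simp: crd_h_def ket_def lookup_single when_def)
  show "v = (\<Sum>l\<in>low n m p. fscale_h (crd_h l v) (fps_const (ket l)))" if v: "v \<in> Fock0_h n m p" for v
  proof (rule fps_ext)
    fix k
    have "v $ k \<in> fock.span (ket ` low n m p)" using v by (simp add: Fock0_h_def Fock0_c_low)
    from ket_expand[OF this finite_low]
    show "v $ k = (\<Sum>l\<in>low n m p. fscale_h (crd_h l v) (fps_const (ket l))) $ k"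
      by (simp add: fps_sum_nth fscale_h_const_nth crd_h_def)
  qed
  have 0: "0 \<in> Fock0_c n m p" unfolding Fock0_c_low by (rule fock.span_zero)
  show "fps_const (ket l) \<in> Fock0_h n m p" if "l \<in> low n m p" for l
    using that 0 by (auto simp: Fock0_h_def Fock0_c_low intro!: fock.span_base)
  show "fock_h.subspace (Fock0_h n m p)"
    unfolding fock_h.subspace_def using 0
    by (auto simp: Fock0_h_def Fock0_c_low fscale_h_def intro!: fock.span_add fock.span_sum fock.span_scale)
qed (simp_all add: act_h_add_right act_h_add_left act_h_mult act_h_scale act_h_fconst fps_eq_iff crd_h_def lookup_add)

text \<open>It suffices to give the action of representatives.\<close>

lemma rep_on_quot:
  assumes I: "two_sided I" and M: "Modules.module.subspace sc M"
    and \<rho>: "\<And>x v. v \<in> M \<Longrightarrow> \<rho> (cls I x) v = A x v"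
    and inv: "\<And>x v. v \<in> M \<Longrightarrow> A x v \<in> M"
    and "\<And>x v w. A x (v + w) = A x v + A x w" "\<And>x c v. A x (sc c v) = sc c (A x v)"
    and "\<And>x y v. A (x + y) v = A x v + A y v" "\<And>x y v. A (x * y) v = A x (A y v)"
    and "\<And>c v. A (k c) v = sc c v" "\<And>v. A 1 v = v"
    and sub: "\<And>v w. v \<in> M \<Longrightarrow> w \<in> M \<Longrightarrow> v + w \<in> M" "\<And>c v. v \<in> M \<Longrightarrow> sc c v \<in> M"
  shows "rep_on (quot_alg (\<lambda>c x. k c * x) I) sc M \<rho>" "invariant (quot_alg (\<lambda>c x. k c * x) I) \<rho> M"
  unfolding rep_on_def invariant_def using M
  by (auto simp: quot_alg_simps[OF I] \<rho> inv sub assms)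

section \<open>The Fock representation for numerical q\<close>

context
  fixes n m p :: nat and h :: complex and s t :: "complex \<Rightarrow> complex"
  assumes n: "n \<ge> 1" and q: "\<forall>k\<ge>1. exp (h / 2) ^ k \<noteq> 1" and st: "is_roots_c h s t"
begin

interpretation fock_action "\<lambda>x. x" "\<lambda>x. exp (h * x / 2)" "qnum_c h" "exp (h/2) + exp (-h/2)" s t fscale n m p
    "act_c n m" ket "\<lambda>l v. Poly_Mapping.lookup v l" "\<lambda>\<phi>. fgen (Fn \<phi>)" op_c "fconst (of_nat p)" "Fock0_c n m p"
  by (rule fock_action_c[OF n q st])

abbreviation (input) "gc \<equiv> gen_c n m h s t (of_nat p)"
abbreviation (input) "Sc \<equiv> subst fconst gc"

lemma gc_simps:
  "i \<in> {1..n+m} \<Longrightarrow> gc (CH i) = hop i" "i \<in> {1..<n+m} \<Longrightarrow> gc (CE i) = eop i"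
  "i \<in> {1..<n+m} \<Longrightarrow> gc (CF i) = fop i"
  by (simp_all add: gen_c_def)

lemma gc_out:
  "i \<notin> {1..n+m} \<Longrightarrow> gc (CH i) = 0" "i \<notin> {1..<n+m} \<Longrightarrow> gc (CE i) = 0"
  "i \<notin> {1..<n+m} \<Longrightarrow> gc (CF i) = 0"
  by (auto simp: gen_c_def)

lemma gc_invariant_ket:
  assumes l: "l \<in> {l \<in> occ n m. (qtys n m l \<le> p) = b}"
  shows "act_c n m (gc g) (ket l) \<in> fock.span (ket ` {l \<in> occ n m. (qtys n m l \<le> p) = b})" (is "_ \<in> ?M")
proof -
  have sc: "fscale c (ket l) \<in> ?M" for c using l by (intro fock.span_scale fock.span_base imageI)
  have sc': "fscale c (ket l') \<in> ?M" if "c \<noteq> 0 \<Longrightarrow> l' \<in> occ n m \<and> (qtys n m l' \<le> p \<longleftrightarrow> qtys n m l \<le> p)" for c l'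
  proof (cases "c = 0")
    case False
    then have "l' \<in> {l \<in> occ n m. (qtys n m l \<le> p) = b}" using that l by auto
    then show ?thesis by (intro fock.span_scale fock.span_base imageI)
  qed (simp add: fock.span_zero)
  have z: "act_c n m 0 (ket l) \<in> ?M" by (simp add: act_c_zero fock.span_zero)
  have o: "l \<in> occ n m" using l by simp
  have Fn: "act_c n m (fgen (Fn \<phi>)) (ket l) \<in> ?M" for \<phi> by (simp only: act_c_fgen act_Fn sc)
  show ?thesis
  proof (cases g)
    case (CH i)
    show ?thesis
    proof (cases "i \<in> {1..n+m}")
      case True
      then show ?thesis unfolding CH gc_simps(1)[OF True] hop_kt[OF o True] by (intro sc)
    qed (simp only: CH gc_out(1) z simp_thms)
  next
    case (CE i)
    show ?thesis
    proof (cases "i \<in> {1..<n+m}")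
      case True
      show ?thesis unfolding CE gc_simps(2)[OF True] eop_kt[OF o True]
        using ec_nonzero[OF o True] by (intro sc') blast
    qed (simp only: CE gc_out(2) z simp_thms)
  next
    case (CF i)
    show ?thesis
    proof (cases "i \<in> {1..<n+m}")
      case True
      show ?thesis unfolding CF gc_simps(3)[OF True] fop_kt[OF o True]
        using fc_nonzero[OF o True] by (intro sc') blast
    qed (simp only: CF gc_out(3) z simp_thms)
  qed (use z Fn in \<open>simp_all add: gen_c_def\<close>)
qed

lemmas Sc_simps = ring_map_simps[OF ring_map_subst[OF ring_map_fconst fconst_central, of gc]]
  subst_fconst[OF ring_map_fconst fconst_central] subst_fgen[OF ring_map_fconst fconst_central]

lemma Sc_invariant:
  assumes M: "M = fock.span (ket ` {l \<in> occ n m. (qtys n m l \<le> p) = b})" and v: "v \<in> M"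
  shows "act_c n m (Sc x) v \<in> M"
  using v unfolding M
proof (induction x arbitrary: v rule: free_alg_induct)
  case (const c)
  then show ?case by (simp add: Sc_simps act_c_fconst fock.span_scale)
next
  case (gen g)
  then show ?case unfolding Sc_simps by (intro span_act_c[OF gc_invariant_ket fock.subspace_span])
qed (simp_all add: Sc_simps act_c_add_left fock.span_add act_c_mult)

lemma pi_c_act:
  assumes \<pi>: "is_pi_c n m h s t (of_nat p) \<pi>" and v: "v \<in> FS n m"
  shows "Fock_act_c n m (\<pi> (cls (U_ideal_c n m h) x)) v = act_c n m (Sc x) v"
  unfolding pi_c_determined[OF n q st \<pi>] by (rule Fock_act_c_cls[OF v])

lemma rep_c:
  assumes \<pi>: "is_pi_c n m h s t (of_nat p) \<pi>" and M: "M = Fock0_c n m p \<or> M = Fock1_c n m p"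
  shows "rep_on (U_alg_c n m h) fscale M (\<lambda>a. Fock_act_c n m (\<pi> a))"
    "invariant (U_alg_c n m h) (\<lambda>a. Fock_act_c n m (\<pi> a)) M"
proof -
  obtain b where b: "M = fock.span (ket ` {l \<in> occ n m. (qtys n m l \<le> p) = b})"
    using M Fock0_c_eq Fock1_c_eq by blast
  have FS: "v \<in> FS n m" if "v \<in> M" for v using that M Fock_subset_FS by blast
  note r = rep_on_quot[where A = "\<lambda>x. act_c n m (Sc x)" and k = fconst and I = "U_ideal_c n m h" and M = M
      and sc = fscale and \<rho> = "\<lambda>a. Fock_act_c n m (\<pi> a)",
      OF two_sided_U_c _ pi_c_act[OF \<pi> FS] Sc_invariant[OF b]]
  have 1: "act_c n m (Sc 1) v = v" for v using act_c_fconst[of n m 1 v] by (simp add: Sc_simps fconst_simps)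
  note simps = b fock.span_add fock.span_scale fock.subspace_span act_c_add_right act_c_add_left act_c_scale
        act_c_mult act_c_fconst Sc_simps(2,3,9) 1
  show "rep_on (U_alg_c n m h) fscale M (\<lambda>a. Fock_act_c n m (\<pi> a))"
    unfolding U_alg_c_def by (rule r(1)) (simp_all add: simps)
  show "invariant (U_alg_c n m h) (\<lambda>a. Fock_act_c n m (\<pi> a)) M"
    unfolding U_alg_c_def by (rule r(2)) (simp_all add: simps)
qed

lemma fin_dim_c: "fin_dim fscale (Fock0_c n m p)"
  unfolding fin_dim_def Fock0_c_low
  by (intro exI[of _ "ket ` low n m p"]) (auto simp: finite_low intro: fock.span_base)

lemma ket_vacuum: "ket (\<lambda>_. 0) \<in> Fock0_c n m p"
  by (rule F0_kt) (simp add: low_def occ_def qtys_def)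

lemma irreducible_c:
  assumes \<pi>: "is_pi_c n m h s t (of_nat p) \<pi>"
  shows "irreducible_c (U_alg_c n m h) (Fock0_c n m p) (\<lambda>a. Fock_act_c n m (\<pi> a))"
  unfolding irreducible_c_def
proof (intro conjI allI impI)
  have "ket (\<lambda>_. 0) \<noteq> 0" using fock_inner_ket[of "\<lambda>_. 0" "\<lambda>_. 0"] by (auto simp: fock_inner_def)
  then show "Fock0_c n m p \<noteq> {0}" using ket_vacuum by blast
  fix L assume L: "fock.subspace L \<and> L \<subseteq> Fock0_c n m p \<and> invariant (U_alg_c n m h) (\<lambda>a. Fock_act_c n m (\<pi> a)) L"
  have act: "act_c n m (gc g) v \<in> L" if v: "v \<in> L" for g v
  proof -
    have "v \<in> FS n m" using v L Fock_subset_FS by blast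
    moreover have "cls (U_ideal_c n m h) (fgen g) \<in> carrier (U_alg_c n m h)"
      by (simp add: U_alg_c_def carrier_quot_alg[OF two_sided_U_c])
    ultimately show ?thesis
      using L v pi_c_act[OF \<pi>, of v "fgen g"] unfolding invariant_def by (metis Sc_simps(10))
  qed
  show "L = {0} \<or> L = Fock0_c n m p"
  proof (rule irreducible)
    show "fock.subspace L" "L \<subseteq> Fock0_c n m p" using L by auto
    show "v \<in> L" if "c \<noteq> 0" "fscale c v \<in> L" for c v
      using that L fock.subspace_scale[of L "fscale c v" "1 / c"] by simp
  qed (use act gc_simps in metis)+
qed

end

text \<open>
  The sum of all \<open>h\<^sub>i\<close> acts as \<open>p\<close> on one space and as \<open>p'\<close> on the other.
\<close>

lemma inequivalent_c:
  assumes n: "n \<ge> 1" and q: "\<forall>k\<ge>1. exp (h / 2) ^ k \<noteq> 1" and st: "is_roots_c h s t"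
    and pp: "p \<noteq> p'" and \<pi>: "is_pi_c n m h s t (of_nat p) \<pi>" and \<pi>': "is_pi_c n m h s t (of_nat p') \<pi>'"
  shows "\<not> equivalent_reps (U_alg_c n m h) fscale
     (Fock0_c n m p) (\<lambda>a. Fock_act_c n m (\<pi> a)) (Fock0_c n m p') (\<lambda>a. Fock_act_c n m (\<pi>' a))"
proof
  let ?c = "\<Sum>i\<in>{1..n+m}. fgen (CH i)"
  let ?C = "cls (U_ideal_c n m h) ?c"
  assume "equivalent_reps (U_alg_c n m h) fscale
     (Fock0_c n m p) (\<lambda>a. Fock_act_c n m (\<pi> a)) (Fock0_c n m p') (\<lambda>a. Fock_act_c n m (\<pi>' a))"
  then obtain T where bij: "bij_betw T (Fock0_c n m p) (Fock0_c n m p')"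
    and Tsc: "\<And>c x. x \<in> Fock0_c n m p \<Longrightarrow> T (fscale c x) = fscale c (T x)"
    and Tact: "\<And>x. x \<in> Fock0_c n m p \<Longrightarrow> T (Fock_act_c n m (\<pi> ?C) x) = Fock_act_c n m (\<pi>' ?C) (T x)"
    unfolding equivalent_reps_def U_alg_c_def carrier_quot_alg[OF two_sided_U_c] by blast
  have C: "act_c n m (subst fconst (gen_c n m h s t (of_nat r)) ?c) v = fscale (of_nat r) v" for r v
  proof -
    have "subst fconst (gen_c n m h s t (of_nat r)) ?c = fconst (of_nat r)"
      using sum_pi_h[of n m "\<lambda>i. fgen (Cr i)" "\<lambda>i. fgen (An i)" "fconst (of_nat r)"] n
      by (simp add: Sc_simps[OF n q st] gen_c_def)
    then show ?thesis by (simp add: act_c_fconst)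
  qed
  obtain x where x: "x \<in> Fock0_c n m p" and Tx: "T x = ket (\<lambda>_. 0)"
    using bij ket_vacuum[OF n q st, of m p'] unfolding bij_betw_def by (metis imageE)
  have FS: "x \<in> FS n m" "T x \<in> FS n m"
    using x ket_vacuum[OF n q st, of m p'] Fock_subset_FS unfolding Tx by blast+
  have "fscale (of_nat p) (T x) = fscale (of_nat p') (T x)"
    using Tact[OF x] unfolding pi_c_act[OF n q st \<pi> FS(1)] pi_c_act[OF n q st \<pi>' FS(2)] C Tsc[OF x] .
  from arg_cong[OF this, of "\<lambda>v. Poly_Mapping.lookup v (\<lambda>_. 0)"] show False
    using pp unfolding Tx by (simp add: ket_def)
qed

section \<open>The Fock representation for formal q\<close>

lemma Fock0_h_eq: "Fock0_h n m p = {v. \<forall>k. v $ k \<in> fock.span (ket ` {l \<in> occ n m. (qtys n m l \<le> p) = True})}"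
  and Fock1_h_eq: "Fock1_h n m p = {v. \<forall>k. v $ k \<in> fock.span (ket ` {l \<in> occ n m. (qtys n m l \<le> p) = False})}"
  by (simp_all add: Fock0_h_def Fock1_h_def Fock0_c_eq Fock1_c_eq)

context
  fixes n m p :: nat and s t :: "complex \<Rightarrow> complex fps"
  assumes n: "n \<ge> 1" and st: "is_roots_h s t"
begin

interpretation fock_action fps_const "\<lambda>x. fps_exp (x/2)" qnum_h "fps_exp (1/2) + fps_exp (-1/2)" s t fscale_h n m p
    "act_h n m" "\<lambda>l. fps_const (ket l)" crd_h fn_h op_h "fconst_h (fps_const (of_nat p))" "Fock0_h n m p"
  by (rule fock_action_h[OF n st])

abbreviation (input) "gh \<equiv> gen_h n m s t (of_nat p)"
abbreviation (input) "Sh \<equiv> subst (\<lambda>c. fps_const (fconst c)) gh"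

lemma gh_simps:
  "i \<in> {1..n+m} \<Longrightarrow> gh (GH i) = hop i" "i \<in> {1..<n+m} \<Longrightarrow> gh (GE i) = eop i"
  "i \<in> {1..<n+m} \<Longrightarrow> gh (GF i) = fop i"
  by (simp_all add: gen_h_def)

lemma gh_out:
  "i \<notin> {1..n+m} \<Longrightarrow> gh (GH i) = 0" "i \<notin> {1..<n+m} \<Longrightarrow> gh (GE i) = 0"
  "i \<notin> {1..<n+m} \<Longrightarrow> gh (GF i) = 0"
  by (auto simp: gen_h_def)

text \<open>
  Each coefficient of the image of a generator leaves the subspace invariant, since the coefficients of a
  vanishing matrix element vanish.
\<close>

lemma gh_invariant_ket:
  assumes l: "l \<in> {l \<in> occ n m. (qtys n m l \<le> p) = b}"
  shows "act_c n m (gh g $ k) (ket l) \<in> fock.span (ket ` {l \<in> occ n m. (qtys n m l \<le> p) = b})" (is "_ \<in> ?M")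
proof -
  have sc: "fscale_h c (fps_const (ket l')) $ k \<in> ?M"
    if "c \<noteq> 0 \<Longrightarrow> l' \<in> occ n m \<and> (qtys n m l' \<le> p \<longleftrightarrow> qtys n m l \<le> p)" for c l'
  proof (cases "c = 0")
    case False
    then have "l' \<in> {l \<in> occ n m. (qtys n m l \<le> p) = b}" using that l by auto
    then have "fscale (c $ k) (ket l') \<in> ?M" by (intro fock.span_scale fock.span_base imageI)
    then show ?thesis by (simp only: fscale_h_const_nth)
  qed (simp add: fock.span_zero)
  have z: "act_c n m (0 $ k) (ket l) \<in> ?M" by (simp add: act_c_zero fock.span_zero)
  have o: "l \<in> occ n m" using l by simp
  show ?thesis
  proof (cases g)
    case (GH i)
    show ?thesis
    proof (cases "i \<in> {1..n+m}")
      case True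
      show ?thesis unfolding GH gh_simps(1)[OF True] act_h_const[symmetric] hop_kt[OF o True] by (intro sc) (use o in auto)
    qed (simp only: GH gh_out(1) z simp_thms)
  next
    case (GE i)
    show ?thesis
    proof (cases "i \<in> {1..<n+m}")
      case True
      show ?thesis unfolding GE gh_simps(2)[OF True] act_h_const[symmetric] eop_kt[OF o True]
        using ec_nonzero[OF o True] by (intro sc) blast
    qed (simp only: GE gh_out(2) z simp_thms)
  next
    case (GF i)
    show ?thesis
    proof (cases "i \<in> {1..<n+m}")
      case True
      show ?thesis unfolding GF gh_simps(3)[OF True] act_h_const[symmetric] fop_kt[OF o True]
        using fc_nonzero[OF o True] by (intro sc) blast
    qed (simp only: GF gh_out(3) z simp_thms)
  qed
qed

lemma Sh_invariant:
  assumes M: "M = fock.span (ket ` {l \<in> occ n m. (qtys n m l \<le> p) = b})" and v: "v \<in> M"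
  shows "act_c n m (Sh x $ k) v \<in> M"
  using v unfolding M
proof (induction x arbitrary: v k rule: free_alg_induct)
  case (const c)
  then show ?case by (auto simp: S_h_simps act_c_fconst act_c_zero fock.span_scale fock.span_zero)
next
  case (gen g)
  then show ?case unfolding S_h_simps by (intro span_act_c[OF gh_invariant_ket fock.subspace_span])
next
  case (mult a b)
  then show ?case by (auto simp: S_h_simps fps_mult_nth act_c_sum_left act_c_mult intro!: fock.span_sum)
qed (simp_all add: S_h_simps act_c_add_left fock.span_add)

lemma Th_invariant:
  assumes M: "M = {v. \<forall>k. v $ k \<in> fock.span (ket ` {l \<in> occ n m. (qtys n m l \<le> p) = b})}" and v: "v \<in> M"
  shows "act_h n m (ext Sh x) v \<in> M"
  using v unfolding M
  by (auto simp: act_h_def ext_def act_c_sum_left intro!: fock.span_sum Sh_invariant[OF refl])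

lemma pi_h_act:
  assumes \<pi>: "is_pi_h n m s t (of_nat p) \<pi>" and v: "\<And>k. v $ k \<in> FS n m"
  shows "Fock_act_h n m (\<pi> (cls (U_ideal_h n m) x)) v = act_h n m (ext Sh x) v"
  unfolding pi_h_determined[OF n st \<pi>] by (rule Fock_act_h_cls[OF v])

lemma Fock_h_FS: "M = Fock0_h n m p \<or> M = Fock1_h n m p \<Longrightarrow> v \<in> M \<Longrightarrow> v $ k \<in> FS n m"
  using Fock_subset_FS unfolding Fock0_h_def Fock1_h_def by blast

lemma rep_h:
  assumes \<pi>: "is_pi_h n m s t (of_nat p) \<pi>" and M: "M = Fock0_h n m p \<or> M = Fock1_h n m p"
  shows "rep_on (U_alg_h n m) fscale_h M (\<lambda>a. Fock_act_h n m (\<pi> a))"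
    "invariant (U_alg_h n m) (\<lambda>a. Fock_act_h n m (\<pi> a)) M"
proof -
  obtain b where b: "M = {v. \<forall>k. v $ k \<in> fock.span (ket ` {l \<in> occ n m. (qtys n m l \<le> p) = b})}"
    using M Fock0_h_eq Fock1_h_eq by blast
  note r = rep_on_quot[where A = "\<lambda>x. act_h n m (ext Sh x)" and k = fconst_h and I = "U_ideal_h n m" and M = M
      and sc = fscale_h and \<rho> = "\<lambda>a. Fock_act_h n m (\<pi> a)",
      OF two_sided_U_h _ pi_h_act[OF \<pi> Fock_h_FS[OF M]] Th_invariant[OF b]]
  have 1: "act_h n m (ext Sh 1) v = v" for v using act_h_fconst[of n m 1 v] by (simp add: T_h_simps fconst_h_simps)
  have sub: "v + w \<in> M" "fscale_h c v \<in> M" if "v \<in> M" "w \<in> M" for v w c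
    using that unfolding b by (auto simp: fscale_h_def intro!: fock.span_add fock.span_sum fock.span_scale)
  have "fock_h.subspace M"
    unfolding fock_h.subspace_def using sub by (auto simp: b fock.span_zero)
  note simps = this sub act_h_add_right act_h_add_left act_h_scale
        act_h_mult act_h_fconst T_h_simps(2,3) T_h_fconst 1
  show "rep_on (U_alg_h n m) fscale_h M (\<lambda>a. Fock_act_h n m (\<pi> a))"
    unfolding U_alg_h_def by (rule r(1)) (simp_all add: simps)
  show "invariant (U_alg_h n m) (\<lambda>a. Fock_act_h n m (\<pi> a)) M"
    unfolding U_alg_h_def by (rule r(2)) (simp_all add: simps)
qed

lemma fin_dim_h: "fin_dim fscale_h (Fock0_h n m p)"
proof -
  let ?B = "(\<lambda>l. fps_const (ket l)) ` low n m p"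
  have "fock_h.span ?B = Fock0_h n m p"
  proof
    show "fock_h.span ?B \<subseteq> Fock0_h n m p"
      by (rule fock_h.span_minimal[OF _ F0_subspace]) (auto intro: F0_kt)
    show "Fock0_h n m p \<subseteq> fock_h.span ?B"
    proof
      fix v assume "v \<in> Fock0_h n m p"
      from F0_expand[OF this] show "v \<in> fock_h.span ?B"
        by (rule ssubst) (intro fock_h.span_sum fock_h.span_scale fock_h.span_base imageI)
    qed
  qed
  then show ?thesis
    unfolding fin_dim_def by (intro exI[of _ ?B]) (auto simp: finite_low intro: F0_kt)
qed

lemma ket_vacuum_h: "fps_const (ket (\<lambda>_. 0)) \<in> Fock0_h n m p"
  by (rule F0_kt) (simp add: low_def occ_def qtys_def)

lemma irreducible_h:
  assumes \<pi>: "is_pi_h n m s t (of_nat p) \<pi>"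
  shows "irreducible_h (U_alg_h n m) (Fock0_h n m p) (\<lambda>a. Fock_act_h n m (\<pi> a))"
  unfolding irreducible_h_def
proof (intro conjI allI impI)
  have "fps_const (ket (\<lambda>_. 0)) \<noteq> 0" using crd_kt[of "\<lambda>_. 0" "\<lambda>_. 0"] crd_scale[of "\<lambda>_. 0" 0 0] by auto
  then show "Fock0_h n m p \<noteq> {0}" using ket_vacuum_h by blast
  fix L assume L: "fock_h.subspace L \<and> L \<subseteq> Fock0_h n m p \<and> invariant (U_alg_h n m) (\<lambda>a. Fock_act_h n m (\<pi> a)) L \<and>
      (\<forall>v\<in>Fock0_h n m p. fscale_h fps_X v \<in> L \<longrightarrow> v \<in> L)"
  have act: "act_h n m (gh g) v \<in> L" if v: "v \<in> L" for g v
  proof -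
    have "v $ k \<in> FS n m" for k using v L Fock_h_FS by blast
    moreover have "cls (U_ideal_h n m) (fgen_h g) \<in> carrier (U_alg_h n m)"
      by (simp add: U_alg_h_def carrier_quot_alg[OF two_sided_U_h])
    ultimately show ?thesis
      using L v pi_h_act[OF \<pi>, of v "fgen_h g"] unfolding invariant_def T_h_gen by metis
  qed
  show "L = {0} \<or> L = Fock0_h n m p"
  proof (rule irreducible)
    show "fock_h.subspace L" "L \<subseteq> Fock0_h n m p" using L by auto
    \<comment> \<open>a nonzero power series is a unit times a power of \<open>h\<close>\<close>
    show "v \<in> L" if c: "c \<noteq> 0" and v: "v \<in> Fock0_h n m p" and cv: "fscale_h c v \<in> L" for c v
    proof -
      let ?d = "subdegree c"
      have pow: "v \<in> L" if "fscale_h (fps_X ^ k) v \<in> L" for k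
        using that
      proof (induction k)
        case (Suc k)
        have "fscale_h (fps_X ^ k) v \<in> Fock0_h n m p"
          using v F0_subspace by (rule fock_h.subspace_scale[rotated])
        moreover have "fscale_h fps_X (fscale_h (fps_X ^ k) v) \<in> L" using Suc.prems by simp
        ultimately show ?case using L Suc.IH by blast
      qed simp
      have "c = unit_factor c * fps_X ^ ?d" using c by (simp add: subdegree_decompose[symmetric])
      moreover have "unit_factor c $ 0 \<noteq> 0" using c by simp
      ultimately have eq: "inverse (unit_factor c) * c = fps_X ^ ?d"
        by (metis inverse_mult_eq_1 mult.assoc mult_1)
      have "fscale_h (inverse (unit_factor c)) (fscale_h c v) \<in> L"
        using L cv fock_h.subspace_scale by blast
      then have "fscale_h (fps_X ^ ?d) v \<in> L" by (simp only: fock_h.scale_scale eq)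
      then show ?thesis by (rule pow)
    qed
  qed (use act gh_simps in metis)+
qed

end

lemma inequivalent_h:
  assumes n: "n \<ge> 1" and st: "is_roots_h s t"
    and pp: "p \<noteq> p'" and \<pi>: "is_pi_h n m s t (of_nat p) \<pi>" and \<pi>': "is_pi_h n m s t (of_nat p') \<pi>'"
  shows "\<not> equivalent_reps (U_alg_h n m) fscale_h
     (Fock0_h n m p) (\<lambda>a. Fock_act_h n m (\<pi> a)) (Fock0_h n m p') (\<lambda>a. Fock_act_h n m (\<pi>' a))"
proof
  let ?c = "\<Sum>i\<in>{1..n+m}. fgen_h (GH i)"
  let ?C = "cls (U_ideal_h n m) ?c"
  assume "equivalent_reps (U_alg_h n m) fscale_h
     (Fock0_h n m p) (\<lambda>a. Fock_act_h n m (\<pi> a)) (Fock0_h n m p') (\<lambda>a. Fock_act_h n m (\<pi>' a))"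
  then obtain T where bij: "bij_betw T (Fock0_h n m p) (Fock0_h n m p')"
    and Tsc: "\<And>c x. x \<in> Fock0_h n m p \<Longrightarrow> T (fscale_h c x) = fscale_h c (T x)"
    and Tact: "\<And>x. x \<in> Fock0_h n m p \<Longrightarrow> T (Fock_act_h n m (\<pi> ?C) x) = Fock_act_h n m (\<pi>' ?C) (T x)"
    unfolding equivalent_reps_def U_alg_h_def carrier_quot_alg[OF two_sided_U_h] by blast
  have C: "act_h n m (ext (subst (\<lambda>c. fps_const (fconst c)) (gen_h n m s t (of_nat r))) ?c) v = fscale_h (fps_const (of_nat r)) v" for r v
  proof -
    have "ext (subst (\<lambda>c. fps_const (fconst c)) (gen_h n m s t (of_nat r))) ?c =
        (\<Sum>i\<in>{1..n+m}. gen_h n m s t (of_nat r) (GH i))"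
      by (simp only: T_h_simps(8) T_h_gen)
    also have "\<dots> = fconst_h (fps_const (of_nat r))"
      using sum_pi_h[of n m "\<lambda>i. fgen_h (Cr i)" "\<lambda>i. fgen_h (An i)" "fconst_h (fps_const (of_nat r))"] n
      by (simp add: gen_h_def)
    finally show ?thesis by (simp only: act_h_fconst)
  qed
  obtain x where x: "x \<in> Fock0_h n m p" and Tx: "T x = fps_const (ket (\<lambda>_. 0))"
    using bij ket_vacuum_h[OF n st, of m p'] unfolding bij_betw_def by (metis imageE)
  have FS: "x $ k \<in> FS n m" "T x $ k \<in> FS n m" for k
    using x ket_vacuum_h[OF n st, of m p'] Fock_h_FS[OF n st] unfolding Tx by blast+
  have "fscale_h (fps_const (of_nat p)) (T x) = fscale_h (fps_const (of_nat p')) (T x)"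
    using Tact[OF x] unfolding pi_h_act[OF n st \<pi> FS(1)] pi_h_act[OF n st \<pi>' FS(2)] C Tsc[OF x] .
  from arg_cong[OF this, of "\<lambda>v. Poly_Mapping.lookup (v $ 0) (\<lambda>_. 0)"] show False
    using pp unfolding Tx by (simp add: ket_def fscale_h_def)
qed

section \<open>The anti-involution\<close>

fun swap :: "cgen \<Rightarrow> cgen" where
  "swap (CE i) = CF i"
| "swap (CF i) = CE i"
| "swap g = g"

lemma swap_swap [simp]: "swap (swap g) = g"
  by (cases g) simp_all

text \<open>
  The anti-involution of the free algebra: words are reversed, \<open>e\<^sub>i\<close> and \<open>f\<^sub>i\<close> are exchanged, and scalars are
  conjugated.
\<close>

definition anti :: "cgen free_alg \<Rightarrow> cgen free_alg" where
  "anti a = (\<Sum>w\<in>Poly_Mapping.keys a. Poly_Mapping.single (rev (map swap w)) (cnj (Poly_Mapping.lookup a w)))"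

lemma anti_single: "anti (Poly_Mapping.single w c) = Poly_Mapping.single (rev (map swap w)) (cnj c)"
  by (simp add: anti_def)

lemma anti_add: "anti (a + b) = anti a + anti b"
  unfolding anti_def by (rule keys_sum_add) (simp_all add: single_add)

lemma anti_mult: "anti (a * b) = anti b * anti a"
proof (induction a rule: poly_mapping_single_induct)
  case (1 u c)
  show ?case
  proof (induction b rule: poly_mapping_single_induct)
    case (1 w d)
    then show ?case by (simp add: mult_single plus_list_def anti_single mult.commute)
  qed (simp add: distrib_left distrib_right anti_add)
qed (simp add: distrib_left distrib_right anti_add)

lemma anti_fconst: "anti (fconst c) = fconst (cnj c)"
  by (simp add: fconst_def anti_single)

lemma anti_fgen: "anti (fgen g) = fgen (swap g)"
  by (simp add: fgen_def anti_single)

lemma anti_zero: "anti 0 = 0"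
  by (simp add: anti_def)

lemma anti_minus: "anti (- a) = - anti a"
  using anti_add[of a "- a"] by (simp add: anti_zero eq_neg_iff_add_eq_0 add.commute)

lemma anti_diff: "anti (a - b) = anti a - anti b"
  using anti_add[of a "- b"] by (simp add: anti_minus)

lemma anti_one: "anti 1 = 1"
  using anti_fconst[of 1] by (simp add: fconst_simps)

lemma anti_anti: "anti (anti a) = a"
  by (induction a rule: poly_mapping_single_induct) (simp_all add: anti_single anti_add rev_map comp_def)

lemmas anti_simps = anti_add anti_mult anti_diff anti_minus anti_one anti_zero anti_fconst anti_fgen

lemma two_sided_anti_vimage: "two_sided I \<Longrightarrow> two_sided (anti -` I)"
  by (auto simp: two_sided_def anti_simps)

text \<open>
  All Serre relations are symmetric under reversal of words except the one of degree four, whose last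
  term is preserved only up to the commutator of \<open>e\<^sub>n\<^sub>-\<^sub>1\<close> and \<open>e\<^sub>n\<^sub>+\<^sub>1\<close>.
\<close>

lemma serre_rels_anti:
  assumes I: "two_sided I" and z': "serre_rels n m (fconst k) z' \<subseteq> I"
    and z: "\<And>i. anti (z i) = z' i" and k: "cnj k = k" and r: "r \<in> serre_rels n m (fconst k) z"
  shows "anti r \<in> I"
proof -
  have K: "x * fconst k = fconst k * x" for x :: "cgen free_alg" by (rule fconst_central[symmetric])
  have comm: "z' i * z' j - z' j * z' i \<in> I"
    if "i \<in> {1..<n+m}" "j \<in> {1..<n+m}" "i \<noteq> j + 1" "j \<noteq> i + 1" for i j
    using that by (intro subsetD[OF z']) (unfold serre_rels_def, blast)
  show ?thesis
    using r unfolding serre_rels_def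
  proof (elim UnE)
    assume "r \<in> {z i * z j - z j * z i |i j. i \<in> {1..<n + m} \<and> j \<in> {1..<n + m} \<and> i \<noteq> j + 1 \<and> j \<noteq> i + 1}"
    then obtain i j where ij: "i \<in> {1..<n+m}" "j \<in> {1..<n+m}" "i \<noteq> j + 1" "j \<noteq> i + 1" and r: "r = z i * z j - z j * z i" by blast
    show ?thesis using comm[OF ij(2,1,4,3)] by (simp only: r anti_simps z)
  next
    assume "r \<in> {z n ^ 2 |_::unit. n \<in> {1..<n+m}}"
    then have n: "n \<in> {1..<n+m}" and r: "r = z n ^ 2" by auto
    have "z' n ^ 2 \<in> I" using n by (intro subsetD[OF z']) (unfold serre_rels_def, blast)
    then show ?thesis by (simp only: r anti_simps z power2_eq_square)
  next
    assume "r \<in> {z i ^ 2 * z (i+1) - fconst k * (z i * z (i+1) * z i) + z (i+1) * z i ^ 2 | i.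
        i \<in> {1..<n+m} \<and> i + 1 \<in> {1..<n+m} \<and> i \<noteq> n}"
    then obtain i where i: "i \<in> {1..<n+m}" "i + 1 \<in> {1..<n+m}" "i \<noteq> n"
      and r: "r = z i ^ 2 * z (i+1) - fconst k * (z i * z (i+1) * z i) + z (i+1) * z i ^ 2" by blast
    have "z' i ^ 2 * z' (i+1) - fconst k * (z' i * z' (i+1) * z' i) + z' (i+1) * z' i ^ 2 \<in> I"
      using i by (intro subsetD[OF z']) (unfold serre_rels_def, blast)
    moreover have "anti r = z' i ^ 2 * z' (i+1) - fconst k * (z' i * z' (i+1) * z' i) + z' (i+1) * z' i ^ 2"
      unfolding r anti_simps z power2_eq_square k K by (simp add: mult.assoc)
    ultimately show ?thesis by (simp only:)
  next
    assume "r \<in> {z (i+1) ^ 2 * z i - fconst k * (z (i+1) * z i * z (i+1)) + z i * z (i+1) ^ 2 | i.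
        i \<in> {1..<n+m} \<and> i + 1 \<in> {1..<n+m} \<and> i + 1 \<noteq> n}"
    then obtain i where i: "i \<in> {1..<n+m}" "i + 1 \<in> {1..<n+m}" "i + 1 \<noteq> n"
      and r: "r = z (i+1) ^ 2 * z i - fconst k * (z (i+1) * z i * z (i+1)) + z i * z (i+1) ^ 2" by blast
    have "z' (i+1) ^ 2 * z' i - fconst k * (z' (i+1) * z' i * z' (i+1)) + z' i * z' (i+1) ^ 2 \<in> I"
      using i by (intro subsetD[OF z']) (unfold serre_rels_def, blast)
    moreover have "anti r = z' (i+1) ^ 2 * z' i - fconst k * (z' (i+1) * z' i * z' (i+1)) + z' i * z' (i+1) ^ 2"
      unfolding r anti_simps z power2_eq_square k K by (simp add: mult.assoc)
    ultimately show ?thesis by (simp only:)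
  next
    assume "r \<in> {z n * z (n-1) * z n * z (n+1) + z (n-1) * z n * z (n+1) * z n
        + z n * z (n+1) * z n * z (n-1) + z (n+1) * z n * z (n-1) * z n
        - fconst k * (z n * z (n-1) * z (n+1) * z n) | _::unit. n - 1 \<in> {1..<n+m} \<and> n + 1 \<in> {1..<n+m}}"
    then have n: "n - 1 \<in> {1..<n+m}" "n + 1 \<in> {1..<n+m}"
      and r: "r = z n * z (n-1) * z n * z (n+1) + z (n-1) * z n * z (n+1) * z n
        + z n * z (n+1) * z n * z (n-1) + z (n+1) * z n * z (n-1) * z n
        - fconst k * (z n * z (n-1) * z (n+1) * z n)" by auto
    let ?r = "z' n * z' (n-1) * z' n * z' (n+1) + z' (n-1) * z' n * z' (n+1) * z' n
        + z' n * z' (n+1) * z' n * z' (n-1) + z' (n+1) * z' n * z' (n-1) * z' n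
        - fconst k * (z' n * z' (n-1) * z' (n+1) * z' n)"
    have "?r \<in> I" using n by (intro subsetD[OF z']) (unfold serre_rels_def, blast)
    moreover have "fconst k * (z' n * (z' (n-1) * z' (n+1) - z' (n+1) * z' (n-1)) * z' n) \<in> I"
    proof -
      have "n - 1 \<noteq> n + 1 + 1" "n + 1 \<noteq> n - 1 + 1" using n by auto
      from comm[OF n this] show ?thesis by (rule two_sided_left[OF I two_sided_right[OF I two_sided_left[OF I]]])
    qed
    moreover have "anti r = ?r + fconst k * (z' n * (z' (n-1) * z' (n+1) - z' (n+1) * z' (n-1)) * z' n)"
      unfolding r anti_simps z k K by (simp add: mult.assoc algebra_simps)
    ultimately show ?thesis by (simp only: two_sided_add[OF I])
  qed
qed

text \<open>
  The right-hand sides \<open>c i\<close> are preserved only modulo \<open>I\<close>, since reversal changes the order of the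
  powers of \<open>q\<close> in them.
\<close>

lemma gl_rels_anti:
  assumes I: "two_sided I" and gl: "gl_rels n m (fconst k) c h e f \<subseteq> I"
    and h: "\<And>i. anti (h i) = h i" and e: "\<And>i. anti (e i) = f i" and f: "\<And>i. anti (f i) = e i"
    and c: "\<And>i. i \<in> {1..<n+m} \<Longrightarrow> anti (c i) - c i \<in> I"
    and k: "cnj k = k" and r: "r \<in> gl_rels n m (fconst k) c h e f"
  shows "anti r \<in> I"
proof -
  have H: "(of_bool P - of_bool Q :: cgen free_alg) * x = x * (of_bool P - of_bool Q)" for P Q x
    by (cases P; cases Q) simp_all
  have aH: "anti (of_bool P :: cgen free_alg) = of_bool P" for P by (cases P) (simp_all add: anti_simps)
  have gl1: "serre_rels n m (fconst k) e \<subseteq> I" "serre_rels n m (fconst k) f \<subseteq> I"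
    using gl unfolding gl_rels_def by blast+
  have he: "h i * e j - e j * h i - (of_bool (i = j) - of_bool (i = j + 1)) * e j \<in> I"
    "h i * f j - f j * h i - (- of_bool (i = j) + of_bool (i = j + 1)) * f j \<in> I"
    if "i \<in> {1..n+m}" "j \<in> {1..<n+m}" for i j
    using that by (intro subsetD[OF gl]; unfold gl_rels_def; blast)+
  have ef: "e i * f i - f i * e i - c i \<in> I" if "i \<in> {1..<n+m}" "i \<noteq> n" for i
    using that by (intro subsetD[OF gl]; unfold gl_rels_def; blast)
  have ef': "e i * f i + f i * e i - c i \<in> I" if "i \<in> {1..<n+m}" "i = n" for i
    using that by (intro subsetD[OF gl]; unfold gl_rels_def; blast)
  show ?thesis
    using r unfolding gl_rels_def
  proof (elim UnE)
    assume "r \<in> serre_rels n m (fconst k) e"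
    then show ?thesis by (rule serre_rels_anti[OF I gl1(2) e k])
  next
    assume "r \<in> serre_rels n m (fconst k) f"
    then show ?thesis by (rule serre_rels_anti[OF I gl1(1) f k])
  next
    assume "r \<in> {h i | i. i \<notin> {1..n+m}}"
    then obtain i where i: "i \<notin> {1..n+m}" and r: "r = h i" by blast
    show ?thesis using subsetD[OF gl gl_rels_out(1)[OF i]] by (simp only: r h)
  next
    assume "r \<in> {e i | i. i \<notin> {1..<n+m}}"
    then obtain i where i: "i \<notin> {1..<n+m}" and r: "r = e i" by blast
    show ?thesis using subsetD[OF gl gl_rels_out(3)[OF i]] by (simp only: r e)
  next
    assume "r \<in> {f i | i. i \<notin> {1..<n+m}}"
    then obtain i where i: "i \<notin> {1..<n+m}" and r: "r = f i" by blast
    show ?thesis using subsetD[OF gl gl_rels_out(2)[OF i]] by (simp only: r f)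
  next
    assume "r \<in> {h i * h j - h j * h i | i j. i \<in> {1..n+m} \<and> j \<in> {1..n+m}}"
    then obtain i j where ij: "i \<in> {1..n+m}" "j \<in> {1..n+m}" and r: "r = h i * h j - h j * h i" by blast
    have "h j * h i - h i * h j \<in> I" using ij by (intro subsetD[OF gl]; unfold gl_rels_def; blast)
    then show ?thesis by (simp only: r anti_simps h)
  next
    assume "r \<in> {h i * e j - e j * h i - (of_bool (i = j) - of_bool (i = j + 1)) * e j | i j.
        i \<in> {1..n+m} \<and> j \<in> {1..<n+m}}"
    then obtain i j where ij: "i \<in> {1..n+m}" "j \<in> {1..<n+m}"
      and r: "r = h i * e j - e j * h i - (of_bool (i = j) - of_bool (i = j + 1)) * e j" by blast
    have "anti r = - (h i * f j - f j * h i - (- of_bool (i = j) + of_bool (i = j + 1)) * f j)"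
      unfolding r anti_simps h e aH H[symmetric] by (simp add: algebra_simps)
    then show ?thesis using two_sided_minus[OF I he(2)[OF ij]] by (simp only:)
  next
    assume "r \<in> {h i * f j - f j * h i - (- of_bool (i = j) + of_bool (i = j + 1)) * f j | i j.
        i \<in> {1..n+m} \<and> j \<in> {1..<n+m}}"
    then obtain i j where ij: "i \<in> {1..n+m}" "j \<in> {1..<n+m}"
      and r: "r = h i * f j - f j * h i - (- of_bool (i = j) + of_bool (i = j + 1)) * f j" by blast
    have "r = h i * f j - f j * h i - (of_bool (i = j + 1) - of_bool (i = j)) * f j"
      by (simp add: r)
    then have "anti r = - (h i * e j - e j * h i - (of_bool (i = j) - of_bool (i = j + 1)) * e j)"
      by (simp only: anti_simps h f aH H[symmetric]) (simp add: algebra_simps)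
    then show ?thesis using two_sided_minus[OF I he(1)[OF ij]] by (simp only:)
  next
    assume "r \<in> {e i * f j - f j * e i | i j. i \<in> {1..<n+m} \<and> j \<in> {1..<n+m} \<and> i \<noteq> j}"
    then obtain i j where ij: "i \<in> {1..<n+m}" "j \<in> {1..<n+m}" "i \<noteq> j" and r: "r = e i * f j - f j * e i" by blast
    have "e j * f i - f i * e j \<in> I" using ij by (intro subsetD[OF gl]; unfold gl_rels_def; blast)
    then show ?thesis by (simp only: r anti_simps e f)
  next
    assume "r \<in> {e i * f i - f i * e i - c i | i. i \<in> {1..<n+m} \<and> i \<noteq> n}"
    then obtain i where i: "i \<in> {1..<n+m}" "i \<noteq> n" and r: "r = e i * f i - f i * e i - c i" by blast
    have "anti r = (e i * f i - f i * e i - c i) - (anti (c i) - c i)" by (simp add: r anti_simps e f)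
    then show ?thesis using two_sided_diff[OF I ef[OF i] c[OF i(1)]] by (simp only:)
  next
    assume "r \<in> {e i * f i + f i * e i - c i | i. i \<in> {1..<n+m} \<and> i = n}"
    then obtain i where i: "i \<in> {1..<n+m}" "i = n" and r: "r = e i * f i + f i * e i - c i" by blast
    have "anti r = (e i * f i + f i * e i - c i) - (anti (c i) - c i)" by (simp add: r anti_simps e f)
    then show ?thesis using two_sided_diff[OF I ef'[OF i] c[OF i(1)]] by (simp only:)
  qed
qed

text \<open>
  The element \<open>u\<close> is the image of the unit of a quotient algebra in the product of quotients.
\<close>

lemma commute_with_inverse:
  fixes a b :: "'a::ring"
  assumes "p * b = u" "b * p = u" "a * b = b * a" "u * a = a" "a * u = a" "u * p = p" "p * u = p"
  shows "p * a = a * p"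
proof -
  have "p * a = p * (a * (b * p))" using assms(2,5) by simp
  also have "\<dots> = p * (a * b) * p" by (simp only: mult.assoc)
  also have "\<dots> = (p * b) * (a * p)" unfolding assms(3) by (simp only: mult.assoc)
  also have "\<dots> = a * p" using assms(1,4) by (simp flip: mult.assoc)
  finally show ?thesis .
qed

lemma exp_Reals: "z \<in> \<real> \<Longrightarrow> exp z \<in> \<real>" for z :: complex
  by (elim Reals_cases) (simp flip: exp_of_real)

lemma U_ideal_c_anti:
  assumes h: "h \<in> \<real>" and x: "x \<in> U_ideal_c n m h" shows "anti x \<in> U_ideal_c n m h"
proof -
  let ?I = "U_ideal_c n m h" and ?q = "exp (h / 2)" and ?k = "exp (h/2) + exp (-h/2)" and ?r = "1 / (exp (h/2) - exp (-h/2))"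
  let ?c = "\<lambda>i. fconst ?r * (if i \<noteq> n then fgen (CQ i) * fgen (CQi (i+1)) - fgen (CQi i) * fgen (CQ (i+1))
              else fgen (CQ i) * fgen (CQ (i+1)) - fgen (CQi i) * fgen (CQi (i+1))) :: cgen free_alg"
  let ?G = "gl_rels n m (fconst ?k) ?c (\<lambda>i. fgen (CH i)) (\<lambda>i. fgen (CE i)) (\<lambda>i. fgen (CF i))"
  note I = two_sided_U_c[of n m h]
  have cnj: "cnj (exp (h / 2)) = exp (h / 2)" "cnj (exp (- h / 2)) = exp (- h / 2)"
    using exp_Reals[of "h / 2"] exp_Reals[of "- h / 2"] h by (simp_all only: Reals_cnj_iff[symmetric] Reals_divide Reals_minus Reals_numeral)
  have U: "?I = genideal type_ring (?G \<union> q_rels n m ?q)" by (simp only: U_ideal_c_def)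
  have gl: "?G \<subseteq> ?I" and q: "q_rels n m ?q \<subseteq> ?I"
    unfolding U using genideal_incl by blast+
  let ?e = "\<lambda>x. emb ?I x"
  let ?Q = "\<lambda>i. ?e (fgen (CQ i))" and ?P = "\<lambda>i. ?e (fgen (CQi i))"
  have rel: "?e a = ?e b" if "a - b \<in> q_rels n m ?q" for a b
    using that q by (auto simp: emb_eq_iff[OF I])
  have inv: "?Q i * ?P i = ?e 1" "?P i * ?Q i = ?e 1" if "i \<in> {1..n+m}" for i
    unfolding emb_mult[symmetric] by (rule rel, unfold q_rels_def, use that in blast)+
  have QQ: "?Q i * ?Q j = ?Q j * ?Q i" if "i \<in> {1..n+m}" "j \<in> {1..n+m}" for i j
    unfolding emb_mult[symmetric] by (rule rel, unfold q_rels_def, use that in blast)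
  have one: "?e 1 * ?e a = ?e a" "?e a * ?e 1 = ?e a" for a by (simp_all flip: emb_mult)
  have PQ: "?P j * ?Q i = ?Q i * ?P j" if "i \<in> {1..n+m}" "j \<in> {1..n+m}" for i j
    by (rule commute_with_inverse[OF inv(2,1)[OF that(2)] QQ[OF that] one one])
  have PP: "?P j * ?P i = ?P i * ?P j" if "i \<in> {1..n+m}" "j \<in> {1..n+m}" for i j
    by (rule commute_with_inverse[OF inv(2,1)[OF that(2)] PQ[OF that(2,1)] one one])
  have c: "anti (?c i) - ?c i \<in> ?I" if i: "i \<in> {1..<n+m}" for i
  proof -
    have i': "i \<in> {1..n+m}" "i + 1 \<in> {1..n+m}" using i by auto
    have cr: "cnj ?r = ?r" by (simp only: cnj complex_cnj_divide complex_cnj_diff complex_cnj_one)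
    note comm = PQ[OF i'] PQ[OF i'(2,1)] PP[OF i'] QQ[OF i']
    have "anti (?c i) = fconst ?r * (if i \<noteq> n then fgen (CQi (i+1)) * fgen (CQ i) - fgen (CQ (i+1)) * fgen (CQi i)
              else fgen (CQ (i+1)) * fgen (CQ i) - fgen (CQi (i+1)) * fgen (CQi i))"
      by (cases "i = n") (simp_all only: simp_thms if_True if_False anti_simps cr fconst_central[symmetric] swap.simps)
    then have "?e (anti (?c i)) = ?e (?c i)"
      using comm by (cases "i \<noteq> n") (simp_all only: simp_thms if_True if_False emb_mult emb_diff)
    then show ?thesis by (simp only: emb_eq_iff[OF I])
  qed
  have powi: "cnj (?q powi j) = ?q powi j" for j
    by (simp add: cnj complex_cnj_power_int)
  have q_anti: "anti r \<in> ?I" if r: "r \<in> q_rels n m ?q" for r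
  proof -
    have QE: "fgen (CQ i) * fgen (CE j) - fconst (?q powi (of_bool (i = j) - of_bool (i = j + 1))) * fgen (CE j) * fgen (CQ i) \<in> ?I"
      "fgen (CQ i) * fgen (CF j) - fconst (?q powi (- of_bool (i = j) + of_bool (i = j + 1))) * fgen (CF j) * fgen (CQ i) \<in> ?I"
      if "i \<in> {1..n+m}" "j \<in> {1..<n+m}" for i j
      using that by (intro subsetD[OF q]; unfold q_rels_def; blast)+
    \<comment> \<open>the anti-image of one of these relations is a multiple of the other one\<close>
    have flip: "y * x - x * (y * fconst a) = - (fconst a * (x * y - fconst b * y * x))"
      if "a * b = 1" for x y :: "cgen free_alg" and a b
    proof -
      have "fconst a * (fconst b * (y * x)) = y * x"
        using that by (simp flip: mult.assoc fconst_simps(3)) (simp add: fconst_simps)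
      moreover have "x * (y * fconst a) = fconst a * (x * y)" by (simp only: fconst_central[of a] mult.assoc)
      ultimately show ?thesis by (simp add: algebra_simps)
    qed
    have ab: "?q powi j * ?q powi (- j) = 1" for j by (simp add: power_int_minus)
    show ?thesis
      using r unfolding q_rels_def
    proof (elim UnE)
      assume "r \<in> {fgen (CQ i) * fgen (CE j)
        - fconst (?q powi (of_bool (i = j) - of_bool (i = j + 1))) * fgen (CE j) * fgen (CQ i) | i j.
        i \<in> {1..n+m} \<and> j \<in> {1..<n+m}}"
      then obtain i j where ij: "i \<in> {1..n+m}" "j \<in> {1..<n+m}" and r: "r = fgen (CQ i) * fgen (CE j)
        - fconst (?q powi (of_bool (i = j) - of_bool (i = j + 1))) * fgen (CE j) * fgen (CQ i)" by blast
      let ?d = "of_bool (i = j) - of_bool (i = j + 1) :: int"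
      have "anti r = fgen (CF j) * fgen (CQ i) - fgen (CQ i) * (fgen (CF j) * fconst (?q powi ?d))"
        by (simp only: r anti_simps swap.simps powi)
      also have "\<dots> = - (fconst (?q powi ?d) * (fgen (CQ i) * fgen (CF j) - fconst (?q powi (- ?d)) * fgen (CF j) * fgen (CQ i)))"
        by (rule flip[OF ab])
      also have "\<dots> \<in> ?I"
        using QE(2)[OF ij] by (intro two_sided_minus[OF I] two_sided_left[OF I]) simp
      finally show ?thesis .
    next
      assume "r \<in> {fgen (CQ i) * fgen (CF j)
        - fconst (?q powi (- of_bool (i = j) + of_bool (i = j + 1))) * fgen (CF j) * fgen (CQ i) | i j.
        i \<in> {1..n+m} \<and> j \<in> {1..<n+m}}"
      then obtain i j where ij: "i \<in> {1..n+m}" "j \<in> {1..<n+m}" and r: "r = fgen (CQ i) * fgen (CF j)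
        - fconst (?q powi (- of_bool (i = j) + of_bool (i = j + 1))) * fgen (CF j) * fgen (CQ i)" by blast
      let ?d = "- of_bool (i = j) + of_bool (i = j + 1) :: int"
      have "anti r = fgen (CE j) * fgen (CQ i) - fgen (CQ i) * (fgen (CE j) * fconst (?q powi ?d))"
        by (simp only: r anti_simps swap.simps powi)
      also have "\<dots> = - (fconst (?q powi ?d) * (fgen (CQ i) * fgen (CE j) - fconst (?q powi (- ?d)) * fgen (CE j) * fgen (CQ i)))"
        by (rule flip[OF ab])
      also have "\<dots> \<in> ?I"
        using QE(1)[OF ij] by (intro two_sided_minus[OF I] two_sided_left[OF I]) simp
      finally show ?thesis .
    next
      assume "r \<in> {fgen (CQ i) * fgen (CH j) - fgen (CH j) * fgen (CQ i) | i j. i \<in> {1..n+m} \<and> j \<in> {1..n+m}}"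
      then obtain i j where ij: "i \<in> {1..n+m}" "j \<in> {1..n+m}" and r: "r = fgen (CQ i) * fgen (CH j) - fgen (CH j) * fgen (CQ i)" by blast
      have "fgen (CQ i) * fgen (CH j) - fgen (CH j) * fgen (CQ i) \<in> ?I"
        using ij by (intro subsetD[OF q]; unfold q_rels_def; blast)
      moreover have "anti r = - (fgen (CQ i) * fgen (CH j) - fgen (CH j) * fgen (CQ i))"
        by (simp only: r anti_simps swap.simps minus_diff_eq)
      ultimately show ?thesis using two_sided_minus[OF I] by (simp only:)
    next
      assume "r \<in> {fgen (CQ i) * fgen (CQ j) - fgen (CQ j) * fgen (CQ i) | i j. i \<in> {1..n+m} \<and> j \<in> {1..n+m}}"
      then obtain i j where ij: "i \<in> {1..n+m}" "j \<in> {1..n+m}" and r: "r = fgen (CQ i) * fgen (CQ j) - fgen (CQ j) * fgen (CQ i)" by blast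
      have "fgen (CQ j) * fgen (CQ i) - fgen (CQ i) * fgen (CQ j) \<in> ?I"
        using ij by (intro subsetD[OF q]; unfold q_rels_def; blast)
      then show ?thesis by (simp only: r anti_simps swap.simps)
    next
      assume "r \<in> {fgen (CQ i) * fgen (CQi i) - 1 | i. i \<in> {1..n+m}}"
      then obtain i where i: "i \<in> {1..n+m}" and r: "r = fgen (CQ i) * fgen (CQi i) - 1" by blast
      have "fgen (CQi i) * fgen (CQ i) - 1 \<in> ?I"
        using i by (intro subsetD[OF q]; unfold q_rels_def; blast)
      then show ?thesis by (simp only: r anti_simps swap.simps)
    next
      assume "r \<in> {fgen (CQi i) * fgen (CQ i) - 1 | i. i \<in> {1..n+m}}"
      then obtain i where i: "i \<in> {1..n+m}" and r: "r = fgen (CQi i) * fgen (CQ i) - 1" by blast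
      have "fgen (CQ i) * fgen (CQi i) - 1 \<in> ?I"
        using i by (intro subsetD[OF q]; unfold q_rels_def; blast)
      then show ?thesis by (simp only: r anti_simps swap.simps)
    next
      assume "r \<in> {fgen (CQ i) | i. i \<notin> {1..n+m}}"
      then obtain i where i: "i \<notin> {1..n+m}" and r: "r = fgen (CQ i)" by blast
      show ?thesis using subsetD[OF q q_rels_out(1)[OF i]] by (simp only: r anti_simps swap.simps)
    next
      assume "r \<in> {fgen (CQi i) | i. i \<notin> {1..n+m}}"
      then obtain i where i: "i \<notin> {1..n+m}" and r: "r = fgen (CQi i)" by blast
      show ?thesis using subsetD[OF q q_rels_out(2)[OF i]] by (simp only: r anti_simps swap.simps)
    qed
  qed
  have "?I \<subseteq> anti -` ?I"
    unfolding U
  proof (rule genideal_minimal', unfold U[symmetric])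
    show "two_sided (anti -` ?I)" by (rule two_sided_anti_vimage[OF I])
    have "anti r \<in> ?I" if "r \<in> ?G" for r
      by (rule gl_rels_anti[OF I gl _ _ _ c _ that]) (simp_all only: anti_fgen swap.simps cnj complex_cnj_add)
    then show "?G \<union> q_rels n m ?q \<subseteq> anti -` ?I" using q_anti by blast
  qed
  then show ?thesis using x by blast
qed

definition omega :: "nat \<Rightarrow> nat \<Rightarrow> complex \<Rightarrow> cgen free_alg set \<Rightarrow> cgen free_alg set" where
  "omega n m h X = cls (U_ideal_c n m h) (anti (SOME x. cls (U_ideal_c n m h) x = X))"

lemma omega_cls:
  assumes h: "h \<in> \<real>"
  shows "omega n m h (cls (U_ideal_c n m h) x) = cls (U_ideal_c n m h) (anti x)"
proof -
  let ?I = "U_ideal_c n m h"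
  have "cls ?I (SOME y. cls ?I y = cls ?I x) = cls ?I x" by (rule someI[of _ x]) simp
  then show ?thesis
    using U_ideal_c_anti[OF h] unfolding omega_def cls_eq_iff[OF two_sided_U_c] anti_diff[symmetric] by blast
qed

lemma is_omega_omega: assumes h: "h \<in> \<real>" shows "is_omega n m h (omega n m h)"
proof -
  note I = two_sided_U_c[of n m h]
  show ?thesis
    unfolding is_omega_def Let_def U_alg_c_def
    by (auto simp: quot_alg_simps[OF I] omega_cls[OF h] anti_simps anti_anti fconst_central)
qed

section \<open>Unitarity\<close>

lemma fock_inner_add_left: "fock_inner (x + y) z = fock_inner x z + fock_inner y z"
  unfolding fock_inner_def by (rule keys_sum_add) (simp_all add: distrib_right)

lemma fock_inner_add_right: "fock_inner x (y + z) = fock_inner x y + fock_inner x z"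
  by (simp add: fock_inner_def lookup_add distrib_left sum.distrib)

lemma fock_inner_scale_right: "fock_inner x (fscale c y) = c * fock_inner x y"
  by (simp add: fock_inner_def sum_distrib_left mult_ac)

lemma fock_inner_scale_left: "fock_inner (fscale c x) y = cnj c * fock_inner x y"
proof (induction x rule: poly_mapping_single_induct)
  case (1 w d)
  have "fock_inner (Poly_Mapping.single w a) y = cnj a * Poly_Mapping.lookup y w" for a
    by (simp add: fock_inner_def)
  then show ?case by (simp add: fscale_ket[symmetric])
next
  case (2 x x')
  then show ?case by (simp add: fock.scale_right_distrib fock_inner_add_left distrib_left)
qed

lemma fock_inner_zero: "fock_inner 0 y = 0" "fock_inner x 0 = 0"
  by (simp_all add: fock_inner_def)

lemma adjoint_on_span:
  assumes ket: "\<And>l k. l \<in> A \<Longrightarrow> k \<in> A \<Longrightarrow> fock_inner (act_c n m a (ket l)) (ket k) = fock_inner (ket l) (act_c n m b (ket k))"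
    and v: "v \<in> fock.span (ket ` A)" and w: "w \<in> fock.span (ket ` A)"
  shows "fock_inner (act_c n m a v) w = fock_inner v (act_c n m b w)"
  using v
proof (induction rule: fock.span_induct_alt)
  case base
  then show ?case by (simp add: act_c_zero fock_inner_zero)
next
  case (step c x y)
  have "fock_inner (act_c n m a x) w = fock_inner x (act_c n m b w)"
    using w
  proof (induction rule: fock.span_induct_alt)
    case base
    then show ?case by (simp add: act_c_zero fock_inner_zero)
  next
    case (step d z z')
    then show ?case using \<open>x \<in> ket ` A\<close> ket
      by (auto simp: act_c_add_right act_c_scale fock_inner_add_right fock_inner_scale_right)
  qed
  with step show ?case
    by (simp add: act_c_add_right act_c_scale fock_inner_add_left fock_inner_scale_left)
qed

text \<open>
  For real \<open>h\<close> the numerator and the denominator of \<open>[k]\<close> have the same sign.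
\<close>

lemma qnum_c_nonneg:
  assumes h: "h \<in> \<real>" shows "qnum_c h (of_nat k) \<in> \<real>\<^sub>\<ge>\<^sub>0"
proof -
  obtain a where a: "h = of_real a" using h by (rule Reals_cases)
  let ?y = "(exp (a * real k / 2) - exp (- (a * real k / 2))) / (exp (a / 2) - exp (- a / 2))"
  have "qnum_c h (of_nat k) = of_real ?y"
    by (simp add: qnum_c_def a exp_of_real[symmetric])
  moreover have "?y \<ge> 0"
  proof (cases "a \<ge> 0")
    case True
    then show ?thesis by (intro divide_nonneg_nonneg) simp_all
  next
    case False
    then show ?thesis by (intro divide_nonpos_nonpos) (simp_all add: mult_nonpos_nonneg)
  qed
  ultimately show ?thesis by (simp only: nonneg_Reals_of_real_iff)
qed

lemma Reals_if_square_nonneg: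
  fixes z :: complex assumes "z ^ 2 \<in> \<real>\<^sub>\<ge>\<^sub>0" shows "z \<in> \<real>"
proof -
  obtain y where y: "z ^ 2 = of_real y" "y \<ge> 0" using assms by (auto elim: nonneg_Reals_cases)
  then have "z ^ 2 = of_real (sqrt y) ^ 2" by (simp flip: of_real_power)
  then have "z = of_real (sqrt y) \<or> z = - of_real (sqrt y)" by (simp add: power2_eq_iff)
  then show ?thesis by auto
qed

lemma amp_Reals: "amp n u i l \<in> \<real>"
  by (simp add: amp_def fsign_def Reals_minus Reals_power)

context
  fixes n m p :: nat and h :: complex and s t :: "complex \<Rightarrow> complex"
  assumes n: "n \<ge> 1" and q: "\<forall>k\<ge>1. exp (h / 2) ^ k \<noteq> 1" and st: "is_roots_c h s t" and h: "h \<in> \<real>"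
begin

interpretation fock_action "\<lambda>x. x" "\<lambda>x. exp (h * x / 2)" "qnum_c h" "exp (h/2) + exp (-h/2)" s t fscale n m p
    "act_c n m" ket "\<lambda>l v. Poly_Mapping.lookup v l" "\<lambda>\<phi>. fgen (Fn \<phi>)" op_c "fconst (of_nat p)" "Fock0_c n m p"
  by (rule fock_action_c[OF n q st])

lemma s_Reals: "s (of_nat k) \<in> \<real>"
  using st qnum_c_nonneg[OF h, of k] unfolding is_roots_c_def by (metis nonneg_Reals_subset_Reals subsetD)

lemma t_Reals: "k \<ge> 1 \<Longrightarrow> t (of_nat k) \<in> \<real>"
proof (rule Reals_if_square_nonneg)
  assume k: "k \<ge> 1"
  then have "(t (of_nat k))\<^sup>2 = qnum_c h (of_nat k) / of_nat k" using st by (simp add: is_roots_c_def)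
  moreover have "qnum_c h (of_nat k) / of_nat k \<in> \<real>\<^sub>\<ge>\<^sub>0"
    using qnum_c_nonneg[OF h, of k] by (intro nonneg_Reals_divide_I) simp_all
  ultimately show "(t (of_nat k))\<^sup>2 \<in> \<real>\<^sub>\<ge>\<^sub>0" by simp
qed

lemma ang_Reals: "k \<ge> 1 \<Longrightarrow> ang n t i (of_nat k) \<in> \<real>"
  by (simp add: ang_def t_Reals)

lemma ec_Reals:
  assumes l: "l \<in> low n m p" and i: "i \<in> {1..<n+m}" shows "ec i l \<in> \<real>"
proof (cases "ec i l = 0")
  case False
  then have a: "eamp n i l \<noteq> 0" by (auto simp: ec_def)
  have "eamp n i l \<in> \<real>" by (simp add: eamp_def amp_Reals)
  have up: "ang n t j (of_nat k + 1) \<in> \<real>" for j k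
    using ang_Reals[of "k + 1" j] by (simp add: add.commute)
  have "wt i (et i l) \<in> \<real>"
  proof (cases "i = 1")
    case True
    have "qtys n m (et i l) \<le> p" using et_sum(1)[OF a i] l by (simp add: low_def)
    then have "s (of_nat p - of_nat (qtys n m (et i l))) \<in> \<real>"
      using s_Reals[of "p - qtys n m (et i l)"] by (simp add: of_nat_diff)
    then show ?thesis unfolding wt_def if_P[OF True] by (intro Reals_mult up)
  next
    case False
    have "ang n t (i - 1) (of_nat (et i l (i - 1))) \<in> \<real>"
      using et_values(2)[OF a _ False] i by (intro ang_Reals) simp
    then show ?thesis unfolding wt_def if_not_P[OF False] by (intro Reals_mult up)
  qed
  then show ?thesis unfolding ec_def using \<open>eamp n i l \<in> \<real>\<close> by (intro Reals_mult)
qed simp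

lemma adjoint_ket:
  assumes l: "l \<in> low n m p" and k: "k \<in> low n m p" and i: "i \<in> {1..<n+m}"
  shows "fock_inner (fscale (ec i l) (ket (et i l))) (ket k) = fock_inner (ket l) (fscale (fc i k) (ket (ft i k)))"
proof -
  have "cnj (ec i l) = ec i l" using ec_Reals[OF l i] by (simp add: Reals_cnj_iff)
  then have L: "fock_inner (fscale (ec i l) (ket (et i l))) (ket k) = (if et i l = k then ec i l else 0)"
    by (simp add: fock_inner_scale_left fock_inner_ket)
  have R: "fock_inner (ket l) (fscale (fc i k) (ket (ft i k))) = (if ft i k = l then fc i k else 0)"
    by (auto simp add: fock_inner_scale_right fock_inner_ket)
  have to: "ft i k = l \<and> fc i k = ec i l" if "et i l = k" "ec i l \<noteq> 0"
    using ec_fc[OF i, of l] et_ft[of n i l] that by (auto simp: ec_def)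
  have from': "et i l = k \<and> ec i l = fc i k" if "ft i k = l" "fc i k \<noteq> 0"
    using fc_ec[OF i, of k] ft_et[of n i k] that by (auto simp: fc_def)
  show ?thesis
  proof (cases "et i l = k \<and> ec i l \<noteq> 0")
    case True
    then show ?thesis unfolding L R using to by presburger
  next
    case False
    then have "(if et i l = k then ec i l else 0) = 0" by argo
    moreover have "(if ft i k = l then fc i k else 0) = 0"
    proof (rule ccontr)
      assume "(if ft i k = l then fc i k else 0) \<noteq> 0"
      then have "ft i k = l" "fc i k \<noteq> 0" by (simp_all split: if_splits)
      from from'[OF this] this(2) False show False by simp
    qed
    ultimately show ?thesis unfolding L R by (simp only:)
  qed
qed

lemma hval_Reals: "hval i l \<in> \<real>"
  by (simp add: hval_def)

lemma adjoint_diag: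
  "c \<in> \<real> \<Longrightarrow> fock_inner (fscale c (ket l)) (ket k) = fock_inner (ket l) (fscale c (ket k))"
  by (simp add: fock_inner_scale_left fock_inner_scale_right Reals_cnj_iff)

lemma adjoint_gen:
  assumes l: "l \<in> low n m p" and k: "k \<in> low n m p"
  shows "fock_inner (act_c n m (gen_c n m h s t (of_nat p) a) (ket l)) (ket k) =
    fock_inner (ket l) (act_c n m (gen_c n m h s t (of_nat p) (swap a)) (ket k))"
proof -
  note gs = gc_simps[OF n q st] and go = gc_out[OF n q st]
  have o: "l \<in> occ n m" "k \<in> occ n m" using l k by (auto simp: low_def)
  have zero: "fock_inner (act_c n m 0 (ket l)) (ket k) = fock_inner (ket l) (act_c n m 0 (ket k))"
    by (simp add: act_c_zero fock_inner_zero)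
  have Fn: "fock_inner (act_c n m (fgen (Fn \<phi>)) (ket l)) (ket k) = fock_inner (ket l) (act_c n m (fgen (Fn \<phi>)) (ket k))"
    if "\<phi> (\<lambda>i. of_nat (l i)) \<in> \<real>" for \<phi>
    using adjoint_diag[OF that, of l k]
    by (cases "l = k") (simp_all add: act_c_fgen act_Fn fock_inner_scale_left fock_inner_scale_right fock_inner_ket)
  have num: "(if i = 1 then of_nat p - tot n m (\<lambda>i. of_nat (l i)) else of_nat (l (i - 1)) :: complex) \<in> \<real>" for i
    by (simp add: tot_of_nat)
  have R: "h * (if i = 1 then of_nat p - tot n m (\<lambda>i. of_nat (l i)) else of_nat (l (i - 1))) / 2 \<in> \<real>" for i
    using h num[of i] by (intro Reals_divide Reals_mult Reals_numeral)
  have expR: "exp (h * (if i = 1 then of_nat p - tot n m (\<lambda>i. of_nat (l i)) else of_nat (l (i - 1))) / 2) \<in> \<real>"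
    "exp (- (h * (if i = 1 then of_nat p - tot n m (\<lambda>i. of_nat (l i)) else of_nat (l (i - 1))) / 2)) \<in> \<real>" for i
    by (rule exp_Reals[OF R], rule exp_Reals[OF Reals_minus[OF R]])
  show ?thesis
  proof (cases a)
    case (CH i)
    show ?thesis
    proof (cases "i \<in> {1..n+m}")
      case True
      show ?thesis unfolding CH swap.simps gs(1)[OF True] hop_kt[OF o(1) True] hop_kt[OF o(2) True]
        using adjoint_diag[OF hval_Reals[of i l], of l k]
        by (cases "l = k") (simp_all add: fock_inner_scale_left fock_inner_scale_right fock_inner_ket)
    next
      case False
      show ?thesis unfolding CH swap.simps go(1)[OF False] by (rule zero)
    qed
  next
    case (CE i)
    show ?thesis
    proof (cases "i \<in> {1..<n+m}")
      case True
      show ?thesis unfolding CE swap.simps gs(2,3)[OF True] eop_kt[OF o(1) True] fop_kt[OF o(2) True]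
        by (rule adjoint_ket[OF l k True])
    next
      case False
      show ?thesis unfolding CE swap.simps go(2,3)[OF False] by (rule zero)
    qed
  next
    case (CF i)
    show ?thesis
    proof (cases "i \<in> {1..<n+m}")
      case True
      have sym: "fock_inner x y = cnj (fock_inner y x)" if "x = fscale a (ket j)" "y = fscale b (ket j')" for x y a b j j'
        by (simp add: that fock_inner_scale_left fock_inner_scale_right fock_inner_ket of_bool_def)
      have "fock_inner (fscale (fc i l) (ket (ft i l))) (fscale 1 (ket k)) = fock_inner (fscale 1 (ket l)) (fscale (ec i k) (ket (et i k)))"
        using adjoint_ket[OF k l True] sym[OF refl refl, of "fc i l" "ft i l" 1 k] sym[OF refl refl, of 1 l "ec i k" "et i k"]
        by simp
      then show ?thesis unfolding CF swap.simps gs(2,3)[OF True] eop_kt[OF o(2) True] fop_kt[OF o(1) True] by simp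
    next
      case False
      show ?thesis unfolding CF swap.simps go(2,3)[OF False] by (rule zero)
    qed
  next
    case (CQ i)
    then show ?thesis using Fn expR(1)[of i] zero by (cases "i \<in> {1..n+m}") (simp_all only: gen_c_def Let_def cgen.case swap.simps simp_thms if_True if_False)
  next
    case (CQi i)
    then show ?thesis using Fn expR(2)[of i] zero by (cases "i \<in> {1..n+m}") (simp_all only: gen_c_def Let_def cgen.case swap.simps simp_thms if_True if_False)
  qed
qed

text \<open>
  On the generators this is the symmetry of the matrix elements. It extends to products because \<open>F\<^sub>0\<close> is
  invariant.
\<close>

lemma adjoint_all:
  assumes v: "v \<in> Fock0_c n m p" and w: "w \<in> Fock0_c n m p"
  shows "fock_inner (act_c n m (subst fconst (gen_c n m h s t (of_nat p)) x) v) w =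
    fock_inner v (act_c n m (subst fconst (gen_c n m h s t (of_nat p)) (anti x)) w)"
  using v w
proof (induction x arbitrary: v w rule: free_alg_induct)
  case (const c)
  show ?case
    unfolding anti_simps Sc_simps[OF n q st] act_c_fconst fock_inner_scale_left fock_inner_scale_right ..
next
  case (gen a)
  then show ?case
    unfolding anti_simps Sc_simps[OF n q st] Fock0_c_low
    by (intro adjoint_on_span[OF adjoint_gen])
next
  case (add a b)
  then show ?case
    by (simp only: anti_simps Sc_simps[OF n q st] act_c_add_left fock_inner_add_left fock_inner_add_right)
next
  case (mult a b)
  note inv = Sc_invariant[OF n q st Fock0_c_eq]
  show ?case
    using mult.IH(1)[OF inv[OF mult.prems(1)] mult.prems(2), of b] mult.IH(2)[OF mult.prems(1) inv[OF mult.prems(2)], of "anti a"]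
    by (simp only: anti_simps Sc_simps[OF n q st] act_c_mult)
qed

lemma unitary:
  assumes \<pi>: "is_pi_c n m h s t (of_nat p) \<pi>" and a: "a \<in> carrier (U_alg_c n m h)"
    and v: "v \<in> Fock0_c n m p" and w: "w \<in> Fock0_c n m p"
  shows "fock_inner (Fock_act_c n m (\<pi> a) v) w = fock_inner v (Fock_act_c n m (\<pi> (omega n m h a)) w)"
proof -
  obtain x where x: "a = cls (U_ideal_c n m h) x"
    using a by (auto simp: U_alg_c_def carrier_quot_alg[OF two_sided_U_c])
  have FS: "v \<in> FS n m" "w \<in> FS n m" using v w Fock_subset_FS by blast+
  show ?thesis
    unfolding x omega_cls[OF h] pi_c_act[OF n q st \<pi> FS(1)] pi_c_act[OF n q st \<pi> FS(2)]
    by (rule adjoint_all[OF v w])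
qed

end

theorem proposition2:
  fixes n m :: nat
  assumes "n \<ge> 1" and "n + m \<ge> 2"
  shows
    "(\<forall>s t. is_roots_h s t \<longrightarrow>
       (\<forall>p::complex. \<exists>\<pi>. is_pi_h n m s t p \<pi>) \<and>
       (\<forall>(p::nat) \<pi>. p \<ge> 1 \<and> is_pi_h n m s t (of_nat p) \<pi> \<longrightarrow>
          (let A = U_alg_h n m; \<rho> = (\<lambda>a. Fock_act_h n m (\<pi> a)) in
            invariant A \<rho> (Fock0_h n m p) \<and> invariant A \<rho> (Fock1_h n m p) \<and>
            rep_on A fscale_h (Fock0_h n m p) \<rho> \<and>
            fin_dim fscale_h (Fock0_h n m p) \<and>
            irreducible_h A (Fock0_h n m p) \<rho>)) \<and>
       (\<forall>(p::nat) (p'::nat) \<pi> \<pi>'. p \<ge> 1 \<and> p' \<ge> 1 \<and> p \<noteq> p' \<and>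
            is_pi_h n m s t (of_nat p) \<pi> \<and> is_pi_h n m s t (of_nat p') \<pi>' \<longrightarrow>
          \<not> equivalent_reps (U_alg_h n m) fscale_h
              (Fock0_h n m p) (\<lambda>a. Fock_act_h n m (\<pi> a))
              (Fock0_h n m p') (\<lambda>a. Fock_act_h n m (\<pi>' a))))
   \<and> (\<forall>(h::complex) s t. (\<forall>k\<ge>1. exp (h / 2) ^ k \<noteq> 1) \<and> is_roots_c h s t \<longrightarrow>
       (\<forall>p::complex. \<exists>\<pi>. is_pi_c n m h s t p \<pi>) \<and>
       (\<forall>(p::nat) \<pi>. p \<ge> 1 \<and> is_pi_c n m h s t (of_nat p) \<pi> \<longrightarrow>
          (let A = U_alg_c n m h; \<rho> = (\<lambda>a. Fock_act_c n m (\<pi> a)) in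
            invariant A \<rho> (Fock0_c n m p) \<and> invariant A \<rho> (Fock1_c n m p) \<and>
            rep_on A fscale (Fock0_c n m p) \<rho> \<and>
            fin_dim fscale (Fock0_c n m p) \<and>
            irreducible_c A (Fock0_c n m p) \<rho>)) \<and>
       (h \<in> \<real> \<longrightarrow>
          (\<exists>\<omega>. is_omega n m h \<omega> \<and>
             (\<forall>(p::nat) \<pi>. p \<ge> 1 \<and> is_pi_c n m h s t (of_nat p) \<pi> \<longrightarrow>
                (\<forall>a\<in>carrier (U_alg_c n m h). \<forall>x\<in>Fock0_c n m p. \<forall>y\<in>Fock0_c n m p.
                   fock_inner (Fock_act_c n m (\<pi> a) x) y =
                   fock_inner x (Fock_act_c n m (\<pi> (\<omega> a)) y))))) \<and>
       (\<forall>(p::nat) (p'::nat) \<pi> \<pi>'. p \<ge> 1 \<and> p' \<ge> 1 \<and> p \<noteq> p' \<and>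
            is_pi_c n m h s t (of_nat p) \<pi> \<and> is_pi_c n m h s t (of_nat p') \<pi>' \<longrightarrow>
          \<not> equivalent_reps (U_alg_c n m h) fscale
              (Fock0_c n m p) (\<lambda>a. Fock_act_c n m (\<pi> a))
              (Fock0_c n m p') (\<lambda>a. Fock_act_c n m (\<pi>' a))))"
proof (intro conjI allI impI)
  fix s t :: "complex \<Rightarrow> complex fps" and p :: complex assume st: "is_roots_h s t"
  show "\<exists>\<pi>. is_pi_h n m s t p \<pi>" by (rule pi_h_exists[OF assms(1) st])
next
  fix s t :: "complex \<Rightarrow> complex fps" and p :: nat and \<pi>
  assume st: "is_roots_h s t" and \<pi>: "p \<ge> 1 \<and> is_pi_h n m s t (of_nat p) \<pi>"
  note r = rep_h[OF assms(1) st conjunct2[OF \<pi>]]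
  show "let A = U_alg_h n m; \<rho> = (\<lambda>a. Fock_act_h n m (\<pi> a)) in
      invariant A \<rho> (Fock0_h n m p) \<and> invariant A \<rho> (Fock1_h n m p) \<and>
      rep_on A fscale_h (Fock0_h n m p) \<rho> \<and> fin_dim fscale_h (Fock0_h n m p) \<and>
      irreducible_h A (Fock0_h n m p) \<rho>"
    unfolding Let_def
    by (intro conjI r(2)[OF disjI1[OF refl]] r(2)[OF disjI2[OF refl]] r(1)[OF disjI1[OF refl]]
        fin_dim_h[OF assms(1) st] irreducible_h[OF assms(1) st conjunct2[OF \<pi>]])
next
  fix s t :: "complex \<Rightarrow> complex fps" and p p' :: nat and \<pi> \<pi>'
  assume st: "is_roots_h s t" and \<pi>: "p \<ge> 1 \<and> p' \<ge> 1 \<and> p \<noteq> p' \<and>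
            is_pi_h n m s t (of_nat p) \<pi> \<and> is_pi_h n m s t (of_nat p') \<pi>'"
  then show "\<not> equivalent_reps (U_alg_h n m) fscale_h
              (Fock0_h n m p) (\<lambda>a. Fock_act_h n m (\<pi> a))
              (Fock0_h n m p') (\<lambda>a. Fock_act_h n m (\<pi>' a))"
    by (intro inequivalent_h[OF assms(1) st]) auto
next
  fix h p :: complex and s t :: "complex \<Rightarrow> complex"
  assume st: "(\<forall>k\<ge>1. exp (h / 2) ^ k \<noteq> 1) \<and> is_roots_c h s t"
  show "\<exists>\<pi>. is_pi_c n m h s t p \<pi>" by (rule pi_c_exists[OF assms(1) conjunct1[OF st] conjunct2[OF st]])
next
  fix h :: complex and s t :: "complex \<Rightarrow> complex" and p :: nat and \<pi>
  assume st: "(\<forall>k\<ge>1. exp (h / 2) ^ k \<noteq> 1) \<and> is_roots_c h s t"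
    and \<pi>: "p \<ge> 1 \<and> is_pi_c n m h s t (of_nat p) \<pi>"
  note st' = conjunct1[OF st] conjunct2[OF st]
  note r = rep_c[OF assms(1) st' conjunct2[OF \<pi>]]
  show "let A = U_alg_c n m h; \<rho> = (\<lambda>a. Fock_act_c n m (\<pi> a)) in
      invariant A \<rho> (Fock0_c n m p) \<and> invariant A \<rho> (Fock1_c n m p) \<and>
      rep_on A fscale (Fock0_c n m p) \<rho> \<and> fin_dim fscale (Fock0_c n m p) \<and>
      irreducible_c A (Fock0_c n m p) \<rho>"
    unfolding Let_def
    by (intro conjI r(2)[OF disjI1[OF refl]] r(2)[OF disjI2[OF refl]] r(1)[OF disjI1[OF refl]]
        fin_dim_c[OF assms(1) st'] irreducible_c[OF assms(1) st' conjunct2[OF \<pi>]])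
next
  fix h :: complex and s t :: "complex \<Rightarrow> complex"
  assume st: "(\<forall>k\<ge>1. exp (h / 2) ^ k \<noteq> 1) \<and> is_roots_c h s t" and h: "h \<in> \<real>"
  show "\<exists>\<omega>. is_omega n m h \<omega> \<and>
             (\<forall>(p::nat) \<pi>. p \<ge> 1 \<and> is_pi_c n m h s t (of_nat p) \<pi> \<longrightarrow>
                (\<forall>a\<in>carrier (U_alg_c n m h). \<forall>x\<in>Fock0_c n m p. \<forall>y\<in>Fock0_c n m p.
                   fock_inner (Fock_act_c n m (\<pi> a) x) y =
                   fock_inner x (Fock_act_c n m (\<pi> (\<omega> a)) y)))"
    using is_omega_omega[OF h] unitary[OF assms(1) conjunct1[OF st] conjunct2[OF st] h] by blast
next
  fix h :: complex and s t :: "complex \<Rightarrow> complex" and p p' :: nat and \<pi> \<pi>'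
  assume st: "(\<forall>k\<ge>1. exp (h / 2) ^ k \<noteq> 1) \<and> is_roots_c h s t"
    and \<pi>: "p \<ge> 1 \<and> p' \<ge> 1 \<and> p \<noteq> p' \<and>
            is_pi_c n m h s t (of_nat p) \<pi> \<and> is_pi_c n m h s t (of_nat p') \<pi>'"
  then show "\<not> equivalent_reps (U_alg_c n m h) fscale
              (Fock0_c n m p) (\<lambda>a. Fock_act_c n m (\<pi> a))
              (Fock0_c n m p') (\<lambda>a. Fock_act_c n m (\<pi>' a))"
    by (intro inequivalent_c[OF assms(1) conjunct1[OF st] conjunct2[OF st]]) auto
qed

end
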